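(* Let $\mathscr{H}_L$ be the affine Hecke algebra attached to $(R,L)$ and a parameter system $(q_i)$. Let $t\in\mathrm{Hom}(L,\mathbb{C}^\times)$ and let $J\subseteq N(t)$. Suppose that $F_J(t)\neq\emptyset$ and that each $wt$ with $w\in F_J(t)$ is $(i,j)$-calibratable for each pair $(\alpha_i,\alpha_j)$ of simple roots of $R$. Let $M_J(t)$ be the complex vector space with basis $\{e_{wt}\mid w\in F_J(t)\}$ (indexed by the set of weights $\{wt\mid w\in F_J(t)\}$), and define linear operators $\tilde T_i$ ($i=1,\dots,n$) and $\tilde x^\lambda$ ($\lambda\in L$) on $M_J(t)$ by linearly extending $$\tilde x^\lambda e_{wt}=(wt)^\lambda e_{wt}\quad(\lambda\in L),\qquad \tilde T_i e_{wt}=q_i^{1/2}c_i'(wt)\,e_{wt}+q_i^{1/2}c_i(wt)\,e_{s_iwt}\quad(1\le i\le n),$$ with the convention that $e_{vt}=0$ if $v\notin F_J(t)$. Then the map $\mathscr{H}_L\to\mathrm{End}(M_J(t))$ with $T_i\mapsto\tilde T_i$ and $x^\lambda\mapsto\tilde x^\lambda$ defines an irreducible calibrated representation of $\mathscr{H}_L$.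
   Context: Root data. $R$ is an irreducible, not necessarily reduced, finite crystallographic root system in an $n$-dimensional real inner product space $V$, with simple roots $\alpha_1,\dots,\alpha_n$ and positive roots $R^+$; $\alpha^\vee=2\alpha/\langle\alpha,\alpha\rangle$; $s_\alpha(\lambda)=\lambda-\langle\lambda,\alpha\rangle\alpha^\vee$; $s_i=s_{\alpha_i}$; $W_0=\langle s_1,\dots,s_n\rangle$ is the Weyl group. $Q$ is the $\mathbb{Z}$-span of $R^\vee=\{\alpha^\vee\mid\alpha\in R\}$, $P=\{\lambda\in V\mid\langle\lambda,\alpha\rangle\in\mathbb{Z}\ \forall\alpha\in R\}$, and $L$ is a lattice with $Q\subseteq L\subseteq P$. Put $R_1=\{\alpha\in R\mid \alpha/2\notin R,\ 2\alpha\notin R\}$, $R_2=\{\alpha\in R\mid 2\alpha\in R\}$, $R_0=R_1\cup R_2$, $R_0^+=R_0\cap R^+$ (if $R$ is reduced, $R_0=R_1=R$). If $R$ is non-reduced it is of type $BC_n$: $R=\pm\{e_i-e_j,e_i+e_j,e_k,2e_k\mid i<j\}$ with $\alpha_i=e_i-e_{i+1}$ ($i<n$), $\alpha_n=e_n$. For $w\in W_0$, $R(w)=\{\alpha\in R_0^+\mid w^{-1}\alpha\in -R_0^+\}$. Parameters. $q_0,q_1,\dots,q_n\in\mathbb{C}^\times$ with $q_i=q_j$ whenever $s_i,s_j$ are conjugate in the affine Weyl group (only $q_1,\dots,q_n$ are needed when $R$ is reduced), with fixed square roots. For $\alpha\in R_0$, $q_\alpha=q_i$ if $\alpha\in W_0\alpha_i$.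 Functions. $\mathbb{C}[L]$ is the group algebra of $L$ with basis $x^\lambda$. For $\alpha\in R_1$: $c_\alpha(x)=\frac{1-q_\alpha^{-1}x^{-\alpha^\vee}}{1-x^{-\alpha^\vee}}$ and $c'_\alpha(x)=\frac{1-q_\alpha^{-1}}{1-x^{-\alpha^\vee}}$. For $\alpha\in R_2$: $c_\alpha(x)=\frac{(1-q_0^{-1/2}q_n^{-1/2}x^{-\alpha^\vee/2})(1+q_0^{1/2}q_n^{-1/2}x^{-\alpha^\vee/2})}{1-x^{-\alpha^\vee}}$ and $c'_\alpha(x)=\frac{1-q_n^{-1}+q_n^{-1/2}(q_0^{1/2}-q_0^{-1/2})x^{-\alpha^\vee/2}}{1-x^{-\alpha^\vee}}$. Write $c_\alpha(x)=n_\alpha(x)/d_\alpha(x)$ with $n_\alpha,d_\alpha\in\mathbb{C}[L]$ relatively prime. $c_i=c_{\alpha_i}$, $c_i'=c'_{\alpha_i}$. For $t\in\mathrm{Hom}(L,\mathbb{C}^\times)$ write $t^\lambda=t(\lambda)$; $f(t)$ denotes the value of $f$ under $x^\lambda\mapsto t^\lambda$; $W_0$ acts by $(wt)^\lambda=t^{w^{-1}\lambda}$. Algebra. $\mathscr{H}_L$ is the $\mathbb{C}$-algebra with basis $\{T_wx^\lambda\mid w\in W_0,\lambda\in L\}$ ($T_w=T_{i_1}\cdots T_{i_\ell}$ for $w=s_{i_1}\cdots s_{i_\ell}$ reduced) and relations $T_i^2=1+(q_i^{1/2}-q_i^{-1/2})T_i$; the braid relations $T_iT_jT_i\cdots=T_jT_iT_j\cdots$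 ($m_{ij}$ factors, $m_{ij}$ the order of $s_is_j$); $x^\lambda x^\mu=x^{\lambda+\mu}$; $T_ix^\lambda-x^{s_i\lambda}T_i=q_i^{1/2}c_i'(x)(x^\lambda-x^{s_i\lambda})$ for $1\le i\le n$, $\lambda\in L$. A finite-dimensional module $M$ is calibrated if for each $t$ the generalised weight space $\{v\mid\forall\lambda\,\exists k>0:(x^\lambda-t^\lambda)^kv=0\}$ equals the weight space $\{v\mid x^\lambda v=t^\lambda v\ \forall\lambda\}$. Sets. $N(t)=\{\alpha\in R_0^+\mid n_\alpha(t)n_{-\alpha}(t)=0\}$, $D(t)=\{\alpha\in R_0^+\mid d_\alpha(t)=0\}$, and for $J\subseteq N(t)$, $F_J(t)=\{w\in W_0\mid R(w^{-1})\cap N(t)=J\text{ and }R(w^{-1})\cap D(t)=\emptyset\}$. Calibratable. Let $R_{ij}$ be the intersection of $R$ with the $\mathbb{Z}$-span of $\{\alpha_i,\alpha_j\}$ and $W_{ij}=\langle s_i,s_j\rangle$. $t$ is $(i,j)$-regular if $(wt)^{\alpha_i^\vee}\ne1$ and $(wt)^{\alpha_j^\vee}\neq 1$ for all $w\in W_{ij}$. $t$ is $(i,j)$-calibratable if one of the following holds: (1) $t$ is $(i,j)$-regular. (2) $R_{ij}$ is of type $C_2$ ($\alpha_i$ short, $\alpha_j$ long) and either (a) $q_i=q_j$ and $(t^{\alpha_i^\vee},t^{\alpha_j^\vee})=(q_i,q_i^{-1})$ or $(q_i^{-1},q_i)$; or (b) $q_i=q_j^2$ and $(t^{\alpha_i^\vee},t^{\alpha_j^\vee})=(q_j^{-2},q_j)$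 or $(q_j^{2},q_j^{-1})$. (3) $R_{ij}$ is of type $G_2$ ($\alpha_i$ short, $\alpha_j$ long) and either (a) $q_i=q_j$ and $(t^{\alpha_i^\vee},t^{\alpha_j^\vee})\in\{(q_i^{-1},q_i),(q_i,q_i^{-1}),(q_i^2,q_i^{-1}),(q_i^{-2},q_i)\}$; or (b) $q_i=q_j^3$ and $(t^{\alpha_i^\vee},t^{\alpha_j^\vee})\in\{(q_j^3,q_j^{-1}),(q_j^{-3},q_j),(q_j^{-3},q_j^2),(q_j^3,q_j^{-2})\}$. (4) $R_{ij}$ is of type $BC_2$ ($\alpha_i$ middle-length, $\alpha_j$ short, so $j=n$) and one of: (a) $q_i=q_0q_j$ and $(t^{\alpha_i^\vee},t^{\alpha_j^\vee/2})=(q_0q_j,q_0^{-1/2}q_j^{-1/2})$ or $(q_0^{-1}q_j^{-1},q_0^{1/2}q_j^{1/2})$; (b) $q_i=q_0q_j^{-1}$ or $q_0^{-1}q_j$, and $(t^{\alpha_i^\vee},t^{\alpha_j^\vee/2})=(q_0^{-1}q_j,-q_0^{1/2}q_j^{-1/2})$ or $(q_0q_j^{-1},-q_0^{-1/2}q_j^{1/2})$; (c) $q_i=q_0^{1/2}q_j^{1/2}$ and $(t^{\alpha_i^\vee},t^{\alpha_j^\vee/2})=(q_i^{-1},q_i)$ or $(q_i,q_i^{-1})$; (d) $q_i=q_0^{-1/2}q_j^{1/2}$ or $q_0^{1/2}q_j^{-1/2}$, and $(t^{\alpha_i^\vee},t^{\alpha_j^\vee/2})=(q_i^{-1},-q_i)$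 or $(q_i,-q_i^{-1})$.
   Formalization: It is additionally assumed that d_{α_i}(wt) ≠ 0 for all w in F_J(t) and 1 ≤ i ≤ n, so that c_i(wt) and c_i'(wt) are defined; otherwise the formula for T̃_i can have a pole (e.g. type G_2 with q_1=q_2=−1, or n=1 and t=1). *)

theory Defs
  imports "HOL-Analysis.Analysis" "HOL-Library.Poly_Mapping"
begin

section \<open>Root systems\<close>

definition coroot :: "'v::real_inner \<Rightarrow> 'v" where
  "coroot \<alpha> = (2 / (\<alpha> \<bullet> \<alpha>)) *\<^sub>R \<alpha>"

definition reflection :: "'v::real_inner \<Rightarrow> 'v \<Rightarrow> 'v" where
  "reflection \<alpha> v = v - (v \<bullet> \<alpha>) *\<^sub>R coroot \<alpha>"

definition root_system :: "'v::euclidean_space set \<Rightarrow> bool" where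
  "root_system R \<longleftrightarrow> finite R \<and> 0 \<notin> R \<and> span R = UNIV \<and>
     (\<forall>\<alpha>\<in>R. \<forall>\<beta>\<in>R. reflection \<alpha> \<beta> \<in> R) \<and>
     (\<forall>\<alpha>\<in>R. \<forall>\<beta>\<in>R. \<beta> \<bullet> coroot \<alpha> \<in> \<int>)"

definition irreducible_root_system :: "'v::euclidean_space set \<Rightarrow> bool" where
  "irreducible_root_system R \<longleftrightarrow> root_system R \<and> R \<noteq> {} \<and>
     \<not> (\<exists>A B. R = A \<union> B \<and> A \<noteq> {} \<and> B \<noteq> {} \<and> (\<forall>a\<in>A. \<forall>b\<in>B. a \<bullet> b = 0))"

definition int_span :: "'v::real_vector set \<Rightarrow> 'v set" where
  "int_span S = {(\<Sum>s\<in>A. of_int (k s) *\<^sub>R s) | A (k :: 'v \<Rightarrow> int). finite A \<and> A \<subseteq> S}"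

definition pm :: "'v::uminus set \<Rightarrow> 'v set" where
  "pm S = S \<union> uminus ` S"

text \<open>
  The data \<open>(R, \<alpha>\<^sub>1, \<dots>, \<alpha>\<^sub>n, L, q\<^sub>0, \<dots>, q\<^sub>n)\<close>, with \<open>n = DIM('v)\<close>, together with the fixed
  square roots \<open>qroot D i\<close> of the parameters \<open>qpar D i\<close>. Simple roots are used at the indices
  \<open>1, \<dots>, n\<close>, parameters at the indices \<open>0, \<dots>, n\<close>.
\<close>

record 'v hecke_data =
  roots :: "'v set"
  sroot :: "nat \<Rightarrow> 'v"
  lat :: "'v set"
  qpar :: "nat \<Rightarrow> complex"
  qroot :: "nat \<Rightarrow> complex"

definition idx :: "'v::euclidean_space hecke_data \<Rightarrow> nat set" where
  "idx D = {1..DIM('v)}"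

definition nonneg_comb :: "'v::euclidean_space hecke_data \<Rightarrow> 'v set" where
  "nonneg_comb D = {(\<Sum>i\<in>idx D. real (k i) *\<^sub>R sroot D i) | k :: nat \<Rightarrow> nat. True}"

definition simple_system :: "'v::euclidean_space hecke_data \<Rightarrow> bool" where
  "simple_system D \<longleftrightarrow> inj_on (sroot D) (idx D) \<and> independent (sroot D ` idx D) \<and>
     sroot D ` idx D \<subseteq> roots D \<and>
     (\<forall>\<beta>\<in>roots D. \<beta> \<in> nonneg_comb D \<or> - \<beta> \<in> nonneg_comb D)"

definition non_reduced :: "'v::euclidean_space hecke_data \<Rightarrow> bool" where
  "non_reduced D \<longleftrightarrow> (\<exists>\<alpha>\<in>roots D. 2 *\<^sub>R \<alpha> \<in> roots D)"

text \<open>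
  The standard coordinates and numbering of type \<open>BC\<^sub>n\<close>. The vectors \<open>e\<^sub>i\<close> are orthogonal of a
  common length, not necessarily 1, so that rescaled copies of the root system are included.
\<close>

definition BC_coordinates :: "'v::euclidean_space hecke_data \<Rightarrow> bool" where
  "BC_coordinates D \<longleftrightarrow> (\<exists>(e :: nat \<Rightarrow> 'v) (c :: real). c > 0 \<and>
     (\<forall>i\<in>idx D. \<forall>j\<in>idx D. e i \<bullet> e j = (if i = j then c else 0)) \<and>
     roots D = pm ({e i - e j | i j. i \<in> idx D \<and> j \<in> idx D \<and> i < j} \<union>
                   {e i + e j | i j. i \<in> idx D \<and> j \<in> idx D \<and> i < j} \<union>
                   {e k | k. k \<in> idx D} \<union> {2 *\<^sub>R e k | k. k \<in> idx D}) \<and>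
     (\<forall>i\<in>idx D. sroot D i = (if i < DIM('v) then e i - e (i + 1) else e i)))"

definition pos_roots :: "'v::euclidean_space hecke_data \<Rightarrow> 'v set" where
  "pos_roots D = roots D \<inter> nonneg_comb D"

definition coroot_lattice :: "'v::euclidean_space hecke_data \<Rightarrow> 'v set" where
  "coroot_lattice D = int_span (coroot ` roots D)"

definition coweight_lattice :: "'v::euclidean_space hecke_data \<Rightarrow> 'v set" where
  "coweight_lattice D = {v. \<forall>\<alpha>\<in>roots D. v \<bullet> \<alpha> \<in> \<int>}"

definition R1 :: "'v::euclidean_space hecke_data \<Rightarrow> 'v set" where
  "R1 D = {\<alpha>\<in>roots D. (1/2) *\<^sub>R \<alpha> \<notin> roots D \<and> 2 *\<^sub>R \<alpha> \<notin> roots D}"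

definition R2 :: "'v::euclidean_space hecke_data \<Rightarrow> 'v set" where
  "R2 D = {\<alpha>\<in>roots D. 2 *\<^sub>R \<alpha> \<in> roots D}"

definition R0 :: "'v::euclidean_space hecke_data \<Rightarrow> 'v set" where
  "R0 D = R1 D \<union> R2 D"

definition R0_pos :: "'v::euclidean_space hecke_data \<Rightarrow> 'v set" where
  "R0_pos D = R0 D \<inter> pos_roots D"


section \<open>Weyl groups\<close>

definition srefl :: "'v::euclidean_space hecke_data \<Rightarrow> nat \<Rightarrow> 'v \<Rightarrow> 'v" where
  "srefl D i = reflection (sroot D i)"

definition word_elt :: "'v::euclidean_space hecke_data \<Rightarrow> nat list \<Rightarrow> 'v \<Rightarrow> 'v" where
  "word_elt D is = foldr (\<lambda>i g. srefl D i \<circ> g) is id"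

text \<open>As the \<open>s\<^sub>i\<close> are involutions, the words in \<open>{s\<^sub>i | i \<in> I}\<close> already form a group.\<close>

definition parabolic :: "'v::euclidean_space hecke_data \<Rightarrow> nat set \<Rightarrow> ('v \<Rightarrow> 'v) set" where
  "parabolic D I = {word_elt D is | is. set is \<subseteq> I}"

definition W0 :: "'v::euclidean_space hecke_data \<Rightarrow> ('v \<Rightarrow> 'v) set" where
  "W0 D = parabolic D (idx D)"

definition reduced_word :: "'v::euclidean_space hecke_data \<Rightarrow> nat list \<Rightarrow> bool" where
  "reduced_word D is \<longleftrightarrow> set is \<subseteq> idx D \<and>
     (\<forall>js. set js \<subseteq> idx D \<and> word_elt D js = word_elt D is \<longrightarrow> length is \<le> length js)"

definition coxeter_order :: "'v::euclidean_space hecke_data \<Rightarrow> nat \<Rightarrow> nat \<Rightarrow> nat" where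
  "coxeter_order D i j = (LEAST m. m > 0 \<and> (srefl D i \<circ> srefl D j) ^^ m = id)"

definition inversions :: "'v::euclidean_space hecke_data \<Rightarrow> ('v \<Rightarrow> 'v) \<Rightarrow> 'v set" where
  "inversions D w = {\<alpha>\<in>R0_pos D. inv w \<alpha> \<in> uminus ` R0_pos D}"

definition highest_root :: "'v::euclidean_space hecke_data \<Rightarrow> 'v" where
  "highest_root D = (THE \<phi>. \<phi> \<in> roots D \<and> (\<forall>\<beta>\<in>roots D. \<phi> - \<beta> \<in> nonneg_comb D))"

text \<open>
  The affine Weyl group is \<open>Q \<rtimes> W\<^sub>0\<close>, acting on \<open>V\<close> by affine maps; its Coxeter generators are
  \<open>s\<^sub>1, \<dots>, s\<^sub>n\<close> and \<open>s\<^sub>0\<close>, the composite of \<open>s\<^sub>\<phi>\<close> and the translation by \<open>\<phi>\<^sup>\<or>\<close> for the highest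
  root \<open>\<phi>\<close>.
\<close>

definition affine_weyl :: "'v::euclidean_space hecke_data \<Rightarrow> ('v \<Rightarrow> 'v) set" where
  "affine_weyl D = {(\<lambda>v. w v + \<mu>) | w \<mu>. w \<in> W0 D \<and> \<mu> \<in> coroot_lattice D}"

definition affine_refl :: "'v::euclidean_space hecke_data \<Rightarrow> nat \<Rightarrow> 'v \<Rightarrow> 'v" where
  "affine_refl D i = (if i = 0
     then (\<lambda>v. reflection (highest_root D) v + coroot (highest_root D))
     else srefl D i)"

definition affine_conj :: "'v::euclidean_space hecke_data \<Rightarrow> nat \<Rightarrow> nat \<Rightarrow> bool" where
  "affine_conj D i j \<longleftrightarrow>
     (\<exists>g\<in>affine_weyl D. g \<circ> affine_refl D i \<circ> inv g = affine_refl D j)"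

text \<open>
  The square roots are chosen per conjugacy class, i.e. \<open>q\<^sub>i\<^sup>1\<^sup>/\<^sup>2 = q\<^sub>j\<^sup>1\<^sup>/\<^sup>2\<close> for conjugate
  \<open>s\<^sub>i, s\<^sub>j\<close>; otherwise the quadratic and braid relations would be inconsistent.
\<close>

definition hecke_datum :: "'v::euclidean_space hecke_data \<Rightarrow> bool" where
  "hecke_datum D \<longleftrightarrow>
     irreducible_root_system (roots D) \<and> simple_system D \<and>
     (non_reduced D \<longrightarrow> BC_coordinates D) \<and>
     (\<forall>\<mu>\<in>lat D. \<forall>\<nu>\<in>lat D. \<mu> - \<nu> \<in> lat D) \<and>
     coroot_lattice D \<subseteq> lat D \<and> lat D \<subseteq> coweight_lattice D \<and>
     (\<forall>i\<in>{0..DIM('v)}. qpar D i \<noteq> 0 \<and> (qroot D i)\<^sup>2 = qpar D i) \<and>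
     (\<forall>i\<in>{0..DIM('v)}. \<forall>j\<in>{0..DIM('v)}. affine_conj D i j \<longrightarrow>
        qpar D i = qpar D j \<and> qroot D i = qroot D j)"

definition q_root :: "'v::euclidean_space hecke_data \<Rightarrow> 'v \<Rightarrow> complex" where
  "q_root D \<alpha> = qpar D (SOME i. i \<in> idx D \<and> (\<exists>w\<in>W0 D. \<alpha> = w (sroot D i)))"


section \<open>The group algebra and the functions c and c'\<close>

text \<open>
  The group algebra of the additive group \<open>V\<close> is \<open>'v \<Rightarrow>\<^sub>0 complex\<close> with the convolution product;
  the group algebra of \<open>L\<close> is the subalgebra of elements supported in \<open>L\<close>.
\<close>

definition group_alg :: "'v::euclidean_space hecke_data \<Rightarrow> ('v \<Rightarrow>\<^sub>0 complex) set" where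
  "group_alg D = {f. Poly_Mapping.keys f \<subseteq> lat D}"

abbreviation xpow :: "'v \<Rightarrow> 'v::euclidean_space \<Rightarrow>\<^sub>0 complex" where
  "xpow \<mu> \<equiv> Poly_Mapping.single \<mu> 1"

definition scal :: "complex \<Rightarrow> ('k \<Rightarrow>\<^sub>0 complex) \<Rightarrow> ('k \<Rightarrow>\<^sub>0 complex)" where
  "scal c f = Poly_Mapping.map (\<lambda>z. c * z) f"

definition characters :: "'v::euclidean_space hecke_data \<Rightarrow> ('v \<Rightarrow> complex) set" where
  "characters D = {t \<in> lat D \<rightarrow>\<^sub>E (UNIV - {0}). \<forall>\<mu>\<in>lat D. \<forall>\<nu>\<in>lat D. t (\<mu> + \<nu>) = t \<mu> * t \<nu>}"

definition act :: "('v \<Rightarrow> 'v) \<Rightarrow> ('v \<Rightarrow> complex) \<Rightarrow> ('v \<Rightarrow> complex)" where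
  "act w t = (\<lambda>\<mu>. t (inv w \<mu>))"

definition ga_eval :: "('v \<Rightarrow>\<^sub>0 complex) \<Rightarrow> ('v \<Rightarrow> complex) \<Rightarrow> complex" where
  "ga_eval f t = (\<Sum>\<mu>\<in>Poly_Mapping.keys f. Poly_Mapping.lookup f \<mu> * t \<mu>)"

definition rel_prime ::
  "'v::euclidean_space hecke_data \<Rightarrow> ('v \<Rightarrow>\<^sub>0 complex) \<Rightarrow> ('v \<Rightarrow>\<^sub>0 complex) \<Rightarrow> bool" where
  "rel_prime D f g \<longleftrightarrow> (\<forall>p\<in>group_alg D.
     (\<exists>k\<in>group_alg D. f = p * k) \<and> (\<exists>k\<in>group_alg D. g = p * k) \<longrightarrow>
     (\<exists>k\<in>group_alg D. p * k = 1))"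

text \<open>A representation of the fraction \<open>f/g\<close> in lowest terms; it is unique up to units.\<close>

definition lowest_terms :: "'v::euclidean_space hecke_data \<Rightarrow> ('v \<Rightarrow>\<^sub>0 complex) \<Rightarrow>
    ('v \<Rightarrow>\<^sub>0 complex) \<Rightarrow> ('v \<Rightarrow>\<^sub>0 complex) \<times> ('v \<Rightarrow>\<^sub>0 complex)" where
  "lowest_terms D f g = (SOME (n, d). n \<in> group_alg D \<and> d \<in> group_alg D \<and> d \<noteq> 0 \<and>
     rel_prime D n d \<and> n * g = f * d)"

text \<open>The value at \<open>t\<close> of the rational function \<open>f/g\<close>; meaningful where it has no pole.\<close>

definition frac_eval :: "'v::euclidean_space hecke_data \<Rightarrow> ('v \<Rightarrow>\<^sub>0 complex) \<Rightarrow>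
    ('v \<Rightarrow>\<^sub>0 complex) \<Rightarrow> ('v \<Rightarrow> complex) \<Rightarrow> complex" where
  "frac_eval D f g t =
     ga_eval (fst (lowest_terms D f g)) t / ga_eval (snd (lowest_terms D f g)) t"

definition c_num :: "'v::euclidean_space hecke_data \<Rightarrow> 'v \<Rightarrow> ('v \<Rightarrow>\<^sub>0 complex)" where
  "c_num D \<alpha> = (if \<alpha> \<in> R1 D
     then 1 - Poly_Mapping.single (- coroot \<alpha>) (inverse (q_root D \<alpha>))
     else (let a = qroot D 0; b = qroot D DIM('v); h = - ((1/2) *\<^sub>R coroot \<alpha>) in
       (1 - Poly_Mapping.single h (inverse a * inverse b)) *
       (1 + Poly_Mapping.single h (a * inverse b))))"

definition c'_num :: "'v::euclidean_space hecke_data \<Rightarrow> 'v \<Rightarrow> ('v \<Rightarrow>\<^sub>0 complex)" where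
  "c'_num D \<alpha> = (if \<alpha> \<in> R1 D
     then Poly_Mapping.single 0 (1 - inverse (q_root D \<alpha>))
     else (let a = qroot D 0; b = qroot D DIM('v); h = - ((1/2) *\<^sub>R coroot \<alpha>) in
       Poly_Mapping.single 0 (1 - inverse (qpar D DIM('v))) +
       Poly_Mapping.single h (inverse b * (a - inverse a))))"

definition c_den :: "'v::euclidean_space \<Rightarrow> ('v \<Rightarrow>\<^sub>0 complex)" where
  "c_den \<alpha> = 1 - xpow (- coroot \<alpha>)"

definition n_fun :: "'v::euclidean_space hecke_data \<Rightarrow> 'v \<Rightarrow> ('v \<Rightarrow>\<^sub>0 complex)" where
  "n_fun D \<alpha> = fst (lowest_terms D (c_num D \<alpha>) (c_den \<alpha>))"

definition d_fun :: "'v::euclidean_space hecke_data \<Rightarrow> 'v \<Rightarrow> ('v \<Rightarrow>\<^sub>0 complex)" where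
  "d_fun D \<alpha> = snd (lowest_terms D (c_num D \<alpha>) (c_den \<alpha>))"

text \<open>
  Since \<open>c\<^sub>i = c'\<^sub>i + q\<^sub>i\<^sup>-\<^sup>1\<close>, the functions \<open>c\<^sub>i\<close> and \<open>c'\<^sub>i\<close> have the same poles, namely the zeros of
  \<open>d_fun D \<alpha>\<^sub>i\<close>; the values below are the intended ones away from these.
\<close>

definition c_val :: "'v::euclidean_space hecke_data \<Rightarrow> nat \<Rightarrow> ('v \<Rightarrow> complex) \<Rightarrow> complex" where
  "c_val D i t = frac_eval D (c_num D (sroot D i)) (c_den (sroot D i)) t"

definition c'_val :: "'v::euclidean_space hecke_data \<Rightarrow> nat \<Rightarrow> ('v \<Rightarrow> complex) \<Rightarrow> complex" where
  "c'_val D i t = frac_eval D (c'_num D (sroot D i)) (c_den (sroot D i)) t"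

definition N_set :: "'v::euclidean_space hecke_data \<Rightarrow> ('v \<Rightarrow> complex) \<Rightarrow> 'v set" where
  "N_set D t = {\<alpha>\<in>R0_pos D. ga_eval (n_fun D \<alpha>) t * ga_eval (n_fun D (- \<alpha>)) t = 0}"

definition D_set :: "'v::euclidean_space hecke_data \<Rightarrow> ('v \<Rightarrow> complex) \<Rightarrow> 'v set" where
  "D_set D t = {\<alpha>\<in>R0_pos D. ga_eval (d_fun D \<alpha>) t = 0}"

definition F_set ::
  "'v::euclidean_space hecke_data \<Rightarrow> 'v set \<Rightarrow> ('v \<Rightarrow> complex) \<Rightarrow> ('v \<Rightarrow> 'v) set" where
  "F_set D J t = {w\<in>W0 D. inversions D (inv w) \<inter> N_set D t = J \<and>
                          inversions D (inv w) \<inter> D_set D t = {}}"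


section \<open>Calibratable weights\<close>

definition sub_roots :: "'v::euclidean_space hecke_data \<Rightarrow> nat \<Rightarrow> nat \<Rightarrow> 'v set" where
  "sub_roots D i j = roots D \<inter> int_span {sroot D i, sroot D j}"

definition regular_pair ::
  "'v::euclidean_space hecke_data \<Rightarrow> nat \<Rightarrow> nat \<Rightarrow> ('v \<Rightarrow> complex) \<Rightarrow> bool" where
  "regular_pair D i j t \<longleftrightarrow> (\<forall>w\<in>parabolic D {i, j}.
     act w t (coroot (sroot D i)) \<noteq> 1 \<and> act w t (coroot (sroot D j)) \<noteq> 1)"

text \<open>
  The types of the rank two systems, given by their positive roots: \<open>\<alpha>\<^sub>i\<close> is the short and
  \<open>\<alpha>\<^sub>j\<close> the long simple root in types \<open>C\<^sub>2\<close> and \<open>G\<^sub>2\<close>, and \<open>\<alpha>\<^sub>i\<close> is the middle-length and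
  \<open>\<alpha>\<^sub>j\<close> the short simple root in type \<open>BC\<^sub>2\<close>.
\<close>

definition type_C2 :: "'v::euclidean_space hecke_data \<Rightarrow> nat \<Rightarrow> nat \<Rightarrow> bool" where
  "type_C2 D i j \<longleftrightarrow> (let a = sroot D i; b = sroot D j in
     norm a < norm b \<and>
     sub_roots D i j = pm {a, b, a + b, 2 *\<^sub>R a + b})"

definition type_G2 :: "'v::euclidean_space hecke_data \<Rightarrow> nat \<Rightarrow> nat \<Rightarrow> bool" where
  "type_G2 D i j \<longleftrightarrow> (let a = sroot D i; b = sroot D j in
     norm a < norm b \<and>
     sub_roots D i j = pm {a, b, a + b, 2 *\<^sub>R a + b, 3 *\<^sub>R a + b, 3 *\<^sub>R a + 2 *\<^sub>R b})"

definition type_BC2 :: "'v::euclidean_space hecke_data \<Rightarrow> nat \<Rightarrow> nat \<Rightarrow> bool" where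
  "type_BC2 D i j \<longleftrightarrow> (let a = sroot D i; b = sroot D j in
     norm b < norm a \<and>
     sub_roots D i j = pm {a, b, 2 *\<^sub>R b, a + b, 2 *\<^sub>R (a + b), a + 2 *\<^sub>R b})"

definition exceptional_C2 ::
  "'v::euclidean_space hecke_data \<Rightarrow> nat \<Rightarrow> nat \<Rightarrow> ('v \<Rightarrow> complex) \<Rightarrow> bool" where
  "exceptional_C2 D i j t \<longleftrightarrow> type_C2 D i j \<and>
     (let qi = qpar D i; qj = qpar D j; z = (t (coroot (sroot D i)), t (coroot (sroot D j))) in
       (qi = qj \<and> z \<in> {(qi, inverse qi), (inverse qi, qi)}) \<or>
       (qi = qj^2 \<and> z \<in> {(inverse qj ^ 2, qj), (qj^2, inverse qj)}))"

definition exceptional_G2 ::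
  "'v::euclidean_space hecke_data \<Rightarrow> nat \<Rightarrow> nat \<Rightarrow> ('v \<Rightarrow> complex) \<Rightarrow> bool" where
  "exceptional_G2 D i j t \<longleftrightarrow> type_G2 D i j \<and>
     (let qi = qpar D i; qj = qpar D j; z = (t (coroot (sroot D i)), t (coroot (sroot D j))) in
       (qi = qj \<and> z \<in> {(inverse qi, qi), (qi, inverse qi),
                        (qi^2, inverse qi), (inverse qi ^ 2, qi)}) \<or>
       (qi = qj^3 \<and> z \<in> {(qj^3, inverse qj), (inverse qj ^ 3, qj),
                          (inverse qj ^ 3, qj^2), (qj^3, inverse qj ^ 2)}))"

definition exceptional_BC2 ::
  "'v::euclidean_space hecke_data \<Rightarrow> nat \<Rightarrow> nat \<Rightarrow> ('v \<Rightarrow> complex) \<Rightarrow> bool" where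
  "exceptional_BC2 D i j t \<longleftrightarrow> type_BC2 D i j \<and>
     (let q0 = qpar D 0; qi = qpar D i; qj = qpar D j; r0 = qroot D 0; rj = qroot D j;
          z = (t (coroot (sroot D i)), t ((1/2) *\<^sub>R coroot (sroot D j))) in
       (qi = q0 * qj \<and>
          z \<in> {(q0 * qj, inverse r0 * inverse rj), (inverse q0 * inverse qj, r0 * rj)}) \<or>
       ((qi = q0 * inverse qj \<or> qi = inverse q0 * qj) \<and>
          z \<in> {(inverse q0 * qj, - (r0 * inverse rj)), (q0 * inverse qj, - (inverse r0 * rj))}) \<or>
       (qi = r0 * rj \<and> z \<in> {(inverse qi, qi), (qi, inverse qi)}) \<or>
       ((qi = inverse r0 * rj \<or> qi = r0 * inverse rj) \<and>
          z \<in> {(inverse qi, - qi), (qi, - inverse qi)}))"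

definition exceptional_pair ::
  "'v::euclidean_space hecke_data \<Rightarrow> nat \<Rightarrow> nat \<Rightarrow> ('v \<Rightarrow> complex) \<Rightarrow> bool" where
  "exceptional_pair D i j t \<longleftrightarrow>
     exceptional_C2 D i j t \<or> exceptional_G2 D i j t \<or> exceptional_BC2 D i j t"

text \<open>
  The notion concerns the unordered pair: the roles of the two simple roots in the exceptional
  cases are determined by their lengths, not by the order in which the indices are written.
\<close>

definition calibratable ::
  "'v::euclidean_space hecke_data \<Rightarrow> nat \<Rightarrow> nat \<Rightarrow> ('v \<Rightarrow> complex) \<Rightarrow> bool" where
  "calibratable D i j t \<longleftrightarrow>
     regular_pair D i j t \<or> exceptional_pair D i j t \<or> exceptional_pair D j i t"


section \<open>The affine Hecke algebra\<close>

definition complex_algebra :: "(complex \<Rightarrow> 'h::ring_1 \<Rightarrow> 'h) \<Rightarrow> bool" where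
  "complex_algebra sH \<longleftrightarrow> vector_space sH \<and>
     (\<forall>c a b. sH c a * b = sH c (a * b) \<and> a * sH c b = sH c (a * b))"

fun alt_prod :: "nat \<Rightarrow> 'h::monoid_mult \<Rightarrow> 'h \<Rightarrow> 'h" where
  "alt_prod 0 a b = 1"
| "alt_prod (Suc m) a b = a * alt_prod m b a"

definition ga_embed ::
  "(complex \<Rightarrow> 'h::ring_1 \<Rightarrow> 'h) \<Rightarrow> ('v \<Rightarrow> 'h) \<Rightarrow> ('v \<Rightarrow>\<^sub>0 complex) \<Rightarrow> 'h" where
  "ga_embed sH X f = (\<Sum>\<mu>\<in>Poly_Mapping.keys f. sH (Poly_Mapping.lookup f \<mu>) (X \<mu>))"

text \<open>
  \<open>'h\<close> with scalar multiplication \<open>sH\<close> and elements \<open>T i\<close>, \<open>Tw w\<close>, \<open>X \<mu>\<close> is the affine Hecke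
  algebra. In the last relation the element \<open>c'\<^sub>i(x) (x\<^sup>\<mu> - x\<^sup>s\<^sup>\<mu>)\<close> of the group algebra is the
  element \<open>p\<close> whose product with the denominator of \<open>c'\<^sub>i\<close> is the numerator times \<open>x\<^sup>\<mu> - x\<^sup>s\<^sup>\<mu>\<close>.
\<close>

definition affine_hecke_algebra :: "'v::euclidean_space hecke_data \<Rightarrow>
    (complex \<Rightarrow> 'h::ring_1 \<Rightarrow> 'h) \<Rightarrow> (nat \<Rightarrow> 'h) \<Rightarrow> (('v \<Rightarrow> 'v) \<Rightarrow> 'h) \<Rightarrow> ('v \<Rightarrow> 'h) \<Rightarrow> bool" where
  "affine_hecke_algebra D sH T Tw X \<longleftrightarrow>
     complex_algebra sH \<and>
     (\<forall>is. reduced_word D is \<longrightarrow> Tw (word_elt D is) = prod_list (map T is)) \<and>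
     inj_on (\<lambda>(w, \<mu>). Tw w * X \<mu>) (W0 D \<times> lat D) \<and>
     \<not> module.dependent sH ((\<lambda>(w, \<mu>). Tw w * X \<mu>) ` (W0 D \<times> lat D)) \<and>
     module.span sH ((\<lambda>(w, \<mu>). Tw w * X \<mu>) ` (W0 D \<times> lat D)) = UNIV \<and>
     (\<forall>i\<in>idx D. T i * T i = 1 + sH (qroot D i - inverse (qroot D i)) (T i)) \<and>
     (\<forall>i\<in>idx D. \<forall>j\<in>idx D. i \<noteq> j \<longrightarrow>
        alt_prod (coxeter_order D i j) (T i) (T j) = alt_prod (coxeter_order D i j) (T j) (T i)) \<and>
     X 0 = 1 \<and>
     (\<forall>\<mu>\<in>lat D. \<forall>\<nu>\<in>lat D. X \<mu> * X \<nu> = X (\<mu> + \<nu>)) \<and>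
     (\<forall>i\<in>idx D. \<forall>\<mu>\<in>lat D. \<exists>p\<in>group_alg D.
        p * c_den (sroot D i) = c'_num D (sroot D i) * (xpow \<mu> - xpow (srefl D i \<mu>)) \<and>
        T i * X \<mu> - X (srefl D i \<mu>) * T i = sH (qroot D i) (ga_embed sH X p))"


section \<open>Representations\<close>

text \<open>
  An algebra homomorphism from \<open>'h\<close> to the endomorphisms of the space \<open>M\<close>. Endomorphisms are
  extensional functions, so that they are determined by their values on \<open>M\<close>.
\<close>

definition representation :: "(complex \<Rightarrow> 'h::ring_1 \<Rightarrow> 'h) \<Rightarrow>
    (complex \<Rightarrow> 'm::ab_group_add \<Rightarrow> 'm) \<Rightarrow> 'm set \<Rightarrow> ('h \<Rightarrow> 'm \<Rightarrow> 'm) \<Rightarrow> bool" where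
  "representation sH sM M \<rho> \<longleftrightarrow>
     vector_space sM \<and> module.subspace sM M \<and>
     (\<forall>h. \<rho> h \<in> M \<rightarrow>\<^sub>E M \<and>
          (\<forall>u\<in>M. \<forall>v\<in>M. \<rho> h (u + v) = \<rho> h u + \<rho> h v) \<and>
          (\<forall>c. \<forall>u\<in>M. \<rho> h (sM c u) = sM c (\<rho> h u))) \<and>
     (\<forall>u\<in>M. \<rho> 1 u = u \<and>
        (\<forall>h k. \<rho> (h + k) u = \<rho> h u + \<rho> k u \<and> \<rho> (h * k) u = \<rho> h (\<rho> k u)) \<and>
        (\<forall>c h. \<rho> (sH c h) u = sM c (\<rho> h u)))"

definition irreducible_rep :: "(complex \<Rightarrow> 'm::ab_group_add \<Rightarrow> 'm) \<Rightarrow> 'm set \<Rightarrow>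
    ('h \<Rightarrow> 'm \<Rightarrow> 'm) \<Rightarrow> bool" where
  "irreducible_rep sM M \<rho> \<longleftrightarrow> M \<noteq> {0} \<and>
     (\<forall>U. module.subspace sM U \<and> U \<subseteq> M \<and> (\<forall>h. \<forall>u\<in>U. \<rho> h u \<in> U) \<longrightarrow> U = {0} \<or> U = M)"

definition weight_space :: "'v::euclidean_space hecke_data \<Rightarrow> ('v \<Rightarrow> 'h::ring_1) \<Rightarrow>
    (complex \<Rightarrow> 'm::ab_group_add \<Rightarrow> 'm) \<Rightarrow> 'm set \<Rightarrow> ('h \<Rightarrow> 'm \<Rightarrow> 'm) \<Rightarrow> ('v \<Rightarrow> complex) \<Rightarrow> 'm set" where
  "weight_space D X sM M \<rho> t = {u\<in>M. \<forall>\<mu>\<in>lat D. \<rho> (X \<mu>) u = sM (t \<mu>) u}"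

definition gen_weight_space :: "'v::euclidean_space hecke_data \<Rightarrow> (complex \<Rightarrow> 'h::ring_1 \<Rightarrow> 'h) \<Rightarrow>
    ('v \<Rightarrow> 'h) \<Rightarrow> 'm::ab_group_add set \<Rightarrow> ('h \<Rightarrow> 'm \<Rightarrow> 'm) \<Rightarrow> ('v \<Rightarrow> complex) \<Rightarrow> 'm set" where
  "gen_weight_space D sH X M \<rho> t =
     {u\<in>M. \<forall>\<mu>\<in>lat D. \<exists>k>0. \<rho> ((X \<mu> - sH (t \<mu>) 1) ^ k) u = 0}"

definition calibrated :: "'v::euclidean_space hecke_data \<Rightarrow> (complex \<Rightarrow> 'h::ring_1 \<Rightarrow> 'h) \<Rightarrow>
    ('v \<Rightarrow> 'h) \<Rightarrow> (complex \<Rightarrow> 'm::ab_group_add \<Rightarrow> 'm) \<Rightarrow> 'm set \<Rightarrow> ('h \<Rightarrow> 'm \<Rightarrow> 'm) \<Rightarrow> bool" where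
  "calibrated D sH X sM M \<rho> \<longleftrightarrow>
     (\<exists>B. finite B \<and> B \<subseteq> M \<and> module.span sM B = M) \<and>
     (\<forall>t\<in>characters D. gen_weight_space D sH X M \<rho> t = weight_space D X sM M \<rho> t)"


section \<open>The module of a local region\<close>

definition region_weights :: "'v::euclidean_space hecke_data \<Rightarrow> 'v set \<Rightarrow> ('v \<Rightarrow> complex) \<Rightarrow>
    ('v \<Rightarrow> complex) set" where
  "region_weights D J t = (\<lambda>w. act w t) ` F_set D J t"

definition region_module :: "'v::euclidean_space hecke_data \<Rightarrow> 'v set \<Rightarrow> ('v \<Rightarrow> complex) \<Rightarrow>
    (('v \<Rightarrow> complex) \<Rightarrow>\<^sub>0 complex) set" where
  "region_module D J t = {f. Poly_Mapping.keys f \<subseteq> region_weights D J t}"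

text \<open>The vector \<open>e\<^sub>w\<^sub>t\<close>, with the convention that it is \<open>0\<close> if \<open>w \<notin> F\<^sub>J(t)\<close>.\<close>

definition basis_vec :: "'v::euclidean_space hecke_data \<Rightarrow> 'v set \<Rightarrow> ('v \<Rightarrow> complex) \<Rightarrow>
    ('v \<Rightarrow> 'v) \<Rightarrow> (('v \<Rightarrow> complex) \<Rightarrow>\<^sub>0 complex)" where
  "basis_vec D J t w = (if w \<in> F_set D J t then Poly_Mapping.single (act w t) 1 else 0)"

definition x_formula :: "'v::euclidean_space hecke_data \<Rightarrow> 'v set \<Rightarrow> ('v \<Rightarrow> complex) \<Rightarrow> 'v \<Rightarrow>
    ((('v \<Rightarrow> complex) \<Rightarrow>\<^sub>0 complex) \<Rightarrow> (('v \<Rightarrow> complex) \<Rightarrow>\<^sub>0 complex)) \<Rightarrow> bool" where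
  "x_formula D J t \<mu> A \<longleftrightarrow> (\<forall>w\<in>F_set D J t.
     A (basis_vec D J t w) = scal (act w t \<mu>) (basis_vec D J t w))"

definition T_formula :: "'v::euclidean_space hecke_data \<Rightarrow> 'v set \<Rightarrow> ('v \<Rightarrow> complex) \<Rightarrow> nat \<Rightarrow>
    ((('v \<Rightarrow> complex) \<Rightarrow>\<^sub>0 complex) \<Rightarrow> (('v \<Rightarrow> complex) \<Rightarrow>\<^sub>0 complex)) \<Rightarrow> bool" where
  "T_formula D J t i A \<longleftrightarrow> (\<forall>w\<in>F_set D J t.
     A (basis_vec D J t w) =
       scal (qroot D i * c'_val D i (act w t)) (basis_vec D J t w) +
       scal (qroot D i * c_val D i (act w t)) (basis_vec D J t (srefl D i \<circ> w)))"

definition region_rep :: "'v::euclidean_space hecke_data \<Rightarrow> (complex \<Rightarrow> 'h::ring_1 \<Rightarrow> 'h) \<Rightarrow>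
    (nat \<Rightarrow> 'h) \<Rightarrow> ('v \<Rightarrow> 'h) \<Rightarrow> 'v set \<Rightarrow> ('v \<Rightarrow> complex) \<Rightarrow>
    ('h \<Rightarrow> (('v \<Rightarrow> complex) \<Rightarrow>\<^sub>0 complex) \<Rightarrow> (('v \<Rightarrow> complex) \<Rightarrow>\<^sub>0 complex)) \<Rightarrow> bool" where
  "region_rep D sH T X J t \<rho> \<longleftrightarrow>
     representation sH scal (region_module D J t) \<rho> \<and>
     (\<forall>\<mu>\<in>lat D. x_formula D J t \<mu> (\<rho> (X \<mu>))) \<and>
     (\<forall>i\<in>idx D. T_formula D J t i (\<rho> (T i)))"

end

theory Submission
  imports Defs "HOL-Computational_Algebra.Field_as_Ring" "HOL-Computational_Algebra.Polynomial_Factorial"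
begin

text \<open>
  On the space with basis all weights, let \<open>T\<^sub>i\<close> act by the given formula, with \<open>e\<^sub>s\<^sub>i\<^sub>s\<close> replaced by 0
  whenever \<open>c\<^sub>i(s) c\<^sub>i(s\<^sub>is) = 0\<close>; along a local region this happens exactly when \<open>s\<^sub>i\<close> leads out of it. The
  quadratic and cross relations follow from \<open>c\<^sub>i(s) + c\<^sub>i(s\<^sub>is) = 1 + q\<^sub>i\<^sup>-\<^sup>1\<close>. At the exceptional weights of
  rank two, \<open>T\<^sub>i\<close> and \<open>T\<^sub>j\<close> generate a space of dimension at most two, where the braid relation is
  checked directly. At regular weights the braid relation is an identity between coefficients
  that can be computed in the algebra itself, modulo the left ideal generated by all
  \<open>x\<^sup>\<mu> - s(\<mu>)\<close>: for characters \<open>s\<close> with trivial stabiliser the intertwined images of 1 are independent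
  there, since they are weight vectors of different weights, and the general case follows by
  continuity. By Matsumoto's theorem the operators attached to reduced words are well defined,
  so the basis \<open>T\<^sub>w x\<^sup>\<mu>\<close> gives the representation. Its weight spaces are spanned by the \<open>e\<^sub>s\<close>, and any
  two of these are connected by intertwiners because the chambers of a local region are.
\<close>

section \<open>The group algebra\<close>

text \<open>The values of the c-functions come from an arbitrary choice of lowest terms, and at
  special parameters such as \<open>q_i = 1\<close> a factor of the denominator cancels, so that a
  weight can be fixed by a simple reflection without being a pole. Each c-function is therefore
  handled as a quotient of polynomials in one variable: Bezout's identity there controls every
  choice, and continuity in that variable yields the identities at cancelled zeros. Distinct
  elements of a local region may have the same weight; the cut-off
  \<open>c_i(s) c_i(s_i s) = 0\<close> refers to the weight alone, so the operators make sense on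
  weights. Regularity only says that certain coroots do not take the value 1. It does not make
  stabilisers trivial: on the lattice spanned by one coroot, the character with value -1 there is
  regular and fixed by the reflection. This is why weights are moved along a curve before weight
  vectors are separated. The coefficients compared on the curve involve no division by c-values, so
  they have limits and remain usable where c vanishes, as it does at the walls of a region.\<close>

lemma pm_decomp: "f = (\<Sum>\<mu>\<in>Poly_Mapping.keys f. Poly_Mapping.single \<mu> (Poly_Mapping.lookup f \<mu>))"
proof (rule poly_mapping_eqI)
  fix k
  have "(\<Sum>\<mu>\<in>Poly_Mapping.keys f. Poly_Mapping.lookup (Poly_Mapping.single \<mu> (Poly_Mapping.lookup f \<mu>)) k)
      = (\<Sum>\<mu>\<in>Poly_Mapping.keys f. if \<mu> = k then Poly_Mapping.lookup f \<mu> else 0)"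
    by (intro sum.cong) (auto simp: lookup_single)
  also have "\<dots> = Poly_Mapping.lookup f k"
    by (simp add: in_keys_iff)
  finally show "Poly_Mapping.lookup f k = Poly_Mapping.lookup
      (\<Sum>\<mu>\<in>Poly_Mapping.keys f. Poly_Mapping.single \<mu> (Poly_Mapping.lookup f \<mu>)) k"
    by (simp add: lookup_sum)
qed

lemma lookup_single_mult:
  fixes f :: "'v::ab_group_add \<Rightarrow>\<^sub>0 complex"
  shows "Poly_Mapping.lookup (Poly_Mapping.single h u * f) \<mu> = u * Poly_Mapping.lookup f (\<mu> - h)"
proof -
  have "Poly_Mapping.single h u * f =
      (\<Sum>\<nu>\<in>Poly_Mapping.keys f. Poly_Mapping.single (h + \<nu>) (u * Poly_Mapping.lookup f \<nu>))"
    by (subst pm_decomp[of f]) (simp add: sum_distrib_left mult_single)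
  then have "Poly_Mapping.lookup (Poly_Mapping.single h u * f) \<mu> =
      (\<Sum>\<nu>\<in>Poly_Mapping.keys f. if \<nu> = \<mu> - h then u * Poly_Mapping.lookup f \<nu> else 0)"
    by (simp add: lookup_sum lookup_single when_def algebra_simps eq_diff_eq)
  then show ?thesis
    by (simp add: in_keys_iff)
qed

text \<open>A function annihilated by \<open>1 - x^h\<close> is invariant under translation by
  \<open>h\<close>, which is impossible for a nonzero function of finite support. All cancellation
  in the group algebra below goes back to this.\<close>

lemma one_minus_single_nonzero_divisor:
  fixes f :: "'v::real_vector \<Rightarrow>\<^sub>0 complex"
  assumes "h \<noteq> 0" and "(1 - Poly_Mapping.single h 1) * f = 0"
  shows "f = 0"
proof (rule ccontr)
  assume "f \<noteq> 0"
  have eq: "Poly_Mapping.lookup f \<mu> = Poly_Mapping.lookup f (\<mu> - h)" for \<mu>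
  proof -
    have "f = Poly_Mapping.single h 1 * f" using assms(2) by (simp add: algebra_simps)
    then show ?thesis by (metis lookup_single_mult mult_1)
  qed
  obtain \<mu> where \<mu>: "Poly_Mapping.lookup f \<mu> \<noteq> 0"
    using \<open>f \<noteq> 0\<close> by (metis lookup_zero poly_mapping_eqI)
  have "Poly_Mapping.lookup f (\<mu> - real n *\<^sub>R h) \<noteq> 0" for n
  proof (induction n)
    case (Suc n)
    then show ?case using eq[of "\<mu> - real n *\<^sub>R h"] by (simp add: algebra_simps)
  qed (use \<mu> in simp)
  then have "range (\<lambda>n. \<mu> - real n *\<^sub>R h) \<subseteq> Poly_Mapping.keys f"
    by (auto simp: in_keys_iff)
  moreover have "inj (\<lambda>n. \<mu> - real n *\<^sub>R h)"
    using assms(1) by (auto simp: inj_def)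
  ultimately show False
    by (meson finite_keys finite_subset finite_imageD infinite_UNIV_nat)
qed

section \<open>Evaluation at characters, and polynomials in a single exponential\<close>

lemma ga_eval_superset:
  assumes "finite A" "Poly_Mapping.keys f \<subseteq> A"
  shows "ga_eval f t = (\<Sum>\<mu>\<in>A. Poly_Mapping.lookup f \<mu> * t \<mu>)"
  unfolding ga_eval_def by (rule sum.mono_neutral_left) (use assms in \<open>auto simp: in_keys_iff\<close>)

lemma ga_eval_add: "ga_eval (f + g) t = ga_eval f t + ga_eval g t"
proof -
  let ?A = "Poly_Mapping.keys f \<union> Poly_Mapping.keys g"
  have "ga_eval (f + g) t = (\<Sum>\<mu>\<in>?A. Poly_Mapping.lookup (f + g) \<mu> * t \<mu>)"
    using keys_add[of f g] by (intro ga_eval_superset) auto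
  then show ?thesis
    by (simp add: ga_eval_superset[of ?A f] ga_eval_superset[of ?A g] lookup_add
        algebra_simps sum.distrib)
qed

lemma ga_eval_0 [simp]: "ga_eval 0 t = 0"
  by (simp add: ga_eval_def)

lemma ga_eval_single [simp]: "ga_eval (Poly_Mapping.single \<mu> c) t = c * t \<mu>"
  by (subst ga_eval_superset[of "{\<mu>}"]) auto

lemma ga_eval_uminus: "ga_eval (- f) t = - ga_eval f t"
  by (simp add: ga_eval_def sum_negf)

lemma ga_eval_diff: "ga_eval (f - g) t = ga_eval f t - ga_eval g t"
  using ga_eval_add[of f "- g"] by (simp add: ga_eval_uminus)

lemma ga_eval_sum: "ga_eval (sum f A) t = (\<Sum>a\<in>A. ga_eval (f a) t)"
  by (induction A rule: infinite_finite_induct) (auto simp: ga_eval_add)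

text \<open>The ring homomorphism that substitutes \<open>x^h\<close> for the variable. Numerators
  and denominators of the c-functions are in its image, and gcds with Bezout coefficients are
  available before substituting.\<close>

definition ypoly :: "'v::real_vector \<Rightarrow> complex poly \<Rightarrow> ('v \<Rightarrow>\<^sub>0 complex)" where
  "ypoly h p = fold_coeffs (\<lambda>a f. Poly_Mapping.single 0 a + Poly_Mapping.single h 1 * f) p 0"

lemma ypoly_0 [simp]: "ypoly h 0 = 0"
  by (simp add: ypoly_def)

lemma ypoly_pCons [simp]:
  "ypoly h (pCons a p) = Poly_Mapping.single 0 a + Poly_Mapping.single h 1 * ypoly h p"
  by (cases "a = 0 \<and> p = 0") (auto simp: ypoly_def)

lemma ypoly_1 [simp]: "ypoly h 1 = 1"
  by (simp add: one_pCons)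

lemma ypoly_add: "ypoly h (p + q) = ypoly h p + ypoly h q"
proof (induction p arbitrary: q)
  case (pCons a p)
  then show ?case by (cases q) (simp add: single_add algebra_simps)
qed simp

lemma ypoly_smult: "ypoly h (smult c p) = Poly_Mapping.single 0 c * ypoly h p"
proof (induction p)
  case (pCons a p)
  have "Poly_Mapping.single h 1 * (Poly_Mapping.single 0 c * ypoly h p) =
      Poly_Mapping.single 0 c * (Poly_Mapping.single h 1 * ypoly h p)"
    by (simp add: mult.left_commute)
  with pCons show ?case by (simp add: mult_single distrib_left)
qed simp

lemma ypoly_mult: "ypoly h (p * q) = ypoly h p * ypoly h q"
  by (induction p) (simp_all add: ypoly_add ypoly_smult algebra_simps)

section \<open>The lattice, its characters, and fractions in lowest terms\<close>

locale hecke =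
  fixes D :: "'v::euclidean_space hecke_data"
  assumes datum: "hecke_datum D"
begin

abbreviation "L \<equiv> lat D"

lemma root_system: "root_system (roots D)"
  using datum by (auto simp: hecke_datum_def irreducible_root_system_def)

lemma roots_nonempty: "roots D \<noteq> {}"
  using datum by (auto simp: hecke_datum_def irreducible_root_system_def)

lemma finite_roots: "finite (roots D)" and zero_notin_roots: "0 \<notin> roots D"
  and span_roots: "span (roots D) = UNIV"
  and refl_root: "\<alpha> \<in> roots D \<Longrightarrow> \<beta> \<in> roots D \<Longrightarrow> reflection \<alpha> \<beta> \<in> roots D"
  and integral_root: "\<alpha> \<in> roots D \<Longrightarrow> \<beta> \<in> roots D \<Longrightarrow> \<beta> \<bullet> coroot \<alpha> \<in> \<int>"
  using root_system by (auto simp: root_system_def)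

lemma L_diff: "\<mu> \<in> L \<Longrightarrow> \<nu> \<in> L \<Longrightarrow> \<mu> - \<nu> \<in> L"
  using datum by (auto simp: hecke_datum_def)

lemma coroot_in_L: assumes "\<alpha> \<in> roots D" shows "coroot \<alpha> \<in> L"
proof -
  have "coroot \<alpha> \<in> coroot_lattice D"
    unfolding coroot_lattice_def int_span_def
    using assms by (auto intro!: exI[of _ "{coroot \<alpha>}"] exI[of _ "\<lambda>_. 1"])
  then show ?thesis using datum by (auto simp: hecke_datum_def)
qed

lemma L_0: "0 \<in> L"
  using roots_nonempty coroot_in_L L_diff by (metis all_not_in_conv diff_self)

lemma L_uminus: "\<mu> \<in> L \<Longrightarrow> - \<mu> \<in> L"
  using L_diff[OF L_0] by simp

lemma L_add: "\<mu> \<in> L \<Longrightarrow> \<nu> \<in> L \<Longrightarrow> \<mu> + \<nu> \<in> L"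
  using L_diff[of \<mu> "- \<nu>"] L_uminus by simp

lemma L_of_int: assumes "\<mu> \<in> L" shows "of_int k *\<^sub>R \<mu> \<in> L"
proof -
  have nat: "real n *\<^sub>R \<mu> \<in> L" for n
    by (induction n) (auto simp: L_0 algebra_simps intro: L_add assms)
  show ?thesis
  proof (cases "k \<ge> 0")
    case True then show ?thesis using nat[of "nat k"] by simp
  next
    case False
    then show ?thesis using L_uminus[OF nat[of "nat (- k)"]] by simp
  qed
qed

lemma L_integral: "\<mu> \<in> L \<Longrightarrow> \<alpha> \<in> roots D \<Longrightarrow> \<mu> \<bullet> \<alpha> \<in> \<int>"
  using datum by (auto simp: hecke_datum_def coweight_lattice_def)

lemma char_add: "s \<in> characters D \<Longrightarrow> \<mu> \<in> L \<Longrightarrow> \<nu> \<in> L \<Longrightarrow> s (\<mu> + \<nu>) = s \<mu> * s \<nu>"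
  and char_nz: "s \<in> characters D \<Longrightarrow> \<mu> \<in> L \<Longrightarrow> s \<mu> \<noteq> 0"
  and char_undef: "s \<in> characters D \<Longrightarrow> \<mu> \<notin> L \<Longrightarrow> s \<mu> = undefined"
  by (auto simp: characters_def PiE_def Pi_def extensional_def)

lemma char_0: assumes "s \<in> characters D" shows "s 0 = 1"
  using char_add[OF assms L_0 L_0] char_nz[OF assms L_0] by simp

lemma char_uminus: assumes "s \<in> characters D" "\<mu> \<in> L" shows "s (- \<mu>) = inverse (s \<mu>)"
  using char_add[OF assms(1) assms(2) L_uminus[OF assms(2)]] char_0[OF assms(1)]
  by (simp add: inverse_unique)

lemma char_diff: "s \<in> characters D \<Longrightarrow> \<mu> \<in> L \<Longrightarrow> \<nu> \<in> L \<Longrightarrow> s (\<mu> - \<nu>) = s \<mu> / s \<nu>"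
  using char_add[of s \<mu> "- \<nu>"] char_uminus[of s \<nu>] L_uminus[of \<nu>]
  by (simp add: field_simps)

lemma char_of_int:
  assumes "s \<in> characters D" "\<mu> \<in> L"
  shows "s (of_int k *\<^sub>R \<mu>) = s \<mu> powi k"
proof -
  have nat: "s (real n *\<^sub>R \<mu>) = s \<mu> ^ n" for n
  proof (induction n)
    case (Suc n)
    have "s (real n *\<^sub>R \<mu> + \<mu>) = s (real n *\<^sub>R \<mu>) * s \<mu>"
      using L_of_int[OF assms(2), of "int n"] by (intro char_add assms) auto
    then show ?case using Suc by (simp add: algebra_simps)
  qed (simp add: char_0 assms)
  show ?thesis
  proof (cases "k \<ge> 0")
    case True then show ?thesis using nat[of "nat k"] by (simp add: power_int_def)
  next
    case False
    define n where "n = nat (- k)"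
    have k: "k = - int n" using False by (simp add: n_def)
    have "s (- (real n *\<^sub>R \<mu>)) = inverse (s (real n *\<^sub>R \<mu>))"
      using L_of_int[OF assms(2), of "int n"] by (intro char_uminus assms) auto
    then show ?thesis using False by (simp add: k power_int_minus nat)
  qed
qed

lemma ga_single: "\<mu> \<in> L \<Longrightarrow> Poly_Mapping.single \<mu> c \<in> group_alg D"
  by (auto simp: group_alg_def)

lemma ga_zero: "0 \<in> group_alg D"
  by (auto simp: group_alg_def)

lemma ga_add: "f \<in> group_alg D \<Longrightarrow> g \<in> group_alg D \<Longrightarrow> f + g \<in> group_alg D"
  using keys_add[of f g] by (auto simp: group_alg_def)

lemma ga_diff: "f \<in> group_alg D \<Longrightarrow> g \<in> group_alg D \<Longrightarrow> f - g \<in> group_alg D"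
  using ga_add[of f "- g"] by (auto simp: group_alg_def)

lemma ga_mult: "f \<in> group_alg D \<Longrightarrow> g \<in> group_alg D \<Longrightarrow> f * g \<in> group_alg D"
  using keys_mult[of f g] L_add by (force simp: group_alg_def)

lemma ga_ypoly: "h \<in> L \<Longrightarrow> ypoly h p \<in> group_alg D"
  by (induction p) (auto intro: ga_zero ga_add ga_mult ga_single L_0)

lemma ga_eval_mult:
  assumes "s \<in> characters D" "f \<in> group_alg D" "g \<in> group_alg D"
  shows "ga_eval (f * g) s = ga_eval f s * ga_eval g s"
proof -
  have "ga_eval (f * g) s = (\<Sum>\<mu>\<in>Poly_Mapping.keys f. \<Sum>\<nu>\<in>Poly_Mapping.keys g.
      Poly_Mapping.lookup f \<mu> * Poly_Mapping.lookup g \<nu> * s (\<mu> + \<nu>))"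
  proof -
    have "f * g = (\<Sum>\<mu>\<in>Poly_Mapping.keys f. Poly_Mapping.single \<mu> (Poly_Mapping.lookup f \<mu>)) *
        (\<Sum>\<nu>\<in>Poly_Mapping.keys g. Poly_Mapping.single \<nu> (Poly_Mapping.lookup g \<nu>))"
      using pm_decomp[of f] pm_decomp[of g] by simp
    also have "\<dots> = (\<Sum>\<mu>\<in>Poly_Mapping.keys f. \<Sum>\<nu>\<in>Poly_Mapping.keys g.
        Poly_Mapping.single (\<mu> + \<nu>) (Poly_Mapping.lookup f \<mu> * Poly_Mapping.lookup g \<nu>))"
      by (simp only: sum_product mult_single)
    finally show ?thesis by (simp add: ga_eval_sum)
  qed
  also have "\<dots> = (\<Sum>\<mu>\<in>Poly_Mapping.keys f. \<Sum>\<nu>\<in>Poly_Mapping.keys g.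
      (Poly_Mapping.lookup f \<mu> * s \<mu>) * (Poly_Mapping.lookup g \<nu> * s \<nu>))"
    using assms by (intro sum.cong) (auto simp: group_alg_def char_add subset_eq)
  finally show ?thesis by (simp add: ga_eval_def sum_product)
qed

lemma ga_eval_1: "s \<in> characters D \<Longrightarrow> ga_eval 1 s = 1"
  using ga_eval_single[of 0 1 s] char_0 by simp

lemma ga_eval_ypoly:
  assumes "s \<in> characters D" "h \<in> L"
  shows "ga_eval (ypoly h p) s = poly p (s h)"
  by (induction p)
    (simp_all add: ga_eval_add ga_eval_mult assms ga_single ga_ypoly char_0)

text \<open>Since \<open>lowest_terms\<close> is an unspecified choice, every admissible choice has
  to agree with the polynomial one up to a unit. A Bezout identity for the coprime polynomials is
  mapped to one for their images, which makes these relatively prime in the whole group algebra and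
  not only among polynomials in \<open>x^h\<close>.\<close>

lemma lowest_terms_ypoly:
  fixes num den :: "complex poly"
  defines "n0 \<equiv> num div gcd num den" and "d0 \<equiv> den div gcd num den"
  assumes h: "h \<in> L" and nzd: "\<And>f. ypoly h den * f = 0 \<Longrightarrow> f = 0"
  obtains k k' where "k \<in> group_alg D" "k' \<in> group_alg D" "k * k' = 1"
    "lowest_terms D (ypoly h num) (ypoly h den) = (ypoly h n0 * k, ypoly h d0 * k)"
proof -
  define G where "G = gcd num den"
  have den: "den \<noteq> 0" using nzd[of 1] by auto
  then have G0: "G \<noteq> 0" by (auto simp: G_def)
  have num': "num = G * n0" and den': "den = G * d0"
    unfolding n0_def d0_def G_def by (simp_all only: dvd_mult_div_cancel gcd_dvd1 gcd_dvd2)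
  have nzd_d0: "f = 0" if "ypoly h d0 * f = 0" for f
    by (rule nzd) (use that in \<open>simp add: den' ypoly_mult mult.assoc\<close>)
  have nzd_G: "f = 0" if "ypoly h G * f = 0" for f
  proof (rule nzd)
    have "ypoly h den * f = ypoly h d0 * (ypoly h G * f)"
      by (simp add: den' ypoly_mult ac_simps)
    then show "ypoly h den * f = 0" using that by simp
  qed
  obtain u v where uv: "u * n0 + v * d0 = 1"
  proof -
    obtain u v where "u * num + v * den = G"
      using bezout_coefficients_fst_snd[of num den] unfolding G_def by blast
    then have "G * (u * n0 + v * d0) = G * 1"
      by (simp add: num' den' algebra_simps)
    then have "u * n0 + v * d0 = 1" using G0 by simp
    then show ?thesis using that by blast
  qed
  have yuv: "ypoly h u * ypoly h n0 + ypoly h v * ypoly h d0 = 1"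
    using arg_cong[OF uv, of "ypoly h"] by (simp add: ypoly_add ypoly_mult)
  define Q where "Q = (\<lambda>(n, d). n \<in> group_alg D \<and> d \<in> group_alg D \<and> d \<noteq> 0 \<and>
     rel_prime D n d \<and> n * ypoly h den = ypoly h num * d)"
  have "Q (ypoly h n0, ypoly h d0)"
  proof -
    have "rel_prime D (ypoly h n0) (ypoly h d0)"
      unfolding rel_prime_def
    proof clarify
      fix p k1 k2
      assume p: "p \<in> group_alg D" "k1 \<in> group_alg D" "k2 \<in> group_alg D"
        "ypoly h n0 = p * k1" "ypoly h d0 = p * k2"
      have "p * (ypoly h u * k1 + ypoly h v * k2) = 1"
        using yuv by (simp add: p algebra_simps)
      then show "\<exists>k\<in>group_alg D. p * k = 1"
        using p(2,3) h
        by (intro bexI[of _ "ypoly h u * k1 + ypoly h v * k2"]) (auto intro!: ga_add ga_mult ga_ypoly)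
    qed
    moreover have "ypoly h d0 \<noteq> 0" using nzd_d0[of 1] by auto
    ultimately show ?thesis
      using h by (auto simp: Q_def num' den' ypoly_mult ac_simps intro: ga_ypoly)
  qed
  moreover have "lowest_terms D (ypoly h num) (ypoly h den) = (SOME x. Q x)"
    by (simp add: lowest_terms_def Q_def)
  ultimately have Q: "Q (lowest_terms D (ypoly h num) (ypoly h den))"
    by (metis someI)
  obtain n d where nd: "lowest_terms D (ypoly h num) (ypoly h den) = (n, d)"
    by fastforce
  have n: "n \<in> group_alg D" "d \<in> group_alg D" "rel_prime D n d"
    and eq: "n * ypoly h den = ypoly h num * d"
    using Q by (auto simp: Q_def nd)
  have eq': "n * ypoly h d0 = ypoly h n0 * d"
  proof -
    have "ypoly h G * (n * ypoly h d0 - ypoly h n0 * d) = 0"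
      using eq by (simp add: num' den' ypoly_mult algebra_simps)
    then show ?thesis using nzd_G by fastforce
  qed
  \<comment> \<open>If \<open>n\<close> and \<open>d\<close> are the multiples of
    \<open>ypoly h n0\<close> and \<open>ypoly h d0\<close> by a common factor, the Bezout identity
    forces this factor.\<close>
  define k where "k = n * ypoly h u + d * ypoly h v"
  have "d = (ypoly h u * ypoly h n0 + ypoly h v * ypoly h d0) * d" by (simp add: yuv)
  also have "\<dots> = ypoly h u * (ypoly h n0 * d) + ypoly h v * ypoly h d0 * d"
    by (simp add: algebra_simps)
  also have "\<dots> = ypoly h u * (n * ypoly h d0) + ypoly h v * ypoly h d0 * d" by (simp add: eq')
  also have "\<dots> = ypoly h d0 * k" by (simp add: k_def algebra_simps)
  finally have dk: "d = ypoly h d0 * k" .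
  have nk: "n = ypoly h n0 * k"
  proof -
    have "ypoly h d0 * (n - ypoly h n0 * k) = 0"
      using eq' by (simp add: dk algebra_simps)
    then show ?thesis using nzd_d0 by fastforce
  qed
  have k: "k \<in> group_alg D"
    unfolding k_def using n h by (auto intro!: ga_add ga_mult ga_ypoly)
  have "(\<exists>k1\<in>group_alg D. n = k * k1) \<and> (\<exists>k1\<in>group_alg D. d = k * k1)"
    using nk dk ga_ypoly[OF h] by (metis mult.commute)
  then obtain k' where "k' \<in> group_alg D" "k * k' = 1"
    using n(3) k unfolding rel_prime_def by blast
  then show ?thesis using that k nd nk dk by simp
qed

text \<open>A unit of the group algebra has a nonzero value at every character, so neither the zeros
  nor the value of the fraction depend on the choice.\<close>

lemma frac_eval_ypoly:
  fixes num den :: "complex poly"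
  defines "n0 \<equiv> num div gcd num den" and "d0 \<equiv> den div gcd num den"
  assumes h: "h \<in> L" and nzd: "\<And>f. ypoly h den * f = 0 \<Longrightarrow> f = 0" and s: "s \<in> characters D"
  shows "ga_eval (fst (lowest_terms D (ypoly h num) (ypoly h den))) s = 0 \<longleftrightarrow> poly n0 (s h) = 0"
    and "ga_eval (snd (lowest_terms D (ypoly h num) (ypoly h den))) s = 0 \<longleftrightarrow> poly d0 (s h) = 0"
    and "frac_eval D (ypoly h num) (ypoly h den) s = poly n0 (s h) / poly d0 (s h)"
proof -
  obtain k k' where k: "k \<in> group_alg D" "k' \<in> group_alg D" "k * k' = 1"
    and lt: "lowest_terms D (ypoly h num) (ypoly h den) = (ypoly h n0 * k, ypoly h d0 * k)"
    using lowest_terms_ypoly[OF h nzd] unfolding n0_def d0_def by metis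
  have "ga_eval k s * ga_eval k' s = 1"
    using ga_eval_mult[OF s k(1,2)] k(3) ga_eval_1[OF s] by simp
  then have nz: "ga_eval k s \<noteq> 0" by auto
  show "ga_eval (fst (lowest_terms D (ypoly h num) (ypoly h den))) s = 0 \<longleftrightarrow> poly n0 (s h) = 0"
    and "ga_eval (snd (lowest_terms D (ypoly h num) (ypoly h den))) s = 0 \<longleftrightarrow> poly d0 (s h) = 0"
    and "frac_eval D (ypoly h num) (ypoly h den) s = poly n0 (s h) / poly d0 (s h)"
    using nz h k s by (simp_all add: lt frac_eval_def ga_eval_mult ga_ypoly ga_eval_ypoly)
qed


section \<open>Roots and the Weyl group\<close>

abbreviation al where "al \<equiv> sroot D"
abbreviation sr where "sr \<equiv> srefl D"
abbreviation we where "we \<equiv> word_elt D"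

lemma finite_idx: "finite (idx D)"
  by (simp add: idx_def)

lemma simple: "simple_system D"
  using datum by (simp add: hecke_datum_def)

lemma inj_al: "inj_on al (idx D)" and indep_al: "independent (al ` idx D)"
  and al_root: "i \<in> idx D \<Longrightarrow> al i \<in> roots D"
  and root_pos_or_neg: "\<beta> \<in> roots D \<Longrightarrow> \<beta> \<in> nonneg_comb D \<or> - \<beta> \<in> nonneg_comb D"
  using simple by (auto simp: simple_system_def)

lemma span_al: "span (al ` idx D) = UNIV"
proof -
  have "card (al ` idx D) = DIM('v)"
    using inj_al by (simp add: card_image idx_def)
  then show ?thesis
    by (metis UNIV_I card_ge_dim_independent dim_UNIV dual_order.refl indep_al subset_UNIV subset_antisym)
qed

definition coef :: "nat \<Rightarrow> 'v \<Rightarrow> real" where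
  "coef i v = Real_Vector_Spaces.representation (al ` idx D) v (al i)"

lemma coef_add: "coef i (u + v) = coef i u + coef i v"
  and coef_scale: "coef i (c *\<^sub>R v) = c * coef i v"
  by (simp_all add: coef_def real_vector.representation_add real_vector.representation_scale indep_al span_al)

lemma coef_uminus: "coef i (- v) = - coef i v"
  using coef_scale[of i "-1" v] by simp

lemma coef_diff: "coef i (u - v) = coef i u - coef i v"
  using coef_add[of i u "- v"] by (simp add: coef_uminus)

lemma coef_zero [simp]: "coef i 0 = 0"
  using coef_scale[of i 0 0] by simp

lemma coef_sum: "coef i (sum f A) = (\<Sum>a\<in>A. coef i (f a))"
  by (induction A rule: infinite_finite_induct) (auto simp: coef_add)

lemma coef_al: "i \<in> idx D \<Longrightarrow> j \<in> idx D \<Longrightarrow> coef i (al j) = (if i = j then 1 else 0)"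
  using inj_al by (auto simp: coef_def real_vector.representation_basis indep_al inj_on_def)

lemma coef_expand: "(\<Sum>i\<in>idx D. coef i v *\<^sub>R al i) = v"
proof -
  have "(\<Sum>b\<in>al ` idx D. Real_Vector_Spaces.representation (al ` idx D) v b *\<^sub>R b) = v"
    by (rule real_vector.sum_representation_eq) (auto simp: indep_al span_al finite_idx)
  then show ?thesis
    by (simp add: sum.reindex[OF inj_al] coef_def)
qed

lemma coef_eqI: "(\<And>i. i \<in> idx D \<Longrightarrow> coef i u = coef i v) \<Longrightarrow> u = v"
  by (subst coef_expand[of u, symmetric], subst coef_expand[of v, symmetric]) (simp cong: sum.cong)

lemma nonneg_comb_iff: "v \<in> nonneg_comb D \<longleftrightarrow> (\<forall>i\<in>idx D. coef i v \<in> \<nat>)"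
proof
  assume "v \<in> nonneg_comb D"
  then obtain k :: "nat \<Rightarrow> nat" where "v = (\<Sum>i\<in>idx D. real (k i) *\<^sub>R al i)"
    by (auto simp: nonneg_comb_def)
  moreover have "(\<Sum>j\<in>idx D. real (k j) * coef i (al j)) = real (k i)" if "i \<in> idx D" for i
  proof -
    have "(\<Sum>j\<in>idx D. real (k j) * coef i (al j)) = (\<Sum>j\<in>idx D. if j = i then real (k j) else 0)"
      using that by (intro sum.cong) (auto simp: coef_al)
    then show ?thesis using that by (simp add: finite_idx)
  qed
  ultimately show "\<forall>i\<in>idx D. coef i v \<in> \<nat>"
    by (auto simp: coef_sum coef_scale)
next
  assume "\<forall>i\<in>idx D. coef i v \<in> \<nat>"
  then have "\<forall>i\<in>idx D. \<exists>k. coef i v = real k" by (auto simp: Nats_def)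
  then obtain k where "\<forall>i\<in>idx D. coef i v = real (k i)" by metis
  then have "v = (\<Sum>i\<in>idx D. real (k i) *\<^sub>R al i)"
    by (subst coef_expand[of v, symmetric]) (rule sum.cong, auto)
  then show "v \<in> nonneg_comb D" by (auto simp: nonneg_comb_def)
qed

definition pos :: "'v \<Rightarrow> bool" where "pos v \<longleftrightarrow> v \<in> nonneg_comb D"

lemma pos_coef: "pos v \<Longrightarrow> i \<in> idx D \<Longrightarrow> coef i v \<ge> 0"
  by (auto simp: pos_def nonneg_comb_iff Nats_def)

lemma pos_antisym: "pos v \<Longrightarrow> pos (- v) \<Longrightarrow> v = 0"
  by (rule coef_eqI) (use pos_coef[of v] pos_coef[of "- v"] in \<open>force simp: coef_uminus\<close>)

lemma neg_root: "\<beta> \<in> roots D \<Longrightarrow> \<not> pos \<beta> \<longleftrightarrow> pos (- \<beta>)"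
  using root_pos_or_neg pos_antisym zero_notin_roots unfolding pos_def by metis

lemma pos_al: "i \<in> idx D \<Longrightarrow> pos (al i)"
  by (auto simp: pos_def nonneg_comb_iff coef_al)

lemma coroot_scale: "coroot (c *\<^sub>R v) = (1 / c) *\<^sub>R coroot v"
  by (cases "c = 0") (auto simp: coroot_def field_simps)

lemma coroot_uminus: "coroot (- v) = - coroot v"
  by (simp add: coroot_def)

lemma inner_coroot: "v \<noteq> 0 \<Longrightarrow> coroot v \<bullet> v = 2"
  by (simp add: coroot_def)

lemma al_nz: "i \<in> idx D \<Longrightarrow> al i \<noteq> 0"
  using al_root zero_notin_roots by metis

lemma sr_def: "sr i v = v - (v \<bullet> al i) *\<^sub>R coroot (al i)"
  by (simp add: srefl_def reflection_def)

lemma linear_sr: "linear (sr i)"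
  by (rule linearI) (simp_all add: sr_def algebra_simps inner_add_left)

lemma sr_sr: "i \<in> idx D \<Longrightarrow> sr i (sr i v) = v"
  using inner_coroot[OF al_nz] by (simp add: sr_def algebra_simps)

lemma sr_inner: "i \<in> idx D \<Longrightarrow> sr i u \<bullet> sr i v = u \<bullet> v"
  using al_nz[of i] by (simp add: sr_def coroot_def inner_diff_left inner_diff_right inner_commute field_simps)

lemma sr_al: "i \<in> idx D \<Longrightarrow> sr i (al i) = - al i"
  using al_nz[of i] by (simp add: sr_def coroot_def scaleR_2)

lemma sr_root: "i \<in> idx D \<Longrightarrow> \<beta> \<in> roots D \<Longrightarrow> sr i \<beta> \<in> roots D"
  using refl_root[OF al_root] by (simp add: srefl_def)

lemma sr_L: assumes "i \<in> idx D" "\<mu> \<in> L" shows "sr i \<mu> \<in> L"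
proof -
  obtain k where "\<mu> \<bullet> al i = of_int k"
    using L_integral[OF assms(2) al_root[OF assms(1)]] by (auto elim: Ints_cases)
  then show ?thesis
    using assms L_diff L_of_int coroot_in_L al_root by (simp add: sr_def)
qed

lemma coef_sr: "i \<in> idx D \<Longrightarrow> j \<in> idx D \<Longrightarrow> j \<noteq> i \<Longrightarrow> coef j (sr i v) = coef j v"
  by (simp add: sr_def coroot_def coef_diff coef_scale coef_al)

lemma uminus_root: assumes "\<beta> \<in> roots D" shows "- \<beta> \<in> roots D"
proof -
  have "\<beta> \<noteq> 0" using assms zero_notin_roots by metis
  then have "reflection \<beta> \<beta> = - \<beta>" by (simp add: reflection_def coroot_def scaleR_2)
  then show ?thesis using refl_root[OF assms assms] by simp
qed

section \<open>Words in the simple reflections and the group that they form\<close>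

lemma word_elt_Nil [simp]: "we [] = id"
  and word_elt_Cons: "we (i # is) = sr i \<circ> we is"
  by (simp_all add: word_elt_def)

lemma word_elt_append: "we (is @ js) = we is \<circ> we js"
  by (induction "is") (simp_all add: word_elt_Cons comp_assoc)

lemma linear_word: "linear (we is)"
proof (induction "is")
  case (Cons i "is")
  then show ?case using linear_compose[OF Cons linear_sr] by (simp only: word_elt_Cons)
qed (simp add: linear_iff)

lemma word_rev: "set is \<subseteq> idx D \<Longrightarrow> we (rev is) (we is v) = v"
  by (induction "is" arbitrary: v) (auto simp: word_elt_Cons word_elt_append sr_sr)

lemma word_rev': "set is \<subseteq> idx D \<Longrightarrow> we is (we (rev is) v) = v"
  using word_rev[of "rev is"] by simp

lemma bij_word: "set is \<subseteq> idx D \<Longrightarrow> bij (we is)"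
  by (rule o_bij[of "we (rev is)"]) (auto simp: word_rev word_rev')

lemma inv_word: "set is \<subseteq> idx D \<Longrightarrow> inv (we is) = we (rev is)"
  by (rule inv_equality) (auto simp: word_rev word_rev')

lemma word_inner: "set is \<subseteq> idx D \<Longrightarrow> we is u \<bullet> we is v = u \<bullet> v"
  by (induction "is") (auto simp: word_elt_Cons sr_inner)

lemma word_root: "set is \<subseteq> idx D \<Longrightarrow> \<beta> \<in> roots D \<Longrightarrow> we is \<beta> \<in> roots D"
  by (induction "is") (auto simp: word_elt_Cons sr_root)

lemma word_L: "set is \<subseteq> idx D \<Longrightarrow> \<mu> \<in> L \<Longrightarrow> we is \<mu> \<in> L"
  by (induction "is") (auto simp: word_elt_Cons sr_L)

lemma parabolicE: 
  assumes "w \<in> parabolic D I"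
  obtains "is" where "set is \<subseteq> I" "w = we is"
  using assms by (auto simp: parabolic_def)

lemma parabolicI: "set is \<subseteq> I \<Longrightarrow> we is \<in> parabolic D I"
  by (auto simp: parabolic_def)

lemma parabolic_mono: "I \<subseteq> I' \<Longrightarrow> parabolic D I \<subseteq> parabolic D I'"
  unfolding parabolic_def by blast

lemma id_parabolic: "id \<in> parabolic D I"
  using parabolicI[of "[]" I] by simp

lemma comp_parabolic: "u \<in> parabolic D I \<Longrightarrow> w \<in> parabolic D I \<Longrightarrow> u \<circ> w \<in> parabolic D I"
  by (auto elim!: parabolicE intro!: parabolicI simp flip: word_elt_append simp: subset_iff)

lemma sr_parabolic: "i \<in> I \<Longrightarrow> sr i \<in> parabolic D I"
  using parabolicI[of "[i]" I] by (simp add: word_elt_Cons)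

lemma W0E: 
  assumes "w \<in> W0 D"
  obtains "is" where "set is \<subseteq> idx D" "w = we is"
  using assms by (auto simp: W0_def elim: parabolicE)

lemma word_W0: "set is \<subseteq> idx D \<Longrightarrow> we is \<in> W0 D"
  by (simp add: W0_def parabolicI)

lemma W0_id: "id \<in> W0 D" and W0_comp: "u \<in> W0 D \<Longrightarrow> w \<in> W0 D \<Longrightarrow> u \<circ> w \<in> W0 D"
  and W0_sr: "i \<in> idx D \<Longrightarrow> sr i \<in> W0 D"
  by (simp_all add: W0_def id_parabolic comp_parabolic sr_parabolic)

lemma parabolic_W0: "I \<subseteq> idx D \<Longrightarrow> w \<in> parabolic D I \<Longrightarrow> w \<in> W0 D"
  using parabolic_mono W0_def by blast

lemma inv_parabolic: "I \<subseteq> idx D \<Longrightarrow> w \<in> parabolic D I \<Longrightarrow> inv w \<in> parabolic D I"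
  by (erule parabolicE) (simp add: inv_word parabolicI)

lemma W0_inv: "w \<in> W0 D \<Longrightarrow> inv w \<in> W0 D"
  by (simp add: W0_def inv_parabolic)

lemma W0_linear: "w \<in> W0 D \<Longrightarrow> linear w"
  and W0_bij: "w \<in> W0 D \<Longrightarrow> bij w"
  and W0_inner: "w \<in> W0 D \<Longrightarrow> w u \<bullet> w v = u \<bullet> v"
  and W0_root: "w \<in> W0 D \<Longrightarrow> \<beta> \<in> roots D \<Longrightarrow> w \<beta> \<in> roots D"
  and W0_L: "w \<in> W0 D \<Longrightarrow> \<mu> \<in> L \<Longrightarrow> w \<mu> \<in> L"
  by (auto elim!: W0E simp: linear_word bij_word word_inner word_root word_L)

lemma W0_inv_apply: "w \<in> W0 D \<Longrightarrow> inv w (w v) = v" "w \<in> W0 D \<Longrightarrow> w (inv w v) = v"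
  using W0_bij by (auto simp: bij_def surj_f_inv_f)

lemma W0_uminus: "w \<in> W0 D \<Longrightarrow> w (- v) = - w v"
  and W0_scale: "w \<in> W0 D \<Longrightarrow> w (c *\<^sub>R v) = c *\<^sub>R w v"
  and W0_add: "w \<in> W0 D \<Longrightarrow> w (u + v) = w u + w v"
  using W0_linear by (auto simp: linear_neg linear_scale linear_add)

lemma inv_sr: "i \<in> idx D \<Longrightarrow> inv (sr i) = sr i"
  by (rule inv_equality) (auto simp: sr_sr)

lemma inv_comp_W0: "u \<in> W0 D \<Longrightarrow> w \<in> W0 D \<Longrightarrow> inv (u \<circ> w) = inv w \<circ> inv u"
  by (simp add: W0_bij o_inv_distrib)

lemma W0_coroot: "w \<in> W0 D \<Longrightarrow> coroot (w v) = w (coroot v)"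
  by (simp add: coroot_def W0_inner W0_scale)

lemma refl_conj: assumes "w \<in> W0 D" shows "reflection (w \<alpha>) (w v) = w (reflection \<alpha> v)"
  using assms W0_linear[OF assms]
  by (simp add: reflection_def W0_inner W0_coroot linear_diff linear_scale)

text \<open>A linear map is determined by its restriction to the roots, a finite spanning set that
  the group preserves.\<close>

lemma finite_W0: "finite (W0 D)"
proof -
  have "inj_on (\<lambda>w. restrict w (roots D)) (W0 D)"
  proof (rule inj_onI)
    fix u w assume uw: "u \<in> W0 D" "w \<in> W0 D" "restrict u (roots D) = restrict w (roots D)"
    have "u v = w v" for v
    proof (rule linear_eq_on[of u w _ "roots D"])
      show "u b = w b" if "b \<in> roots D" for b using that uw(3) by (metis restrict_apply')
    qed (use uw W0_linear span_roots in auto)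
    then show "u = w" by auto
  qed
  moreover have "(\<lambda>w. restrict w (roots D)) ` W0 D \<subseteq> (roots D \<rightarrow>\<^sub>E roots D)"
    using W0_root by auto
  ultimately show ?thesis
    by (meson finite_PiE finite_roots inj_on_finite)
qed

lemma scaled_root:
  assumes "\<alpha> \<in> roots D" "c *\<^sub>R \<alpha> \<in> roots D"
  shows "2 / c \<in> \<int>"
proof -
  have "c \<noteq> 0" "\<alpha> \<noteq> 0" using assms zero_notin_roots by auto
  then show ?thesis
    using integral_root[OF assms(2,1)] by (simp add: coroot_def field_simps)
qed

lemma R0_root: "\<beta> \<in> R0 D \<Longrightarrow> \<beta> \<in> roots D"
  by (auto simp: R0_def R1_def R2_def)

lemma R12_disj: "\<beta> \<in> R1 D \<Longrightarrow> \<beta> \<notin> R2 D"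
  by (auto simp: R1_def R2_def)

text \<open>Half a simple root has a coordinate that is not an integer, so it is no root. Hence a
  simple root lies in \<open>R2\<close> or \<open>R1\<close> according to whether its double is a
  root.\<close>

lemma al_R0: assumes "i \<in> idx D" shows "al i \<in> R0 D"
proof (cases "2 *\<^sub>R al i \<in> roots D")
  case False
  have "(1/2) *\<^sub>R al i \<notin> roots D"
  proof
    assume "(1/2) *\<^sub>R al i \<in> roots D"
    then have "pos ((1/2) *\<^sub>R al i) \<or> pos (- ((1/2) *\<^sub>R al i))"
      using root_pos_or_neg pos_def by blast
    then have "1/2 \<in> (\<nat> :: real set) \<or> - (1/2) \<in> (\<nat> :: real set)"
      using assms by (auto simp: pos_def nonneg_comb_iff coef_scale coef_uminus coef_al)
    then show False
    proof
      assume "1/2 \<in> (\<nat> :: real set)"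
      then obtain n where "1/2 = real n" by (auto simp: Nats_def)
      then have "real 1 = real (2 * n)" by simp
      then show False by (simp only: of_nat_eq_iff) presburger
    next
      assume "- (1/2) \<in> (\<nat> :: real set)"
      then obtain n where "- (1/2) = real n" by (auto simp: Nats_def)
      then show False using of_nat_0_le_iff[of n, where ?'a = real] by linarith
    qed
  qed
  with False show ?thesis using al_root[OF assms] by (auto simp: R0_def R1_def)
qed (use al_root[OF assms] in \<open>auto simp: R0_def R2_def\<close>)

lemma W0_root_iff: "w \<in> W0 D \<Longrightarrow> w \<beta> \<in> roots D \<longleftrightarrow> \<beta> \<in> roots D"
  using W0_root[of w \<beta>] W0_root[OF W0_inv, of w "w \<beta>"] by (auto simp: W0_inv_apply)

lemma W0_R1_iff: "w \<in> W0 D \<Longrightarrow> w \<beta> \<in> R1 D \<longleftrightarrow> \<beta> \<in> R1 D"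
  by (simp add: R1_def W0_root_iff flip: W0_scale)

lemma W0_R0_iff: "w \<in> W0 D \<Longrightarrow> w \<beta> \<in> R0 D \<longleftrightarrow> \<beta> \<in> R0 D"
  by (simp add: R0_def R1_def R2_def W0_root_iff flip: W0_scale)

lemma uminus_root_iff: "- \<beta> \<in> roots D \<longleftrightarrow> \<beta> \<in> roots D"
  using uminus_root[of \<beta>] uminus_root[of "- \<beta>"] by auto

lemma uminus_R1_iff: "- \<beta> \<in> R1 D \<longleftrightarrow> \<beta> \<in> R1 D" and uminus_R0_iff: "- \<beta> \<in> R0 D \<longleftrightarrow> \<beta> \<in> R0 D"
  by (simp_all add: R0_def R1_def R2_def uminus_root_iff)

lemma R0_pos_iff: "\<beta> \<in> R0_pos D \<longleftrightarrow> \<beta> \<in> R0 D \<and> pos \<beta>"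
  using R0_root by (auto simp: R0_pos_def pos_roots_def pos_def)

text \<open>Such a root has a positive coordinate at some index other than \<open>i\<close>, which
  \<open>sr i\<close> leaves unchanged, and a root with a positive coordinate is positive. The
  restriction to \<open>R0\<close> matters: in a non-reduced system \<open>2 al i\<close> can be a
  positive root that becomes negative.\<close>

lemma sr_pos:
  assumes i: "i \<in> idx D" and \<beta>: "\<beta> \<in> R0 D" "pos \<beta>" "\<beta> \<noteq> al i"
  shows "pos (sr i \<beta>)"
proof -
  have "\<exists>j\<in>idx D. j \<noteq> i \<and> coef j \<beta> \<noteq> 0"
  proof (rule ccontr)
    assume *: "\<not> (\<exists>j\<in>idx D. j \<noteq> i \<and> coef j \<beta> \<noteq> 0)"
    have "\<beta> = coef i \<beta> *\<^sub>R al i"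
      using * i by (intro coef_eqI) (auto simp: coef_scale coef_al)
    moreover obtain n where n: "coef i \<beta> = real n"
      using \<beta>(2) i by (auto simp: pos_def nonneg_comb_iff Nats_def)
    ultimately have b: "\<beta> = real n *\<^sub>R al i" by simp
    \<comment> \<open>Integrality bounds the multiples: the pairing of \<open>al i\<close> with the
      coroot of \<open>m al i\<close> is \<open>2 / m\<close>.\<close>
    have small: "m \<le> 2" if m: "real m *\<^sub>R al i \<in> roots D" for m
    proof -
      have "2 / real m \<in> \<int>" using scaled_root[OF al_root[OF i] m] .
      moreover have "m > 0" using m zero_notin_roots by (cases m) auto
      ultimately obtain k where k: "2 / real m = of_int k" "m > 0" by (auto elim: Ints_cases)
      then have "of_int (k * int m) = (of_int 2 :: real)" by (simp add: field_simps)
      then have "k * int m = 2" by (simp only: of_int_eq_iff)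
      then have "int m dvd 2" by (metis dvd_triv_right)
      then show "m \<le> 2" by (auto dest: zdvd_imp_le)
    qed
    have "n \<le> 2" "n \<noteq> 1"
      using small[of n] R0_root[OF \<beta>(1)] \<beta>(3) by (auto simp: b)
    moreover have "n \<noteq> 0"
    proof
      assume "n = 0"
      then have "\<beta> = 0" by (simp add: b)
      then show False using R0_root[OF \<beta>(1)] zero_notin_roots by simp
    qed
    ultimately have n2: "n = 2" by simp
    have "(1/2) *\<^sub>R \<beta> \<in> roots D" using al_root[OF i] by (simp add: b n2)
    then have "2 *\<^sub>R \<beta> \<in> roots D" using \<beta>(1) by (auto simp: R0_def R1_def R2_def)
    then show False using small[of 4] by (simp add: b n2)
  qed
  then obtain j where j: "j \<in> idx D" "j \<noteq> i" "coef j \<beta> \<noteq> 0" by blast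
  show ?thesis
  proof (rule ccontr)
    assume "\<not> pos (sr i \<beta>)"
    then have "pos (- sr i \<beta>)" using sr_root[OF i R0_root[OF \<beta>(1)]] neg_root by blast
    then show False
      using pos_coef[OF _ j(1), of "- sr i \<beta>"] pos_coef[OF \<beta>(2) j(1)] j i
      by (simp add: coef_uminus coef_sr)
  qed
qed

section \<open>Exchange and reduced words\<close>

text \<open>Apply the letters to \<open>\<beta>\<close> one at a time. When the root first becomes
  negative, \<open>sr_pos\<close> says that it was the simple root of the letter being
  applied.\<close>

lemma exchange_root:
  assumes "set is \<subseteq> idx D" "\<beta> \<in> R0 D" "pos \<beta>" "\<not> pos (we (rev is) \<beta>)"
  shows "\<exists>p<length is. we (rev (take p is)) \<beta> = al (is ! p)"
  using assms
proof (induction "is" arbitrary: \<beta>)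
  case (Cons k "is")
  show ?case
  proof (cases "\<beta> = al k")
    case False
    have "\<exists>p<length is. we (rev (take p is)) (sr k \<beta>) = al (is ! p)"
    proof (rule Cons.IH)
      show "sr k \<beta> \<in> R0 D" using Cons.prems W0_R0_iff[OF W0_sr] by simp
      show "pos (sr k \<beta>)" using Cons.prems False sr_pos by simp
      show "\<not> pos (we (rev is) (sr k \<beta>))"
        using Cons.prems by (simp add: word_elt_append word_elt_Cons)
    qed (use Cons.prems in auto)
    then obtain p where "p < length is" "we (rev (take p is)) (sr k \<beta>) = al (is ! p)" by blast
    then show ?thesis
      by (intro exI[of _ "Suc p"]) (auto simp: word_elt_append word_elt_Cons)
  qed (auto intro!: exI[of _ 0])
qed simp

text \<open>The initial part of the word found by \<open>exchange_root\<close> conjugates a letter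
  of the word into \<open>sr i\<close>, so multiplication by \<open>sr i\<close> on the left deletes
  that letter.\<close>

lemma exchange:
  assumes "set is \<subseteq> idx D" "i \<in> idx D" "\<not> pos (we (rev is) (al i))"
  shows "\<exists>p<length is. sr i \<circ> we is = we (take p is @ drop (Suc p) is)"
proof -
  obtain p where p: "p < length is" "we (rev (take p is)) (al i) = al (is ! p)"
    using exchange_root[OF assms(1) al_R0[OF assms(2)] pos_al[OF assms(2)] assms(3)] by blast
  define u where "u = we (take p is)"
  have tp: "set (take p is) \<subseteq> idx D" using assms(1) set_take_subset by fastforce
  then have u: "u \<in> W0 D" by (simp add: u_def word_W0)
  have ip: "is ! p \<in> idx D" using assms(1) p(1) by (meson nth_mem subsetD)
  have "al i = u (al (is ! p))"
    using p(2) word_rev'[OF tp, of "al i"] by (simp add: u_def)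
  then have conj: "sr i (u v) = u (sr (is ! p) v)" for v
    using refl_conj[OF u] by (simp add: srefl_def)
  have "is = take p is @ (is ! p) # drop (Suc p) is" using p(1) by (simp add: id_take_nth_drop)
  then have "we is = u \<circ> (sr (is ! p) \<circ> we (drop (Suc p) is))"
    by (metis u_def word_elt_append word_elt_Cons)
  then have "sr i \<circ> we is = u \<circ> we (drop (Suc p) is)"
    by (auto simp: fun_eq_iff conj sr_sr[OF ip])
  then show ?thesis using p(1) by (auto simp: word_elt_append u_def)
qed

section \<open>The length function and reduced words\<close>

definition len :: "('v \<Rightarrow> 'v) \<Rightarrow> nat" where
  "len w = (LEAST n. \<exists>is. set is \<subseteq> idx D \<and> we is = w \<and> length is = n)"

lemma len_le: "set is \<subseteq> idx D \<Longrightarrow> len (we is) \<le> length is"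
  unfolding len_def by (rule Least_le) auto

lemma len_ex: assumes "w \<in> W0 D" obtains "is" where "set is \<subseteq> idx D" "we is = w" "length is = len w"
proof -
  have "\<exists>n is. set is \<subseteq> idx D \<and> we is = w \<and> length is = n" using assms by (auto elim: W0E)
  then show ?thesis using LeastI_ex[of "\<lambda>n. \<exists>is. set is \<subseteq> idx D \<and> we is = w \<and> length is = n"] that
    unfolding len_def by blast
qed

lemma reduced_iff: "reduced_word D is \<longleftrightarrow> set is \<subseteq> idx D \<and> length is = len (we is)"
proof -
  have "length is \<le> length js" if "length is = len (we is)" "set js \<subseteq> idx D" "we js = we is" for js
    using that len_le[of js] by simp
  moreover have "length is = len (we is)"
    if red: "\<forall>js. set js \<subseteq> idx D \<and> we js = we is \<longrightarrow> length is \<le> length js" and set: "set is \<subseteq> idx D"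
  proof -
    obtain js where "set js \<subseteq> idx D" "we js = we is" "length js = len (we is)"
      using len_ex[OF word_W0[OF set]] by blast
    then show ?thesis using red len_le[OF set] by (metis le_antisym)
  qed
  ultimately show ?thesis unfolding reduced_word_def by blast
qed

lemma len_id: "len id = 0"
  using len_le[of "[]"] by simp

lemma len_sr_le: assumes "w \<in> W0 D" "i \<in> idx D" shows "len (sr i \<circ> w) \<le> Suc (len w)"
proof -
  obtain "is" where "set is \<subseteq> idx D" "we is = w" "length is = len w" using len_ex[OF assms(1)] .
  then show ?thesis using len_le[of "i # is"] assms(2) by (simp add: word_elt_Cons)
qed

lemma sr_comp_sr: "i \<in> idx D \<Longrightarrow> sr i \<circ> (sr i \<circ> w) = w"
  by (auto simp: fun_eq_iff sr_sr)

lemma len_down: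
  assumes "w \<in> W0 D" "i \<in> idx D" "\<not> pos (inv w (al i))"
  shows "len w = Suc (len (sr i \<circ> w))"
proof -
  obtain "is" where ws: "set is \<subseteq> idx D" "we is = w" "length is = len w" using len_ex[OF assms(1)] .
  obtain p where p: "p < length is" "sr i \<circ> we is = we (take p is @ drop (Suc p) is)"
    using exchange[OF ws(1) assms(2)] assms(3) inv_word[OF ws(1)] ws(2) by auto
  have "set (take p is @ drop (Suc p) is) \<subseteq> idx D"
    using ws(1) set_take_subset[of p "is"] set_drop_subset[of "Suc p" "is"] by auto
  from len_le[OF this] have "len (sr i \<circ> w) < len w" using p ws by simp
  moreover have "len w \<le> Suc (len (sr i \<circ> w))"
    using len_sr_le[OF W0_comp[OF W0_sr[OF assms(2)] assms(1)] assms(2)] assms(2)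
    by (simp add: sr_comp_sr)
  ultimately show ?thesis by simp
qed

lemma inv_sr_comp: "w \<in> W0 D \<Longrightarrow> i \<in> idx D \<Longrightarrow> inv (sr i \<circ> w) v = inv w (sr i v)"
  by (simp add: inv_comp_W0 W0_sr inv_sr)

lemma pos_inv_sr:
  assumes "w \<in> W0 D" "i \<in> idx D"
  shows "pos (inv (sr i \<circ> w) (al i)) \<longleftrightarrow> \<not> pos (inv w (al i))"
  using assms neg_root[OF W0_root[OF W0_inv al_root]]
  by (simp add: inv_sr_comp sr_al W0_uminus W0_inv)

lemma len_up:
  assumes "w \<in> W0 D" "i \<in> idx D" "pos (inv w (al i))"
  shows "len (sr i \<circ> w) = Suc (len w)"
  using len_down[of "sr i \<circ> w" i] assms
  by (simp add: W0_comp W0_sr pos_inv_sr sr_comp_sr)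

text \<open>Positivity of \<open>inv w (al i)\<close> decides whether \<open>sr i\<close> raises or
  lowers the length of \<open>w\<close>, so reducedness can be tested letter by letter from the
  right.\<close>

lemma reduced_Cons:
  "reduced_word D (i # is) \<longleftrightarrow> i \<in> idx D \<and> reduced_word D is \<and> pos (inv (we is) (al i))"
proof (cases "i \<in> idx D \<and> set is \<subseteq> idx D")
  case True
  then show ?thesis
    using len_up[OF word_W0, of "is" i] len_down[OF word_W0, of "is" i] len_le[of "is"]
    by (cases "pos (inv (we is) (al i))") (auto simp: reduced_iff word_elt_Cons)
qed (auto simp: reduced_iff)

lemma reduced_Nil: "reduced_word D []"
  by (simp add: reduced_iff len_id)

text \<open>Exchange only deletes letters, so shortening a word in \<open>I\<close> never leaves
  \<open>I\<close>. Reducedness refers to the whole group \<open>W0\<close>.\<close>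

lemma reduced_in_parabolic:
  assumes "I \<subseteq> idx D" "w \<in> parabolic D I"
  obtains "is" where "set is \<subseteq> I" "reduced_word D is" "we is = w"
proof -
  have "\<exists>js. set js \<subseteq> I \<and> reduced_word D js \<and> we js = we is" if "set is \<subseteq> I" for "is"
    using that
  proof (induction "is")
    case Nil then show ?case using reduced_Nil by force
  next
    case (Cons i "is")
    then obtain js where js: "set js \<subseteq> I" "reduced_word D js" "we js = we is" by auto
    have i: "i \<in> idx D" "set js \<subseteq> idx D" using Cons.prems js assms(1) by auto
    show ?case
    proof (cases "pos (inv (we js) (al i))")
      case True
      then show ?thesis
        using js i Cons.prems by (intro exI[of _ "i # js"]) (auto simp: reduced_Cons word_elt_Cons)
    next
      case False
      then obtain p where p: "p < length js" "sr i \<circ> we js = we (take p js @ drop (Suc p) js)"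
        using exchange[OF i(2,1)] inv_word[OF i(2)] by auto
      define k where "k = take p js @ drop (Suc p) js"
      have k: "set k \<subseteq> I"
        using js(1) set_take_subset[of p js] set_drop_subset[of "Suc p" js] by (auto simp: k_def)
      have wk: "sr i \<circ> we js = we k" using p(2) by (simp only: k_def)
      have "length js = Suc (length k)" using p(1) by (simp add: k_def)
      moreover have "length js = len (we js)" using js(2) by (simp add: reduced_iff)
      ultimately have "length k = len (we k)"
        using len_down[OF word_W0[OF i(2)] i(1) False] unfolding wk by linarith
      moreover have "set k \<subseteq> idx D" using k assms(1) by (rule order_trans)
      moreover have "we k = we (i # is)" unfolding wk[symmetric] js(3) by (rule word_elt_Cons[symmetric])
      ultimately show ?thesis using k by (auto simp only: reduced_iff)
    qed
  qed
  then show ?thesis using assms(2) that by (metis parabolicE)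
qed

lemma reduced_ex: assumes "w \<in> W0 D" obtains "is" where "reduced_word D is" "we is = w"
  using reduced_in_parabolic[of "idx D" w] assms by (auto simp: W0_def)

end

section \<open>Dihedral subgroups and Matsumoto's theorem\<close>

fun altw :: "nat \<Rightarrow> nat \<Rightarrow> nat \<Rightarrow> nat list" where
  "altw 0 i j = []"
| "altw (Suc m) i j = i # altw m j i"

text \<open>The letter at position \<open>m\<close>, counted from 0, of the infinite alternating
  word starting with \<open>i\<close>; thus it is the one that follows
  \<open>altw m i j\<close>.\<close>

definition letter :: "nat \<Rightarrow> nat \<Rightarrow> nat \<Rightarrow> nat" where
  "letter m i j = (if even m then i else j)"

lemma letter_simps [simp]: "letter 0 i j = i" "letter (Suc m) i j = letter m j i"
  "letter m i i = i" "letter m (letter n i j) (letter n j i) = letter (m + n) i j"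
  by (auto simp: letter_def)

lemma length_altw [simp]: "length (altw m i j) = m"
  by (induction m arbitrary: i j) auto

lemma altw_add: "altw (m + n) i j = altw m i j @ altw n (letter m i j) (letter m j i)"
  by (induction m arbitrary: i j) auto

lemma altw_snoc: "altw (Suc m) i j = altw m i j @ [letter m i j]"
  using altw_add[of m 1 i j] by simp

lemma rev_altw: "rev (altw m i j) = (if even m then altw m j i else altw m i j)"
proof (induction m arbitrary: i j)
  case (Suc m)
  have "rev (altw (Suc m) i j) = rev (altw m j i) @ [i]" by simp
  then show ?case
    using Suc altw_snoc[of m i j] altw_snoc[of m j i] by (auto simp: letter_def simp del: altw.simps)
qed simp

lemma altw_double: "altw (2 * n) i j = altw n i j @ rev (altw n j i)"
  using altw_add[of n n i j] by (auto simp: rev_altw letter_def mult_2)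

lemma altw_nth: "k < m \<Longrightarrow> altw m i j ! k = letter k i j"
  by (induction m arbitrary: i j k) (auto simp: nth_Cons split: nat.split)

lemma set_altw: "set (altw m i j) \<subseteq> {i, j}"
proof (induction m arbitrary: i j)
  case (Suc m)
  then show ?case using Suc[of j i] by auto
qed simp

lemma alt_prod_altw: "alt_prod m (f i) (f j) = prod_list (map f (altw m i j))"
  by (induction m arbitrary: i j) auto

context hecke
begin

abbreviation cox where "cox \<equiv> coxeter_order D"

lemma word_altw_double: "we (altw (2 * n) i j) = (sr i \<circ> sr j) ^^ n"
  by (induction n) (simp_all add: word_elt_Cons comp_assoc)

lemma altw_idx: "i \<in> idx D \<Longrightarrow> j \<in> idx D \<Longrightarrow> set (altw m i j) \<subseteq> idx D"
  using set_altw[of m i j] by auto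

text \<open>The alternating word of length \<open>2 n\<close> splits into \<open>altw n i j\<close>
  and the reversal, hence the inverse, of \<open>altw n j i\<close>.\<close>

lemma power_id_iff:
  assumes "i \<in> idx D" "j \<in> idx D"
  shows "(sr i \<circ> sr j) ^^ n = id \<longleftrightarrow> we (altw n i j) = we (altw n j i)"
proof
  assume "(sr i \<circ> sr j) ^^ n = id"
  then have *: "we (altw n i j) (we (rev (altw n j i)) v) = v" for v
    by (simp add: word_altw_double[symmetric] altw_double word_elt_append fun_eq_iff)
  have "we (altw n i j) v = we (altw n j i) v" for v
    using *[of "we (altw n j i) v"] word_rev[of "altw n j i" v] altw_idx[OF assms(2,1)] by simp
  then show "we (altw n i j) = we (altw n j i)" by auto
next
  assume "we (altw n i j) = we (altw n j i)"
  then show "(sr i \<circ> sr j) ^^ n = id"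
    using word_rev'[OF altw_idx[OF assms(2,1), of n]]
    by (simp add: word_altw_double[symmetric] altw_double word_elt_append fun_eq_iff)
qed

text \<open>Two powers coincide because the group is finite. This gives the \<open>LEAST\<close> in
  \<open>coxeter_order\<close> its meaning.\<close>

lemma cox_ex:
  assumes "i \<in> idx D" "j \<in> idx D"
  shows "\<exists>m>0. (sr i \<circ> sr j) ^^ m = id"
proof -
  let ?g = "sr i \<circ> sr j"
  have g: "?g \<in> W0 D" using assms W0_comp W0_sr by blast
  have pow: "?g ^^ n \<in> W0 D" for n
    by (induction n) (simp_all only: funpow.simps W0_id W0_comp g)
  have "\<not> inj (\<lambda>n. ?g ^^ n)"
  proof
    assume "inj (\<lambda>n. ?g ^^ n)"
    moreover have "range (\<lambda>n. ?g ^^ n) \<subseteq> W0 D" using pow by auto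
    ultimately show False using finite_W0 by (meson finite_imageD finite_subset infinite_UNIV_nat)
  qed
  then obtain a b where ab: "a < b" "?g ^^ a = ?g ^^ b"
    by (auto simp: inj_def) (metis linorder_neqE_nat)
  have "?g ^^ (b - a) = id"
  proof
    fix v
    have "(?g ^^ a) ((?g ^^ (b - a)) v) = (?g ^^ a) v"
    proof -
      have "?g ^^ (a + (b - a)) = ?g ^^ a \<circ> ?g ^^ (b - a)" by (rule funpow_add)
      then show ?thesis using ab by (simp only: le_add_diff_inverse less_imp_le fun_eq_iff comp_apply)
    qed
    moreover have "inj (?g ^^ a)" using W0_bij[OF pow] by (simp add: bij_def)
    ultimately show "(?g ^^ (b - a)) v = id v" by (simp add: inj_eq)
  qed
  then show ?thesis using ab(1) by (intro exI[of _ "b - a"]) auto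
qed

lemma cox_pos: "i \<in> idx D \<Longrightarrow> j \<in> idx D \<Longrightarrow> cox i j > 0"
  and cox_power: "i \<in> idx D \<Longrightarrow> j \<in> idx D \<Longrightarrow> (sr i \<circ> sr j) ^^ cox i j = id"
  using LeastI_ex[OF cox_ex[of i j]] unfolding coxeter_order_def by auto

lemma cox_least: "m > 0 \<Longrightarrow> (sr i \<circ> sr j) ^^ m = id \<Longrightarrow> cox i j \<le> m"
  unfolding coxeter_order_def by (rule Least_le) auto

lemma cox_sym: "i \<in> idx D \<Longrightarrow> j \<in> idx D \<Longrightarrow> cox i j = cox j i"
  using power_id_iff[of i j] power_id_iff[of j i] unfolding coxeter_order_def by metis

lemma word_cox: "i \<in> idx D \<Longrightarrow> j \<in> idx D \<Longrightarrow> we (altw (cox i j) i j) = we (altw (cox i j) j i)"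
  using cox_power power_id_iff by blast

text \<open>If the root were negative, exchange would identify the two alternating words of some
  length at most \<open>c\<close>, so a power of \<open>sr i \<circ> sr j\<close> with exponent
  below \<open>cox i j\<close> would be trivial.\<close>

lemma dihedral_pos:
  assumes ij: "i \<in> idx D" "j \<in> idx D" and c: "c < cox i j"
  shows "pos (we (altw c i j) (al (letter c i j)))"
proof (rule ccontr)
  assume neg: "\<not> pos (we (altw c i j) (al (letter c i j)))"
  let ?is = "rev (altw c i j)"
  have l: "letter n i j \<in> idx D" "letter n j i \<in> idx D" for n using ij by (auto simp: letter_def)
  have "\<exists>p<length ?is. we (rev (take p ?is)) (al (letter c i j)) = al (?is ! p)"
    using neg altw_idx[OF ij] l pos_al al_R0 by (intro exchange_root) auto
  then obtain p where p: "p < c" "we (rev (take p ?is)) (al (letter c i j)) = al (?is ! p)" by auto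
  \<comment> \<open>The last \<open>p\<close> letters of \<open>altw c i j\<close> alternate between
    \<open>x\<close> and \<open>y\<close>, beginning with \<open>x\<close>.\<close>
  define x y where "x = letter (c - p) i j" and "y = letter (c - p) j i"
  have xy: "x \<in> idx D" "y \<in> idx D" "x = i \<and> y = j \<or> x = j \<and> y = i"
    using ij by (auto simp: x_def y_def letter_def)
  have "altw c i j = altw (c - p) i j @ altw p x y"
    using altw_add[of "c - p" p i j] p(1) by (simp add: x_def y_def)
  then have "rev (take p ?is) = altw p x y"
    by (simp add: take_rev)
  moreover have "?is ! p = y"
    using p(1) by (simp add: rev_nth altw_nth y_def letter_def)
  moreover have "letter c i j = letter p x y"
    using p(1) by (auto simp: x_def y_def letter_def)
  ultimately have eq: "we (altw p x y) (al (letter p x y)) = al y" using p(2) by simp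
  have "we (altw (Suc p) y x) = we (altw (Suc p) x y)"
  proof
    fix v
    have "sr y (we (altw p x y) v) = we (altw p x y) (sr (letter p x y) v)"
      using refl_conj[OF word_W0[OF altw_idx[OF xy(1,2)]], of p "al (letter p x y)" v]
      by (simp add: eq srefl_def)
    moreover have "we (altw (Suc p) x y) v = we (altw p x y) (sr (letter p x y) v)"
      by (simp only: altw_snoc word_elt_append) (simp add: word_elt_Cons)
    ultimately show "we (altw (Suc p) y x) v = we (altw (Suc p) x y) v"
      by (simp add: word_elt_Cons)
  qed
  then have "(sr i \<circ> sr j) ^^ Suc p = id"
    using xy(3) power_id_iff[OF ij, of "Suc p"] by auto
  then show False using cox_least[of "Suc p" i j] p(1) c by simp
qed

lemma coef_word: "set is \<subseteq> idx D \<Longrightarrow> k \<in> idx D \<Longrightarrow> k \<notin> set is \<Longrightarrow> coef k (we is v) = coef k v"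
  by (induction "is" arbitrary: v) (auto simp: word_elt_Cons coef_sr)

lemma dihedral_comb:
  assumes "i \<in> idx D" "j \<in> idx D" "i \<noteq> j" "c < cox i j"
  obtains a b where "a \<ge> 0" "b \<ge> 0" "we (altw c i j) (al (letter c i j)) = a *\<^sub>R al i + b *\<^sub>R al j"
proof -
  let ?\<beta> = "we (altw c i j) (al (letter c i j))"
  have pos: "pos ?\<beta>" using dihedral_pos assms by blast
  have "?\<beta> = coef i ?\<beta> *\<^sub>R al i + coef j ?\<beta> *\<^sub>R al j"
  proof (rule coef_eqI)
    fix k assume k: "k \<in> idx D"
    show "coef k ?\<beta> = coef k (coef i ?\<beta> *\<^sub>R al i + coef j ?\<beta> *\<^sub>R al j)"
    proof (cases "k = i \<or> k = j")
      case False
      then have "coef k ?\<beta> = coef k (al (letter c i j))"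
        using set_altw[of c i j] by (intro coef_word altw_idx assms k) auto
      then show ?thesis using False k assms by (simp add: coef_add coef_scale coef_al letter_def)
    qed (use assms in \<open>auto simp: coef_add coef_scale coef_al\<close>)
  qed
  then show ?thesis using that pos_coef[OF pos] assms by blast
qed

text \<open>An element with both \<open>i\<close> and \<open>j\<close> as left descents has a
  reduced word beginning with the full alternating word. Its letters are put back one at a time from
  the right; the root to be tested is \<open>- inv w\<close> of a non-negative combination of
  \<open>al i\<close> and \<open>al j\<close>, and \<open>inv w\<close> makes both of these
  negative.\<close>

lemma reduced_peel:
  assumes ij: "i \<in> idx D" "j \<in> idx D" "i \<noteq> j" and w: "w \<in> W0 D"
    and desc: "\<not> pos (inv w (al i))" "\<not> pos (inv w (al j))"
    and ks: "reduced_word D ks" "we ks = we (rev (altw (cox i j) i j)) \<circ> w"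
  shows "reduced_word D (altw (cox i j) i j @ ks)" and "we (altw (cox i j) i j @ ks) = w"
proof -
  let ?m = "cox i j"
  show we: "we (altw ?m i j @ ks) = w"
    using word_rev'[OF altw_idx[OF ij(1,2)]] by (auto simp: word_elt_append ks fun_eq_iff)
  have "reduced_word D (altw n (letter (?m - n) i j) (letter (?m - n) j i) @ ks)" if "n \<le> ?m" for n
    using that
  proof (induction n)
    case 0 then show ?case using ks by simp
  next
    case (Suc n)
    define c where "c = ?m - Suc n"
    have c: "c < ?m" "?m - n = Suc c" using Suc.prems by (auto simp: c_def)
    define x where "x = letter c i j"
    let ?t = "altw n (letter c j i) (letter c i j) @ ks"
    have x: "x \<in> idx D" using ij by (simp add: x_def letter_def)
    have red: "reduced_word D ?t" using Suc c by simp
    have "c + Suc n = ?m" using Suc.prems by (simp add: c_def)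
    then have "altw ?m i j = altw c i j @ altw (Suc n) (letter c i j) (letter c j i)"
      using altw_add[of c "Suc n" i j] by (simp only:)
    then have split: "altw ?m i j @ ks = altw c i j @ [x] @ ?t"
      by (simp add: x_def)
    have w_eq: "w = we (altw c i j) \<circ> sr x \<circ> we ?t"
      using we unfolding split by (simp add: word_elt_append word_elt_Cons comp_assoc)
    obtain a b where ab: "a \<ge> 0" "b \<ge> 0"
      "we (altw c i j) (al x) = a *\<^sub>R al i + b *\<^sub>R al j"
      using dihedral_comb[OF ij c(1)] unfolding x_def by metis
    have tW: "we ?t \<in> W0 D" using red word_W0 by (simp add: reduced_iff)
    have aW: "we (altw c i j) \<in> W0 D" using word_W0 altw_idx ij by blast
    have "inv w (we (altw c i j) (sr x v)) = inv (we ?t) v" for v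
    proof -
      have "w (inv (we ?t) v) = we (altw c i j) (sr x v)"
        by (subst w_eq) (simp add: W0_inv_apply tW)
      then show ?thesis using W0_inv_apply(1)[OF w] by metis
    qed
    from this[of "al x"] have "inv (we ?t) (al x) = - inv w (we (altw c i j) (al x))"
      by (simp add: sr_al x W0_uminus aW W0_inv w)
    also have "\<dots> = - (a *\<^sub>R inv w (al i) + b *\<^sub>R inv w (al j))"
      by (simp add: ab W0_add W0_scale W0_inv w)
    finally have eq: "inv (we ?t) (al x) = a *\<^sub>R (- inv w (al i)) + b *\<^sub>R (- inv w (al j))"
      by simp
    have neg: "pos (- inv w (al i))" "pos (- inv w (al j))"
      using desc neg_root W0_root[OF W0_inv[OF w]] al_root ij by auto
    have rt: "inv (we ?t) (al x) \<in> roots D" using W0_root W0_inv tW al_root x by blast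
    have "pos (inv (we ?t) (al x))"
    proof (rule ccontr)
      assume "\<not> pos (inv (we ?t) (al x))"
      then have p: "pos (- inv (we ?t) (al x))" using neg_root rt by blast
      have "inv (we ?t) (al x) = 0"
      proof (rule coef_eqI)
        fix k assume k: "k \<in> idx D"
        have "coef k (inv (we ?t) (al x)) \<ge> 0"
          unfolding eq coef_add coef_scale
          using pos_coef[OF neg(1) k] pos_coef[OF neg(2) k] ab(1,2) by simp
        then show "coef k (inv (we ?t) (al x)) = coef k 0"
          using pos_coef[OF p k] by (simp add: coef_uminus)
      qed
      then show False using rt zero_notin_roots by simp
    qed
    then have "reduced_word D (x # ?t)" using red x by (simp add: reduced_Cons)
    then show ?case by (simp add: c_def[symmetric] x_def)
  qed
  from this[of ?m] show "reduced_word D (altw ?m i j @ ks)" by simp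
qed

lemma reduced_Cons_desc:
  assumes "reduced_word D (i # is)"
  shows "\<not> pos (inv (we (i # is)) (al i))"
proof -
  have "i \<in> idx D" "set is \<subseteq> idx D" "pos (inv (we is) (al i))"
    using assms unfolding reduced_Cons by (auto simp: reduced_iff)
  then show ?thesis using pos_inv_sr[OF word_W0, of "is" i] by (simp add: word_elt_Cons)
qed

text \<open>The relation is abstract because the theorem is applied both to intertwiners modulo a
  left ideal and to operators on the region. If two reduced words of one element begin with
  different letters, both letters are descents, and \<open>reduced_peel\<close> inserts two reduced
  words between them that differ by a braid move at the beginning.\<close>

theorem matsumoto:
  assumes I: "I \<subseteq> idx D"
    and refl: "\<And>is. rel is is"
    and sym: "\<And>is js. rel is js \<Longrightarrow> rel js is"
    and trans: "\<And>is js ks. rel is js \<Longrightarrow> rel js ks \<Longrightarrow> rel is ks"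
    and tail: "\<And>i is js. i \<in> I \<Longrightarrow> set is \<subseteq> I \<Longrightarrow> set js \<subseteq> I \<Longrightarrow> rel is js \<Longrightarrow> rel (i # is) (i # js)"
    and braid: "\<And>i j ks. i \<in> I \<Longrightarrow> j \<in> I \<Longrightarrow> i \<noteq> j \<Longrightarrow> set ks \<subseteq> I \<Longrightarrow>
      rel (altw (cox i j) i j @ ks) (altw (cox i j) j i @ ks)"
  shows "set is \<subseteq> I \<Longrightarrow> set js \<subseteq> I \<Longrightarrow> reduced_word D is \<Longrightarrow> reduced_word D js \<Longrightarrow>
    we is = we js \<Longrightarrow> rel is js"
proof (induction "length is" arbitrary: "is" js)
  case 0
  then have "is = []" by simp
  moreover have "length js = 0"
    using 0 by (metis reduced_iff)
  ultimately show ?case using refl by simp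
next
  case (Suc n)
  obtain i is' where is': "is = i # is'" using Suc.hyps(2) by (cases "is") auto
  have lj: "length js = Suc n" using Suc.prems(3-5) Suc.hyps(2) unfolding reduced_iff by metis
  obtain j js' where js': "js = j # js'" using lj by (cases js) auto
  have ij: "i \<in> I" "j \<in> I" "set is' \<subseteq> I" "set js' \<subseteq> I" "i \<in> idx D" "j \<in> idx D"
    using Suc.prems(1,2) I is' js' by auto
  have red: "reduced_word D is'" "reduced_word D js'"
    using Suc.prems(3,4) unfolding is' js' reduced_Cons by blast+
  have cancel: "we ks = we ks'" if "we (k # ks) = we (k # ks')" "k \<in> idx D" for k ks ks'
  proof -
    have "sr k (we ks v) = sr k (we ks' v)" for v
      using fun_cong[OF that(1), of v] by (simp only: word_elt_Cons comp_apply)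
    then have "we ks v = we ks' v" for v
      using sr_sr[OF that(2)] by metis
    then show ?thesis by auto
  qed
  have n: "length is' = n" "length js' = n" using Suc.hyps(2) lj unfolding is' js' by simp_all
  show ?case
  proof (cases "i = j")
    case True
    have "rel is' js'"
    proof (rule Suc.hyps(1))
      show "we is' = we js'"
        by (rule cancel[OF _ ij(5)]) (use Suc.prems(5) True in \<open>simp add: is' js'\<close>)
    qed (use ij red n in simp_all)
    then show ?thesis using tail[OF ij(1,3,4)] by (simp only: is' js' True)
  next
    case False
    define w where "w = we is"
    have w: "w \<in> W0 D" using Suc.prems(1) I by (simp add: w_def word_W0)
    have wj: "w = we js" using Suc.prems(5) by (simp only: w_def)
    have desc1: "\<not> pos (inv w (al i))"
      unfolding w_def is' by (rule reduced_Cons_desc) (use Suc.prems(3) is' in simp)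
    have desc2: "\<not> pos (inv w (al j))"
      unfolding wj js' by (rule reduced_Cons_desc) (use Suc.prems(4) js' in simp)
    let ?m = "cox i j"
    have wI: "w \<in> parabolic D I" using Suc.prems(1) by (auto simp: w_def parabolicI)
    have rI: "set (rev (altw ?m i j)) \<subseteq> I" using set_altw[of ?m i j] ij by auto
    then have "we (rev (altw ?m i j)) \<circ> w \<in> parabolic D I"
      by (intro comp_parabolic wI parabolicI)
    then obtain ks where ks: "set ks \<subseteq> I" "reduced_word D ks" "we ks = we (rev (altw ?m i j)) \<circ> w"
      using reduced_in_parabolic[OF I] by metis
    have p1: "reduced_word D (altw ?m i j @ ks)" "we (altw ?m i j @ ks) = w"
      using reduced_peel[OF ij(5,6) False w desc1 desc2 ks(2,3)] by auto
    have "we (rev (altw ?m i j)) = we (rev (altw (cox j i) j i))"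
      using word_cox[OF ij(5,6)] inv_word[OF altw_idx[OF ij(5,6)], symmetric]
        inv_word[OF altw_idx[OF ij(6,5)], symmetric] cox_sym[OF ij(5,6)] by metis
    then have p2: "reduced_word D (altw ?m j i @ ks)" "we (altw ?m j i @ ks) = w"
      using reduced_peel[OF ij(6,5) False[symmetric] w desc2 desc1 ks(2)] ks(3)
        cox_sym[OF ij(5,6)] by auto
    obtain m where m: "?m = Suc m" using cox_pos[OF ij(5,6)] by (cases ?m) auto
    have sI: "set (altw m i j) \<subseteq> I" "set (altw m j i) \<subseteq> I" using set_altw[of m] ij by blast+
    have "rel is' (altw m j i @ ks)"
    proof (rule Suc.hyps(1))
      show "reduced_word D (altw m j i @ ks)" using p1(1) by (simp add: m reduced_Cons)
      show "we is' = we (altw m j i @ ks)" 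
        by (rule cancel[OF _ ij(5)]) (use p1(2) in \<open>simp add: m w_def is'\<close>)
    qed (use ij red n sI ks in auto)
    then have r1: "rel is (altw ?m i j @ ks)" using tail ij sI ks by (simp add: is' m)
    have "rel js' (altw m i j @ ks)"
    proof (rule Suc.hyps(1))
      show "reduced_word D (altw m i j @ ks)" using p2(1) by (simp add: m reduced_Cons)
      show "we js' = we (altw m i j @ ks)" 
        by (rule cancel[OF _ ij(6)]) (use p2(2) in \<open>simp add: m wj js'\<close>)
    qed (use ij red n sI ks in auto)
    then have r2: "rel js (altw ?m j i @ ks)" using tail ij sI ks by (simp add: js' m)
    show ?thesis using r1 r2 braid[OF ij(1,2) False ks(1)] sym trans by blast
  qed
qed

section \<open>Local regions\<close>

definition absr :: "'v \<Rightarrow> 'v" where "absr \<gamma> = (if pos \<gamma> then \<gamma> else - \<gamma>)"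

lemma absr_R0_pos: "\<gamma> \<in> R0 D \<Longrightarrow> absr \<gamma> \<in> R0_pos D"
  using neg_root[OF R0_root] by (auto simp: absr_def R0_pos_iff uminus_R0_iff)

lemma inversions_inv_iff:
  assumes "w \<in> W0 D"
  shows "\<alpha> \<in> inversions D (inv w) \<longleftrightarrow> \<alpha> \<in> R0_pos D \<and> \<not> pos (w \<alpha>)"
proof -
  have "inv (inv w) = w" using W0_bij[OF assms] by (simp add: inv_inv_eq)
  moreover have "w \<alpha> \<in> uminus ` R0_pos D \<longleftrightarrow> \<not> pos (w \<alpha>)" if "\<alpha> \<in> R0_pos D"
  proof -
    have "w \<alpha> \<in> R0 D" using that W0_R0_iff assms by (auto simp: R0_pos_iff)
    moreover have "w \<alpha> \<in> uminus ` R0_pos D \<longleftrightarrow> - w \<alpha> \<in> R0_pos D"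
      by (metis (no_types, opaque_lifting) add.inverse_inverse imageE image_eqI)
    ultimately show ?thesis by (simp add: R0_pos_iff uminus_R0_iff neg_root R0_root)
  qed
  ultimately show ?thesis by (auto simp: inversions_def)
qed

text \<open>So a local region consists of the chambers on prescribed sides of the hyperplanes of
  \<open>N_set D t\<close> and on the positive side of those of \<open>D_set D t\<close>, and the
  geometry of convex sets of chambers applies.\<close>

lemma F_set_iff:
  assumes "J \<subseteq> N_set D t"
  shows "w \<in> F_set D J t \<longleftrightarrow> w \<in> W0 D \<and> (\<forall>\<alpha>\<in>N_set D t. pos (w \<alpha>) \<longleftrightarrow> \<alpha> \<notin> J) \<and>
    (\<forall>\<alpha>\<in>D_set D t. pos (w \<alpha>))"
proof -
  have "N_set D t \<subseteq> R0_pos D" "D_set D t \<subseteq> R0_pos D" by (auto simp: N_set_def D_set_def)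
  then show ?thesis using assms unfolding F_set_def
    by (auto simp: inversions_inv_iff set_eq_iff) blast+
qed

lemma exists_descent:
  assumes "g \<in> W0 D" "g \<noteq> id"
  obtains i where "i \<in> idx D" "\<not> pos (inv g (al i))"
proof -
  obtain ks where ks: "reduced_word D ks" "we ks = g" using reduced_ex[OF assms(1)] .
  then obtain i ks' where "ks = i # ks'" using assms(2) by (cases ks) auto
  then show ?thesis using that[of i] reduced_Cons_desc[of i ks'] ks by (auto simp: reduced_Cons)
qed

context
  fixes J t
  assumes J: "J \<subseteq> N_set D t"
begin

lemma F_W0: "v \<in> F_set D J t \<Longrightarrow> v \<in> W0 D"
  by (simp add: F_set_iff[OF J])

lemma F_separated:
  assumes "v \<in> F_set D J t" "v' \<in> F_set D J t" "\<gamma> \<in> R0 D" "pos (v \<gamma>)" "\<not> pos (v' \<gamma>)"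
  shows "absr \<gamma> \<notin> N_set D t \<union> D_set D t"
proof -
  have W: "v \<in> W0 D" "v' \<in> W0 D" using assms F_W0 by auto
  have "\<not> pos (- v \<gamma>)" "pos (- v' \<gamma>)"
    using assms neg_root[OF W0_root[OF _ R0_root]] W by blast+
  then have "pos (v (absr \<gamma>)) \<longleftrightarrow> \<not> pos (v' (absr \<gamma>))"
    using assms(4,5) W by (auto simp: absr_def W0_uminus)
  then show ?thesis using assms(1,2) by (auto simp: F_set_iff[OF J])
qed

text \<open>By \<open>sr_pos\<close>, passing from \<open>v\<close> to \<open>sr i \<circ> v\<close>
  changes the sign of one positive root only, \<open>absr (inv v (al i))\<close>. The region is left
  exactly when its hyperplane is a defining one.\<close>

lemma F_step:
  assumes v: "v \<in> F_set D J t" and i: "i \<in> idx D"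
  shows "sr i \<circ> v \<in> F_set D J t \<longleftrightarrow> absr (inv v (al i)) \<notin> N_set D t \<union> D_set D t"
proof
  have W: "v \<in> W0 D" using v F_W0 by auto
  assume "sr i \<circ> v \<in> F_set D J t"
  then show "absr (inv v (al i)) \<notin> N_set D t \<union> D_set D t"
    using F_separated[OF v, of "sr i \<circ> v" "inv v (al i)"] W i al_R0 pos_al[OF i]
      neg_root[OF al_root[OF i]] W0_R0_iff[OF W0_inv[OF W]]
    by (simp add: W0_inv_apply sr_al)
next
  have W: "v \<in> W0 D" using v F_W0 by auto
  assume *: "absr (inv v (al i)) \<notin> N_set D t \<union> D_set D t"
  have same: "pos (sr i (v \<alpha>)) \<longleftrightarrow> pos (v \<alpha>)" if \<alpha>: "\<alpha> \<in> N_set D t \<union> D_set D t" for \<alpha>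
  proof -
    have "\<alpha> \<in> R0_pos D" using \<alpha> by (auto simp: N_set_def D_set_def)
    then have \<alpha>R: "\<alpha> \<in> R0 D" "pos \<alpha>" by (auto simp: R0_pos_iff)
    have vR: "v \<alpha> \<in> R0 D" "- v \<alpha> \<in> R0 D" using \<alpha>R W W0_R0_iff uminus_R0_iff by blast+
    have "v \<alpha> \<noteq> al i" "- v \<alpha> \<noteq> al i"
    proof -
      show "v \<alpha> \<noteq> al i"
        using * \<alpha> \<alpha>R(2) W0_inv_apply(1)[OF W, of \<alpha>] by (auto simp: absr_def)
      have "\<not> pos (- \<alpha>)" using neg_root[OF R0_root[OF \<alpha>R(1)]] \<alpha>R(2) by blast
      then show "- v \<alpha> \<noteq> al i"
        using * \<alpha> W0_inv_apply(1)[OF W, of "- \<alpha>"] W by (auto simp: absr_def W0_uminus)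
    qed
    then have "pos (v \<alpha>) \<Longrightarrow> pos (sr i (v \<alpha>))" "pos (- v \<alpha>) \<Longrightarrow> pos (- sr i (v \<alpha>))"
      using sr_pos[OF i vR(1)] sr_pos[OF i vR(2)] linear_neg[OF linear_sr] by auto
    then show ?thesis
      using neg_root[OF R0_root[OF vR(1)]] neg_root[OF sr_root[OF i R0_root[OF vR(1)]]] by blast
  qed
  show "sr i \<circ> v \<in> F_set D J t"
    using v same W0_comp[OF W0_sr[OF i] W] by (simp add: F_set_iff[OF J])
qed

text \<open>A left descent of \<open>v0 \<circ> inv v'\<close> is a wall of \<open>v0\<close> that
  separates it from \<open>v'\<close>. By \<open>F_separated\<close> this wall is not a defining
  one, so crossing it stays in the region, and it shortens the distance to
  \<open>v'\<close>.\<close>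

lemma F_connected:
  assumes v0: "v0 \<in> F_set D J t" "P v0"
    and step: "\<And>v i. v \<in> F_set D J t \<Longrightarrow> P v \<Longrightarrow> i \<in> idx D \<Longrightarrow> sr i \<circ> v \<in> F_set D J t \<Longrightarrow> P (sr i \<circ> v)"
    and v': "v' \<in> F_set D J t"
  shows "P v'"
  using v0
proof (induction "len (v0 \<circ> inv v')" arbitrary: v0 rule: less_induct)
  case less
  have W: "v0 \<in> W0 D" "v' \<in> W0 D" using less.prems v' F_W0 by auto
  define g where "g = v0 \<circ> inv v'"
  have g: "g \<in> W0 D" using W W0_inv W0_comp by (simp add: g_def)
  show ?case
  proof (cases "g = id")
    case True
    then have "v0 (inv v' (v' x)) = v' x" for x by (simp add: g_def fun_eq_iff)
    then have "v0 = v'" using W by (auto simp: W0_inv_apply)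
    then show ?thesis using less.prems by simp
  next
    case False
    then obtain i where i: "i \<in> idx D" "\<not> pos (inv g (al i))" using exists_descent[OF g] by metis
    have eq: "sr i \<circ> g = (sr i \<circ> v0) \<circ> inv v'" by (simp add: g_def comp_assoc)
    have ig: "inv g x = v' (inv v0 x)" for x
      using W by (simp add: g_def inv_comp_W0 W0_inv inv_inv_eq W0_bij)
    have "absr (inv v0 (al i)) \<notin> N_set D t \<union> D_set D t"
      using F_separated[OF less.prems(1) v', of "inv v0 (al i)"] i W al_R0 pos_al
        W0_R0_iff[OF W0_inv[OF W(1)]] by (simp add: W0_inv_apply ig)
    then have F: "sr i \<circ> v0 \<in> F_set D J t" using F_step less.prems i by blast
    show ?thesis
    proof (rule less.hyps)
      show "len (sr i \<circ> v0 \<circ> inv v') < len (v0 \<circ> inv v')"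
        using len_down[OF g i] by (simp add: g_def comp_assoc)
      show "P (sr i \<circ> v0)" using step less.prems i F by blast
    qed (rule F)
  qed
qed

end

end

section \<open>Weights and the values of the c-functions\<close>

context hecke
begin

lemma act_apply: "act w s \<mu> = s (inv w \<mu>)"
  by (simp add: act_def)

lemma W0_L_iff: "w \<in> W0 D \<Longrightarrow> w \<mu> \<in> L \<longleftrightarrow> \<mu> \<in> L"
  using W0_L[of w \<mu>] W0_L[OF W0_inv, of w "w \<mu>"] by (auto simp: W0_inv_apply)

lemma act_char: assumes "w \<in> W0 D" "s \<in> characters D" shows "act w s \<in> characters D"
proof -
  note iw = W0_inv[OF assms(1)]
  have "act w s \<mu> = undefined" if "\<mu> \<notin> L" for \<mu>
    using that char_undef[OF assms(2)] W0_L_iff[OF iw] by (simp add: act_apply)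
  moreover have "act w s \<mu> \<noteq> 0" if "\<mu> \<in> L" for \<mu>
    using that char_nz[OF assms(2)] W0_L_iff[OF iw] by (simp add: act_apply)
  moreover have "act w s (\<mu> + \<nu>) = act w s \<mu> * act w s \<nu>" if "\<mu> \<in> L" "\<nu> \<in> L" for \<mu> \<nu>
    using that char_add[OF assms(2)] W0_L_iff[OF iw] by (simp add: act_apply W0_add[OF iw])
  ultimately show ?thesis by (auto simp: characters_def PiE_def extensional_def)
qed

lemma act_comp: "u \<in> W0 D \<Longrightarrow> w \<in> W0 D \<Longrightarrow> act (u \<circ> w) s = act u (act w s)"
  by (simp add: act_def inv_comp_W0)

lemma act_id [simp]: "act id s = s"
  by (simp add: act_def)

lemma act_sr_sr: "i \<in> idx D \<Longrightarrow> act (sr i) (act (sr i) s) = s"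
  by (simp add: act_def inv_sr sr_sr)

lemma act_sr_apply: "i \<in> idx D \<Longrightarrow> act (sr i) s \<mu> = s (sr i \<mu>)"
  by (simp add: act_def inv_sr)

lemma char_eqI:
  assumes "s \<in> characters D" "s' \<in> characters D" "\<And>\<mu>. \<mu> \<in> L \<Longrightarrow> s \<mu> = s' \<mu>"
  shows "s = s'"
  using assms char_undef by (metis ext)

text \<open>As \<open>L\<close> lies in the coweight lattice, \<open>sr i\<close> moves each lattice
  vector by an integral multiple of the coroot.\<close>

lemma act_sr_fixed:
  assumes "i \<in> idx D" "s \<in> characters D" "s (coroot (al i)) = 1"
  shows "act (sr i) s = s"
proof (rule char_eqI)
  fix \<mu> assume \<mu>: "\<mu> \<in> L"
  obtain k where k: "\<mu> \<bullet> al i = of_int k"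
    using L_integral[OF \<mu> al_root[OF assms(1)]] by (auto elim: Ints_cases)
  have c: "coroot (al i) \<in> L" using coroot_in_L al_root assms(1) by blast
  have "s (\<mu> - of_int k *\<^sub>R coroot (al i)) = s \<mu>"
    using char_diff[OF assms(2) \<mu> L_of_int[OF c]] char_of_int[OF assms(2) c] assms(3) by simp
  then show "act (sr i) s \<mu> = s \<mu>" by (simp add: act_sr_apply assms sr_def k)
qed (use assms act_char W0_sr in auto)

text \<open>An exponent in whose exponential both numerator and denominator of the c-function are
  polynomials. For \<open>R2\<close> half the coroot is needed; it lies in \<open>L\<close>, being
  the coroot of \<open>2 \<beta>\<close>.\<close>

definition hh :: "'v \<Rightarrow> 'v" where
  "hh \<beta> = (if \<beta> \<in> R1 D then - coroot \<beta> else - ((1/2) *\<^sub>R coroot \<beta>))"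

definition numP :: "'v \<Rightarrow> complex poly" where
  "numP \<beta> = (if \<beta> \<in> R1 D then [:1, - inverse (q_root D \<beta>):]
     else [:1, - (inverse (qroot D 0) * inverse (qroot D DIM('v))):] *
       [:1, qroot D 0 * inverse (qroot D DIM('v)):])"

definition denP :: "'v \<Rightarrow> complex poly" where
  "denP \<beta> = (if \<beta> \<in> R1 D then [:1, -1:] else [:1, 0, -1:])"

text \<open>The constant by which c exceeds c', namely \<open>1/q\<close> for the parameter of the
  root.\<close>

definition kap :: "'v \<Rightarrow> complex" where
  "kap \<beta> = (if \<beta> \<in> R1 D then inverse (q_root D \<beta>) else inverse (qpar D DIM('v)))"

definition NP :: "'v \<Rightarrow> complex poly" where "NP \<beta> = numP \<beta> div gcd (numP \<beta>) (denP \<beta>)"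
definition DP :: "'v \<Rightarrow> complex poly" where "DP \<beta> = denP \<beta> div gcd (numP \<beta>) (denP \<beta>)"

definition cv :: "'v \<Rightarrow> ('v \<Rightarrow> complex) \<Rightarrow> complex" where
  "cv \<beta> s = poly (NP \<beta>) (s (hh \<beta>)) / poly (DP \<beta>) (s (hh \<beta>))"

lemma q_nz: "i \<le> DIM('v) \<Longrightarrow> qpar D i \<noteq> 0" and qroot_sq: "i \<le> DIM('v) \<Longrightarrow> (qroot D i)\<^sup>2 = qpar D i"
  using datum by (auto simp: hecke_datum_def)

lemma qroot_nz: "i \<le> DIM('v) \<Longrightarrow> qroot D i \<noteq> 0"
  using q_nz qroot_sq by (metis power_zero_numeral)

lemma idx_le: "i \<in> idx D \<Longrightarrow> i \<le> DIM('v)"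
  by (simp add: idx_def)

lemma hh_L: assumes "\<beta> \<in> R0 D" shows "hh \<beta> \<in> L"
proof (cases "\<beta> \<in> R1 D")
  case True
  then show ?thesis using coroot_in_L[OF R0_root[OF assms]] L_uminus by (simp add: hh_def)
next
  case False
  then have "2 *\<^sub>R \<beta> \<in> roots D" using assms by (auto simp: R0_def R2_def)
  then have "(1/2) *\<^sub>R coroot \<beta> \<in> L" using coroot_in_L[of "2 *\<^sub>R \<beta>"] by (simp add: coroot_scale)
  then show ?thesis using False L_uminus by (simp add: hh_def)
qed

lemma hh_W0: "w \<in> W0 D \<Longrightarrow> hh (w \<beta>) = w (hh \<beta>)"
  by (simp add: hh_def W0_R1_iff W0_coroot W0_uminus W0_scale)

lemma hh_uminus: "hh (- \<beta>) = - hh \<beta>"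
  by (simp add: hh_def uminus_R1_iff coroot_uminus)

lemma W0_orbit_iff: "w \<in> W0 D \<Longrightarrow> (\<exists>v\<in>W0 D. w \<beta> = v \<gamma>) \<longleftrightarrow> (\<exists>v\<in>W0 D. \<beta> = v \<gamma>)"
proof
  assume w: "w \<in> W0 D"
  { assume "\<exists>v\<in>W0 D. w \<beta> = v \<gamma>"
    then obtain v where v: "v \<in> W0 D" "w \<beta> = v \<gamma>" by blast
    then have "\<beta> = (inv w \<circ> v) \<gamma>" using W0_inv_apply(1)[OF w, of \<beta>] by simp
    then show "\<exists>v\<in>W0 D. \<beta> = v \<gamma>" using v w W0_comp W0_inv by blast }
  { assume "\<exists>v\<in>W0 D. \<beta> = v \<gamma>"
    then obtain v where "v \<in> W0 D" "\<beta> = v \<gamma>" by blast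
    then show "\<exists>v\<in>W0 D. w \<beta> = v \<gamma>" using w W0_comp by (intro bexI[of _ "w \<circ> v"]) auto }
qed

lemma q_root_W0: "w \<in> W0 D \<Longrightarrow> q_root D (w \<beta>) = q_root D \<beta>"
  by (simp add: q_root_def W0_orbit_iff)

lemma q_root_uminus: "q_root D (- \<beta>) = q_root D \<beta>"
proof -
  have *: "\<exists>v\<in>W0 D. - \<gamma> = v (al i)" if i: "i \<in> idx D" and ex: "\<exists>v\<in>W0 D. \<gamma> = v (al i)" for i \<gamma>
  proof -
    obtain v where "v \<in> W0 D" "\<gamma> = v (al i)" using ex by blast
    then show ?thesis using i W0_comp W0_sr
      by (intro bexI[of _ "v \<circ> sr i"]) (auto simp: sr_al W0_uminus)
  qed
  have "(i \<in> idx D \<and> (\<exists>v\<in>W0 D. - \<beta> = v (al i))) = (i \<in> idx D \<and> (\<exists>v\<in>W0 D. \<beta> = v (al i)))" for i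
    using *[of i \<beta>] *[of i "- \<beta>"] by auto
  then show ?thesis by (simp add: q_root_def)
qed

lemma poly_W0: "w \<in> W0 D \<Longrightarrow> NP (w \<beta>) = NP \<beta>" "w \<in> W0 D \<Longrightarrow> DP (w \<beta>) = DP \<beta>"
  "w \<in> W0 D \<Longrightarrow> kap (w \<beta>) = kap \<beta>"
  by (simp_all add: NP_def DP_def numP_def denP_def kap_def W0_R1_iff q_root_W0)

lemma poly_uminus: "NP (- \<beta>) = NP \<beta>" "DP (- \<beta>) = DP \<beta>" "numP (- \<beta>) = numP \<beta>" "denP (- \<beta>) = denP \<beta>"
  by (simp_all add: NP_def DP_def numP_def denP_def uminus_R1_iff q_root_uminus)

text \<open>Simple roots in one orbit have conjugate reflections, and \<open>W0\<close> is contained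
  in the affine Weyl group, so the datum forces equal parameters and equal square roots. Hence the
  choice in \<open>q_root\<close> is harmless.\<close>

lemma conj_par:
  assumes "i \<in> idx D" "k \<in> idx D" "w \<in> W0 D" "al i = w (al k)"
  shows "qpar D k = qpar D i" "qroot D k = qroot D i"
proof -
  have "w \<circ> sr k \<circ> inv w = sr i"
  proof
    fix v
    show "(w \<circ> sr k \<circ> inv w) v = sr i v"
      using refl_conj[OF assms(3), of "al k" "inv w v"] assms(3,4)
      by (simp add: srefl_def W0_inv_apply)
  qed
  moreover have "0 \<in> coroot_lattice D"
    unfolding coroot_lattice_def int_span_def by (auto intro!: exI[of _ "{}"])
  then have "w \<in> affine_weyl D"
    unfolding affine_weyl_def using assms(3) by force
  ultimately have "affine_conj D k i"
    using assms(1,2) by (auto simp: affine_conj_def affine_refl_def idx_def)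
  then show "qpar D k = qpar D i" "qroot D k = qroot D i"
    using datum assms(1,2) idx_le by (auto simp: hecke_datum_def)
qed

lemma q_root_al: assumes "i \<in> idx D" shows "q_root D (al i) = qpar D i"
proof -
  define k where "k = (SOME k. k \<in> idx D \<and> (\<exists>w\<in>W0 D. al i = w (al k)))"
  have "i \<in> idx D \<and> (\<exists>w\<in>W0 D. al i = w (al i))"
    using assms W0_id by (auto intro!: bexI[of _ id])
  then have "k \<in> idx D \<and> (\<exists>w\<in>W0 D. al i = w (al k))" unfolding k_def by (rule someI)
  then show ?thesis using conj_par(1)[OF assms] by (auto simp: q_root_def k_def)
qed

text \<open>In \<open>BC\<close> coordinates the squared lengths of roots are \<open>c\<close>,
  \<open>2 c\<close> and \<open>4 c\<close>, while the double of \<open>e i - e (i + 1)\<close>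
  would have squared length \<open>8 c\<close>.\<close>

lemma R2_al: assumes i: "i \<in> idx D" and R2: "al i \<in> R2 D" shows "i = DIM('v)"
proof (rule ccontr)
  assume "i \<noteq> DIM('v)"
  then have lt: "i < DIM('v)" using i idx_le by force
  have r: "al i \<in> roots D" "2 *\<^sub>R al i \<in> roots D" using R2 by (auto simp: R2_def)
  then have "BC_coordinates D" using datum by (auto simp: hecke_datum_def non_reduced_def)
  then obtain e :: "nat \<Rightarrow> 'v" and c where c: "c > 0"
    and e: "\<And>i j. i \<in> idx D \<Longrightarrow> j \<in> idx D \<Longrightarrow> e i \<bullet> e j = (if i = j then c else 0)"
    and R: "roots D = pm ({e i - e j | i j. i \<in> idx D \<and> j \<in> idx D \<and> i < j} \<union>
                   {e i + e j | i j. i \<in> idx D \<and> j \<in> idx D \<and> i < j} \<union>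
                   {e k | k. k \<in> idx D} \<union> {2 *\<^sub>R e k | k. k \<in> idx D})"
    and al: "\<And>i. i \<in> idx D \<Longrightarrow> al i = (if i < DIM('v) then e i - e (i + 1) else e i)"
    unfolding BC_coordinates_def by (elim exE conjE) blast
  have norms: "\<beta> \<bullet> \<beta> \<in> {2 * c, c, 4 * c}" if "\<beta> \<in> roots D" for \<beta>
    using that unfolding R pm_def
    by (auto simp: inner_diff_left inner_diff_right inner_add_left inner_add_right e)
  have i1: "i + 1 \<in> idx D" using i lt by (auto simp: idx_def)
  have "al i \<bullet> al i = 2 * c"
    using lt i i1 by (simp add: al inner_diff_left inner_diff_right e)
  then have "(2 *\<^sub>R al i) \<bullet> (2 *\<^sub>R al i) = 8 * c" by simp
  then show False using norms[OF r(2)] c by auto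
qed

lemma R0_cases: "\<beta> \<in> R0 D \<Longrightarrow> \<beta> \<notin> R1 D \<longleftrightarrow> \<beta> \<in> R2 D"
  using R12_disj by (auto simp: R0_def)

lemma kap_al: assumes "i \<in> idx D" shows "kap (al i) = inverse (qpar D i)"
  using R0_cases[OF al_R0[OF assms]] R2_al[OF assms]
  by (auto simp: kap_def q_root_al assms)

lemma minus_halves: "- ((1/2) *\<^sub>R v) - (1/2) *\<^sub>R v = - (v :: 'v)"
proof -
  have "(1/2) *\<^sub>R v + (1/2) *\<^sub>R v = v"
    by (simp flip: scaleR_add_left)
  then show ?thesis
    by (metis diff_conv_add_uminus minus_add_distrib)
qed

lemma c_den_ypoly: "c_den \<beta> = ypoly (hh \<beta>) (denP \<beta>)"
  by (auto simp: c_den_def hh_def denP_def mult_single single_uminus minus_halves)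

lemma c_num_ypoly: "c_num D \<beta> = ypoly (hh \<beta>) (numP \<beta>)"
  by (auto simp: c_num_def hh_def numP_def Let_def ypoly_mult mult_single single_uminus single_diff algebra_simps)

lemma qDIM: "qpar D DIM('v) = (qroot D DIM('v))\<^sup>2" "qroot D DIM('v) \<noteq> 0" "qroot D 0 \<noteq> 0"
  using qroot_sq qroot_nz by auto

lemma numP_R2: "\<beta> \<notin> R1 D \<Longrightarrow> numP \<beta> - smult (kap \<beta>) (denP \<beta>) =
   [:1 - inverse (qpar D DIM('v)), inverse (qroot D DIM('v)) * (qroot D 0 - inverse (qroot D 0)):]"
  using qDIM by (simp add: numP_def kap_def denP_def field_simps power2_eq_square)

text \<open>The relation between c' and c already holds for the numerators over the common
  denominator, before any cancellation.\<close>

lemma c'_num_ypoly: "c'_num D \<beta> = ypoly (hh \<beta>) (numP \<beta> - smult (kap \<beta>) (denP \<beta>))"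
proof (cases "\<beta> \<in> R1 D")
  case False
  then show ?thesis unfolding numP_R2[OF False]
    by (simp add: c'_num_def Let_def hh_def mult_single)
qed (simp add: c'_num_def hh_def numP_def denP_def kap_def mult_single)

lemma denP_nzd:
  assumes "\<beta> \<in> roots D" and "ypoly (hh \<beta>) (denP \<beta>) * f = 0" shows "f = 0"
proof -
  have "\<beta> \<noteq> 0" using assms(1) zero_notin_roots by metis
  then have "- coroot \<beta> \<noteq> 0" by (simp add: coroot_def)
  then show ?thesis
    using assms(2) one_minus_single_nonzero_divisor unfolding c_den_ypoly[symmetric] c_den_def by blast
qed

lemma denP_nz: "denP \<beta> \<noteq> 0"
  by (simp add: denP_def)

definition GP where "GP \<beta> = gcd (numP \<beta>) (denP \<beta>)"

lemma GP_nz: "GP \<beta> \<noteq> 0"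
  using denP_nz by (simp add: GP_def)

lemma numP_eq: "numP \<beta> = GP \<beta> * NP \<beta>" and denP_eq: "denP \<beta> = GP \<beta> * DP \<beta>"
  by (simp_all only: NP_def DP_def GP_def dvd_mult_div_cancel gcd_dvd1 gcd_dvd2)

lemma n_fun_zero: "s \<in> characters D \<Longrightarrow> \<beta> \<in> R0 D \<Longrightarrow>
    ga_eval (n_fun D \<beta>) s = 0 \<longleftrightarrow> poly (NP \<beta>) (s (hh \<beta>)) = 0"
  and d_fun_zero: "s \<in> characters D \<Longrightarrow> \<beta> \<in> R0 D \<Longrightarrow>
    ga_eval (d_fun D \<beta>) s = 0 \<longleftrightarrow> poly (DP \<beta>) (s (hh \<beta>)) = 0"
  unfolding n_fun_def d_fun_def c_num_ypoly c_den_ypoly NP_def DP_def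
  by (rule frac_eval_ypoly(1)[OF hh_L denP_nzd[OF R0_root]], assumption+)
    (rule frac_eval_ypoly(2)[OF hh_L denP_nzd[OF R0_root]], assumption+)

lemma c_val_cv: "s \<in> characters D \<Longrightarrow> i \<in> idx D \<Longrightarrow> c_val D i s = cv (al i) s"
  unfolding c_val_def cv_def c_num_ypoly c_den_ypoly NP_def DP_def
  by (rule frac_eval_ypoly(3)[OF hh_L[OF al_R0] denP_nzd[OF al_root]], assumption+)

text \<open>Absence of a pole after cancellation; \<open>s (coroot \<beta>)\<close> may be 1
  nevertheless.\<close>

definition good :: "'v \<Rightarrow> ('v \<Rightarrow> complex) \<Rightarrow> bool" where
  "good \<beta> s \<longleftrightarrow> poly (DP \<beta>) (s (hh \<beta>)) \<noteq> 0"

text \<open>Subtracting a multiple of the denominator from the numerator does not change their gcd,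
  so c and c' have the same reduced denominator and their difference survives the reduction.\<close>

lemma c'_val_cv:
  assumes "s \<in> characters D" "i \<in> idx D" "good (al i) s"
  shows "c'_val D i s = c_val D i s - inverse (qpar D i)"
proof -
  let ?\<beta> = "al i"
  let ?n = "numP ?\<beta> - smult (kap ?\<beta>) (denP ?\<beta>)"
  have g: "gcd ?n (denP ?\<beta>) = GP ?\<beta>"
    using gcd_add_mult[of "denP ?\<beta>" "- [:kap ?\<beta>:]" "numP ?\<beta>"]
    by (simp add: GP_def gcd.commute algebra_simps)
  have "?n = GP ?\<beta> * (NP ?\<beta> - smult (kap ?\<beta>) (DP ?\<beta>))"
    by (subst (1) numP_eq, subst (1) denP_eq) (simp add: algebra_simps)
  then have n: "?n div GP ?\<beta> = NP ?\<beta> - smult (kap ?\<beta>) (DP ?\<beta>)"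
    using GP_nz by simp
  have d: "denP ?\<beta> div GP ?\<beta> = DP ?\<beta>" by (simp add: DP_def GP_def)
  have "c'_val D i s = poly (?n div gcd ?n (denP ?\<beta>)) (s (hh ?\<beta>)) /
      poly (denP ?\<beta> div gcd ?n (denP ?\<beta>)) (s (hh ?\<beta>))"
    unfolding c'_val_def c'_num_ypoly c_den_ypoly
    by (rule frac_eval_ypoly(3)[OF hh_L[OF al_R0] denP_nzd[OF al_root]]) (use assms in simp_all)
  also have "\<dots> = cv ?\<beta> s - kap ?\<beta>"
    using assms(3) by (simp add: g n d good_def cv_def field_simps)
  finally show ?thesis using assms by (simp add: c_val_cv kap_al)
qed

lemma char_hh:
  assumes "s \<in> characters D" "\<beta> \<in> R0 D"
  shows "s (hh \<beta>) \<noteq> 0" "s (hh (- \<beta>)) = inverse (s (hh \<beta>))"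
  using assms hh_L char_nz char_uminus by (auto simp: hh_uminus)

lemma poly_denP:
  assumes "s \<in> characters D" "\<beta> \<in> R0 D"
  shows "poly (denP \<beta>) (s (hh \<beta>)) = 1 - inverse (s (coroot \<beta>))"
proof -
  have c: "coroot \<beta> \<in> L" using assms coroot_in_L R0_root by blast
  show ?thesis
  proof (cases "\<beta> \<in> R1 D")
    case True
    then show ?thesis using char_uminus[OF assms(1) c] by (simp add: denP_def hh_def)
  next
    case False
    have "s (hh \<beta>) * s (hh \<beta>) = s (hh \<beta> + hh \<beta>)" using char_add assms hh_L by metis
    also have "hh \<beta> + hh \<beta> = - coroot \<beta>"
      using False by (simp add: hh_def minus_halves)
    finally show ?thesis using False char_uminus[OF assms(1) c] by (simp add: denP_def)
  qed
qed

lemma good_if: "s \<in> characters D \<Longrightarrow> \<beta> \<in> R0 D \<Longrightarrow> s (coroot \<beta>) \<noteq> 1 \<Longrightarrow> good \<beta> s"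
  using poly_denP[of s \<beta>] unfolding denP_eq good_def by auto

lemma poly_denP_eq: "poly (denP \<beta>) z = (if \<beta> \<in> R1 D then 1 - z else (1 - z) * (1 + z))"
  by (simp add: denP_def algebra_simps)

lemma denP_root_inverse: "poly (denP \<beta>) y = 0 \<Longrightarrow> inverse y = y"
proof -
  assume "poly (denP \<beta>) y = 0"
  then have "y = 1 \<or> y * y = 1" by (auto simp: denP_def split: if_splits)
  then show ?thesis by (auto simp: inverse_unique)
qed

text \<open>The zeros of the denominators are among 1 and -1, which are their own inverses.\<close>

lemma good_uminus: assumes "s \<in> characters D" "\<beta> \<in> R0 D" shows "good (- \<beta>) s \<longleftrightarrow> good \<beta> s"
proof -
  have "poly (DP \<beta>) y = 0 \<Longrightarrow> inverse y = y" for y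
    using denP_root_inverse[of \<beta> y] by (simp add: denP_eq)
  from this[of "s (hh \<beta>)"] this[of "inverse (s (hh \<beta>))"] show ?thesis
    by (auto simp: good_def poly_uminus char_hh[OF assms])
qed

text \<open>The c-functions of \<open>\<beta>\<close> and \<open>- \<beta>\<close> add up to a
  constant, which is the source of the quadratic relation. Clearing inverse powers of
  \<open>z\<close> gives the second fraction the denominator of the first.\<close>

lemma num_den_sum:
  assumes "z \<noteq> 0" "z \<noteq> 1" "z \<noteq> -1"
  shows "poly (numP \<beta>) z / poly (denP \<beta>) z + poly (numP \<beta>) (inverse z) / poly (denP \<beta>) (inverse z)
    = 1 + kap \<beta>"
proof (cases "\<beta> \<in> R1 D")
  case True
  have d: "1 - z \<noteq> 0" "1 - inverse z \<noteq> 0" and zw: "z * inverse z = 1"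
    using assms by (auto simp: inverse_eq_1_iff)
  have *: "(1 - k * z) / (1 - z) + (1 - k * inverse z) / (1 - inverse z) = 1 + k" for k
  proof -
    have "(1 - k * inverse z) * (1 - z) = (k - z) * (1 - inverse z)" using zw by algebra
    then have e: "(1 - k * inverse z) / (1 - inverse z) = (k - z) / (1 - z)"
      using d by (simp only: frac_eq_eq not_False_eq_True)
    have "(1 - k * z) / (1 - z) + (k - z) / (1 - z) = (1 + k) * (1 - z) / (1 - z)"
      unfolding add_divide_distrib[symmetric] by (rule arg_cong[of _ _ "\<lambda>x. x / (1 - z)"]) algebra
    then show ?thesis unfolding e using d by simp
  qed
  show ?thesis
    using True *[of "inverse (q_root D \<beta>)"] by (simp add: numP_def denP_def kap_def mult.commute)
next
  case False
  have zz: "1 - z * z \<noteq> 0"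
  proof
    assume "1 - z * z = 0"
    moreover have "(1 - z) * (1 + z) = 1 - z * z" by (simp add: algebra_simps)
    ultimately have "(1 - z) * (1 + z) = 0" by simp
    then show False using assms by (auto simp: add_eq_0_iff)
  qed
  have zw: "z * inverse z = 1" using assms by simp
  have ww: "1 - inverse z * inverse z \<noteq> 0"
  proof
    assume "1 - inverse z * inverse z = 0"
    then have "1 - z * z = 0" using zw by algebra
    then show False using zz by simp
  qed
  have *: "(1 - u * z) * (1 + v * z) / (1 - z * z) +
      (1 - u * inverse z) * (1 + v * inverse z) / (1 - inverse z * inverse z) = 1 + u * v" for u v
  proof -
    have "(1 - u * inverse z) * (1 + v * inverse z) * (1 - z * z) = (u - z) * (z + v) * (1 - inverse z * inverse z)"
      using zw by algebra
    then have e: "(1 - u * inverse z) * (1 + v * inverse z) / (1 - inverse z * inverse z) = (u - z) * (z + v) / (1 - z * z)"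
      using zz ww by (simp only: frac_eq_eq not_False_eq_True)
    have "(1 - u * z) * (1 + v * z) / (1 - z * z) + (u - z) * (z + v) / (1 - z * z)
        = (1 + u * v) * (1 - z * z) / (1 - z * z)"
      unfolding add_divide_distrib[symmetric] by (rule arg_cong[of _ _ "\<lambda>x. x / (1 - z * z)"]) algebra
    then show ?thesis unfolding e using zz by simp
  qed
  have "inverse (qroot D 0) * inverse (qroot D DIM('v)) * (qroot D 0 * inverse (qroot D DIM('v)))
      = inverse (qpar D DIM('v))"
    using qDIM by (simp add: field_simps power2_eq_square)
  then show ?thesis
    using False *[of "inverse (qroot D 0) * inverse (qroot D DIM('v))" "qroot D 0 * inverse (qroot D DIM('v))"]
    by (simp add: numP_def denP_def kap_def algebra_simps)
qed

text \<open>At 1 and -1 the unreduced fractions are meaningless, but \<open>good\<close> makes the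
  reduced ones continuous there, so the identity extends from neighbouring points.\<close>

lemma cv_uminus:
  assumes "s \<in> characters D" "\<beta> \<in> R0 D" "good \<beta> s"
  shows "cv (- \<beta>) s = 1 + kap \<beta> - cv \<beta> s"
proof -
  define y where "y = s (hh \<beta>)"
  define f where "f = (\<lambda>z. poly (NP \<beta>) z / poly (DP \<beta>) z +
    poly (NP \<beta>) (inverse z) / poly (DP \<beta>) (inverse z))"
  have y: "y \<noteq> 0" "poly (DP \<beta>) y \<noteq> 0" "poly (DP \<beta>) (inverse y) \<noteq> 0"
    using assms good_uminus[OF assms(1,2)] char_hh[OF assms(1,2)]
    by (auto simp: y_def good_def poly_uminus)
  have f: "f z = 1 + kap \<beta>" if z: "z \<noteq> 0" "z \<noteq> 1" "z \<noteq> -1" for z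
  proof -
    have nz: "poly (denP \<beta>) z \<noteq> 0" if "z \<noteq> 1" "z \<noteq> -1" for z
      using that by (auto simp: poly_denP_eq add_eq_0_iff)
    have "inverse z \<noteq> 1" "inverse z \<noteq> -1"
      using z by (metis inverse_1 inverse_inverse_eq inverse_minus_eq)+
    then have "poly (GP \<beta>) z \<noteq> 0" "poly (GP \<beta>) (inverse z) \<noteq> 0"
      using nz[of z] nz[of "inverse z"] z by (auto simp: denP_eq)
    then have "f z = poly (numP \<beta>) z / poly (denP \<beta>) z + poly (numP \<beta>) (inverse z) / poly (denP \<beta>) (inverse z)"
      by (simp add: f_def numP_eq denP_eq)
    then show ?thesis using num_den_sum z by simp
  qed
  have "isCont f y" unfolding f_def using y by (intro continuous_intros) auto
  then have "(f \<longlongrightarrow> f y) (at y)" by (simp add: isCont_def)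
  moreover have "\<forall>\<^sub>F z in at y. 1 + kap \<beta> = f z"
  proof -
    have "open (- ({0, 1, -1} - {y}))" by (intro open_Compl finite_imp_closed) auto
    then show ?thesis
      unfolding eventually_at_topological using f by (intro exI[of _ "- ({0, 1, -1} - {y})"]) auto
  qed
  then have "(f \<longlongrightarrow> 1 + kap \<beta>) (at y)" by (rule Lim_transform_eventually[OF tendsto_const])
  ultimately have "f y = 1 + kap \<beta>" by (rule tendsto_unique[OF trivial_limit_at])
  then show ?thesis
    by (simp add: cv_def f_def y_def poly_uminus char_hh[OF assms(1,2)] algebra_simps)
qed

lemma cv_W0: "w \<in> W0 D \<Longrightarrow> cv \<beta> (act w s) = cv (inv w \<beta>) s"
  and good_W0: "w \<in> W0 D \<Longrightarrow> good \<beta> (act w s) \<longleftrightarrow> good (inv w \<beta>) s"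
  by (simp_all add: cv_def good_def act_apply hh_W0 W0_inv poly_W0)

lemma c_val_sr:
  assumes "s \<in> characters D" "i \<in> idx D" "good (al i) s"
  shows "c_val D i (act (sr i) s) = 1 + inverse (qpar D i) - c_val D i s"
  using cv_uminus[OF assms(1) al_R0[OF assms(2)] assms(3)] assms act_char[OF W0_sr]
  by (simp add: c_val_cv cv_W0 W0_sr inv_sr sr_al kap_al)

lemma good_iff: "s \<in> characters D \<Longrightarrow> i \<in> idx D \<Longrightarrow> ga_eval (d_fun D (al i)) s \<noteq> 0 \<longleftrightarrow> good (al i) s"
  by (simp add: d_fun_zero al_R0 good_def)

text \<open>The cross relation specifies \<open>p\<close> through its product with the unreduced
  denominator, which may vanish at \<open>s\<close>. The common factor \<open>GP\<close> must
  therefore be cancelled in the group algebra before evaluating.\<close>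

lemma ga_eval_cross:
  assumes s: "s \<in> characters D" and i: "i \<in> idx D" and g: "good (al i) s" and \<mu>: "\<mu> \<in> L"
    and p: "p \<in> group_alg D" "p * c_den (al i) = c'_num D (al i) * (xpow \<mu> - xpow (sr i \<mu>))"
  shows "ga_eval p s = c'_val D i s * (s \<mu> - s (sr i \<mu>))"
proof -
  let ?\<beta> = "al i"
  let ?n = "NP ?\<beta> - smult (kap ?\<beta>) (DP ?\<beta>)"
  have h: "hh ?\<beta> \<in> L" using hh_L al_R0 i by blast
  have n: "numP ?\<beta> - smult (kap ?\<beta>) (denP ?\<beta>) = GP ?\<beta> * ?n"
    by (subst (1) numP_eq, subst (1) denP_eq) (simp add: algebra_simps)
  have "p * (ypoly (hh ?\<beta>) (GP ?\<beta>) * ypoly (hh ?\<beta>) (DP ?\<beta>)) =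
      ypoly (hh ?\<beta>) (GP ?\<beta>) * ypoly (hh ?\<beta>) ?n * (xpow \<mu> - xpow (sr i \<mu>))"
    using p(2) unfolding c'_num_ypoly c_den_ypoly n unfolding denP_eq ypoly_mult .
  then have "ypoly (hh ?\<beta>) (GP ?\<beta>) * (p * ypoly (hh ?\<beta>) (DP ?\<beta>)
      - ypoly (hh ?\<beta>) ?n * (xpow \<mu> - xpow (sr i \<mu>))) = 0"
    by (simp add: right_diff_distrib mult.assoc mult.left_commute)
  \<comment> \<open>Multiplying by the missing factor \<open>DP\<close> completes \<open>GP\<close>
    to \<open>denP\<close>, which is known to be cancellable.\<close>
  then have "ypoly (hh ?\<beta>) (denP ?\<beta>) * (p * ypoly (hh ?\<beta>) (DP ?\<beta>)
      - ypoly (hh ?\<beta>) ?n * (xpow \<mu> - xpow (sr i \<mu>))) = 0"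
    unfolding denP_eq mult.commute[of "GP ?\<beta>"] ypoly_mult mult.assoc by simp
  then have "p * ypoly (hh ?\<beta>) (DP ?\<beta>) = ypoly (hh ?\<beta>) ?n * (xpow \<mu> - xpow (sr i \<mu>))"
    using denP_nzd[OF al_root[OF i]] eq_iff_diff_eq_0 by blast
  then have "ga_eval p s * poly (DP ?\<beta>) (s (hh ?\<beta>)) = poly ?n (s (hh ?\<beta>)) * (s \<mu> - s (sr i \<mu>))"
    using ga_eval_mult[OF s p(1) ga_ypoly[OF h, of "DP ?\<beta>"]]
      ga_eval_mult[OF s ga_ypoly[OF h, of ?n] ga_diff[OF ga_single[OF \<mu>] ga_single[OF sr_L[OF i \<mu>]]], of 1 1]
    by (simp add: ga_eval_ypoly s h ga_eval_diff)
  then have "ga_eval p s = (cv ?\<beta> s - kap ?\<beta>) * (s \<mu> - s (sr i \<mu>))"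
    using g by (simp add: good_def cv_def field_simps)
  then show ?thesis using c'_val_cv[OF s i g] by (simp add: c_val_cv s i kap_al)
qed

section \<open>Walls of the region and zeros of the numerators in terms of c-values\<close>

lemma absr_zero_iff:
  assumes "s \<in> characters D" "w \<in> W0 D" "i \<in> idx D"
  defines "\<gamma> \<equiv> inv w (al i)"
  shows "absr \<gamma> \<in> N_set D s \<longleftrightarrow> poly (NP \<gamma>) (s (hh \<gamma>)) * poly (NP \<gamma>) (s (hh (- \<gamma>))) = 0"
    and "absr \<gamma> \<in> D_set D s \<longleftrightarrow> \<not> good \<gamma> s"
proof -
  have \<gamma>: "\<gamma> \<in> R0 D" "- \<gamma> \<in> R0 D"
    using assms W0_R0_iff W0_inv al_R0 uminus_R0_iff by auto
  show "absr \<gamma> \<in> N_set D s \<longleftrightarrow> poly (NP \<gamma>) (s (hh \<gamma>)) * poly (NP \<gamma>) (s (hh (- \<gamma>))) = 0"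
    using absr_R0_pos[OF \<gamma>(1)] \<gamma> assms(1)
    by (auto simp: N_set_def absr_def n_fun_zero poly_uminus)
  show "absr \<gamma> \<in> D_set D s \<longleftrightarrow> \<not> good \<gamma> s"
    using absr_R0_pos[OF \<gamma>(1)] \<gamma> assms(1) good_uminus[OF assms(1) \<gamma>(1)]
    by (auto simp: D_set_def absr_def d_fun_zero good_def poly_uminus)
qed

lemma absr_D_set:
  assumes "s \<in> characters D" "w \<in> W0 D" "i \<in> idx D"
  shows "absr (inv w (al i)) \<in> D_set D s \<longleftrightarrow> \<not> good (al i) (act w s)"
  using absr_zero_iff(2)[OF assms] good_W0[OF assms(2)] by simp

text \<open>Together with \<open>absr_D_set\<close> this reads off from the weight
  \<open>act w s\<close> alone whether the wall of \<open>al i\<close> is a defining hyperplane of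
  the region.\<close>

lemma absr_N_set:
  assumes "s \<in> characters D" "w \<in> W0 D" "i \<in> idx D" "good (al i) (act w s)"
  shows "absr (inv w (al i)) \<in> N_set D s \<longleftrightarrow>
    c_val D i (act w s) * c_val D i (act (sr i) (act w s)) = 0"
proof -
  let ?\<gamma> = "inv w (al i)"
  have \<gamma>: "?\<gamma> \<in> R0 D" using assms W0_R0_iff W0_inv al_R0 by blast
  have "good ?\<gamma> s" "good (- ?\<gamma>) s"
    using assms good_W0[OF assms(2)] good_uminus[OF assms(1) \<gamma>] by auto
  moreover have "c_val D i (act w s) = cv ?\<gamma> s"
    using assms by (simp add: c_val_cv act_char cv_W0)
  moreover have "c_val D i (act (sr i) (act w s)) = cv (- ?\<gamma>) s"
    using assms by (simp add: c_val_cv act_char cv_W0 W0_sr inv_sr sr_al W0_uminus W0_inv)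
  ultimately show ?thesis
    unfolding absr_zero_iff(1)[OF assms(1-3)] by (auto simp: cv_def good_def poly_uminus)
qed

text \<open>Where the denominator does not vanish, the zero of the numerator survives the reduction;
  where it vanishes, the coroot has value 1 and the weight is fixed. Either way the generator acts
  on \<open>e s\<close> by a scalar.\<close>

lemma num_zero_cases:
  assumes "s \<in> characters D" "i \<in> idx D"
    and "poly (numP (al i)) (s (hh (al i))) * poly (numP (al i)) (inverse (s (hh (al i)))) = 0"
  shows "c_val D i s * c_val D i (act (sr i) s) = 0 \<or> act (sr i) s = s"
proof -
  let ?\<beta> = "al i"
  have \<beta>: "?\<beta> \<in> R0 D" using al_R0 assms by blast
  have "c_val D i (act (sr i) s) = cv (- ?\<beta>) s"
    using assms by (simp add: c_val_cv act_char cv_W0 W0_sr inv_sr sr_al)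
  moreover have "poly (NP ?\<beta>) (s (hh ?\<beta>)) * poly (NP ?\<beta>) (inverse (s (hh ?\<beta>))) = 0 \<or> act (sr i) s = s"
  proof (cases "poly (denP ?\<beta>) (s (hh ?\<beta>)) = 0")
    case True
    then have "s (coroot ?\<beta>) = 1" using poly_denP[OF assms(1) \<beta>] by simp
    then show ?thesis using act_sr_fixed assms by blast
  next
    case False
    have "poly (denP ?\<beta>) (inverse (s (hh ?\<beta>))) \<noteq> 0"
      using denP_root_inverse[of ?\<beta> "inverse (s (hh ?\<beta>))"] False by auto
    then show ?thesis using False assms(3) by (auto simp: numP_eq denP_eq)
  qed
  ultimately show ?thesis
    using assms char_hh[OF assms(1) \<beta>] by (auto simp: c_val_cv cv_def poly_uminus)
qed

lemma c_val_num_den: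
  assumes "s \<in> characters D" "i \<in> idx D" "s (coroot (al i)) \<noteq> 1"
  shows "c_val D i s = poly (numP (al i)) (s (hh (al i))) / poly (denP (al i)) (s (hh (al i)))"
proof -
  have "poly (denP (al i)) (s (hh (al i))) \<noteq> 0"
    using poly_denP[OF assms(1) al_R0[OF assms(2)]] assms(3) by auto
  then show ?thesis by (simp add: c_val_cv assms cv_def numP_eq denP_eq)
qed

end

section \<open>Linear operators on formal combinations of weights\<close>

lemma lookup_scal: "Poly_Mapping.lookup (scal c f) k = c * Poly_Mapping.lookup f k"
  by (simp add: scal_def Poly_Mapping.map.rep_eq when_def)

lemma vector_space_scal: "vector_space (scal :: complex \<Rightarrow> ('k \<Rightarrow>\<^sub>0 complex) \<Rightarrow> _)"
  by unfold_locales (auto intro!: poly_mapping_eqI simp: lookup_scal lookup_add algebra_simps)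

interpretation scal: vector_space "scal :: complex \<Rightarrow> ('k \<Rightarrow>\<^sub>0 complex) \<Rightarrow> _"
  by (rule vector_space_scal)

abbreviation e :: "'k \<Rightarrow> 'k \<Rightarrow>\<^sub>0 complex" where "e s \<equiv> Poly_Mapping.single s 1"

lemma scal_e: "scal c (e s) = Poly_Mapping.single s c"
  by (rule poly_mapping_eqI) (simp add: lookup_scal lookup_single when_def)

lemma scal_decomp: "m = (\<Sum>s\<in>Poly_Mapping.keys m. scal (Poly_Mapping.lookup m s) (e s))"
  using pm_decomp[of m] by (simp add: scal_e)

definition lin :: "('k \<Rightarrow> ('l \<Rightarrow>\<^sub>0 complex)) \<Rightarrow> ('k \<Rightarrow>\<^sub>0 complex) \<Rightarrow> ('l \<Rightarrow>\<^sub>0 complex)" where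
  "lin g m = (\<Sum>s\<in>Poly_Mapping.keys m. scal (Poly_Mapping.lookup m s) (g s))"

lemma lin_superset:
  "finite A \<Longrightarrow> Poly_Mapping.keys m \<subseteq> A \<Longrightarrow> lin g m = (\<Sum>s\<in>A. scal (Poly_Mapping.lookup m s) (g s))"
  unfolding lin_def by (rule sum.mono_neutral_left) (auto simp: in_keys_iff)

lemma lin_add: "lin g (m + m') = lin g m + lin g m'"
proof -
  let ?A = "Poly_Mapping.keys m \<union> Poly_Mapping.keys m'"
  have "lin g (m + m') = (\<Sum>s\<in>?A. scal (Poly_Mapping.lookup (m + m') s) (g s))"
    using keys_add[of m m'] by (intro lin_superset) auto
  then show ?thesis
    by (simp add: lin_superset[of ?A m] lin_superset[of ?A m'] lookup_add scal.scale_left_distrib sum.distrib)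
qed

lemma lin_scal: "lin g (scal c m) = scal c (lin g m)"
proof -
  have "lin g (scal c m) = (\<Sum>s\<in>Poly_Mapping.keys m. scal (Poly_Mapping.lookup (scal c m) s) (g s))"
    by (rule lin_superset) (auto simp: in_keys_iff lookup_scal)
  then show ?thesis by (simp add: lin_def lookup_scal scal.scale_sum_right)
qed

lemma lin_e [simp]: "lin g (e s) = g s"
  by (subst lin_superset[of "{s}"]) auto

definition islin :: "(('k \<Rightarrow>\<^sub>0 complex) \<Rightarrow> ('l \<Rightarrow>\<^sub>0 complex)) \<Rightarrow> bool" where
  "islin f \<longleftrightarrow> (\<forall>m m'. f (m + m') = f m + f m') \<and> (\<forall>c m. f (scal c m) = scal c (f m))"

lemma islin_lin: "islin (lin g)"
  by (simp add: islin_def lin_add lin_scal)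

lemma islin_0: "islin f \<Longrightarrow> f 0 = 0"
  unfolding islin_def by (metis scal.scale_zero_left)

lemma islin_sum: "islin f \<Longrightarrow> f (sum g A) = (\<Sum>a\<in>A. f (g a))"
  by (induction A rule: infinite_finite_induct) (auto simp: islin_0, simp add: islin_def)

lemma islin_eqI:
  assumes "islin f" "islin g" "\<And>s. s \<in> Poly_Mapping.keys m \<Longrightarrow> f (e s) = g (e s)"
  shows "f m = g m"
proof -
  have "f m = (\<Sum>s\<in>Poly_Mapping.keys m. scal (Poly_Mapping.lookup m s) (f (e s)))"
    by (subst scal_decomp[of m]) (use assms(1) in \<open>simp add: islin_sum, simp add: islin_def\<close>)
  also have "\<dots> = (\<Sum>s\<in>Poly_Mapping.keys m. scal (Poly_Mapping.lookup m s) (g (e s)))"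
    by (rule sum.cong) (auto simp: assms(3))
  also have "\<dots> = g m"
    by (subst (3) scal_decomp[of m]) (use assms(2) in \<open>simp add: islin_sum, simp add: islin_def\<close>)
  finally show ?thesis .
qed

lemma islin_id: "islin id" and islin_comp: "islin f \<Longrightarrow> islin g \<Longrightarrow> islin (f \<circ> g)"
  by (simp_all add: islin_def)

lemma islin_foldr: "(\<And>i. islin (f i)) \<Longrightarrow> islin (foldr f is)"
  by (induction "is") (auto intro: islin_comp islin_id)

context hecke
begin

abbreviation cc where "cc \<equiv> c_val D"

text \<open>The diagonal entry of the i-th generator, equal to q_i^(1/2) c'_i(s) where there is no
  pole, but written through c so that one function suffices.\<close>

definition pp :: "nat \<Rightarrow> ('v \<Rightarrow> complex) \<Rightarrow> complex" where
  "pp i s = qroot D i * (cc i s - inverse (qpar D i))"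

text \<open>The product of the two off-diagonal entries of the i-th generator for the pair
  \<open>s\<close>, \<open>act (sr i) s\<close>, before the cut-off by \<open>eps\<close>.\<close>

definition kk :: "nat \<Rightarrow> ('v \<Rightarrow> complex) \<Rightarrow> complex" where
  "kk i s = qpar D i * cc i s * cc i (act (sr i) s)"

definition eps :: "nat \<Rightarrow> ('v \<Rightarrow> complex) \<Rightarrow> complex" where
  "eps i s = (if cc i s * cc i (act (sr i) s) = 0 then 0 else 1)"

abbreviation zz where "zz i \<equiv> qroot D i - inverse (qroot D i)"

lemma qr: "i \<in> idx D \<Longrightarrow> qpar D i = (qroot D i)\<^sup>2" "i \<in> idx D \<Longrightarrow> qroot D i \<noteq> 0"
  using qroot_sq qroot_nz idx_le by auto

lemma pp_sr:
  assumes "s \<in> characters D" "i \<in> idx D" "good (al i) s"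
  shows "pp i (act (sr i) s) = zz i - pp i s"
  using qr[OF assms(2)] by (simp add: pp_def c_val_sr[OF assms] field_simps power2_eq_square)

text \<open>With \<open>pp_sr\<close> this says that the generator has trace \<open>zz i\<close> and
  determinant -1 on such a pair, as its quadratic relation demands.\<close>

lemma kk_eq:
  assumes "s \<in> characters D" "i \<in> idx D" "good (al i) s"
  shows "kk i s = 1 + zz i * pp i s - (pp i s)\<^sup>2"
  using qr[OF assms(2)]
  by (simp add: pp_def kk_def c_val_sr[OF assms] field_simps power2_eq_square)

lemma kk_sr: "i \<in> idx D \<Longrightarrow> kk i (act (sr i) s) = kk i s"
  by (simp add: kk_def act_sr_sr)

lemma eps_sr: "i \<in> idx D \<Longrightarrow> eps i (act (sr i) s) = eps i s"
  by (simp add: eps_def act_sr_sr mult.commute)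

definition TT :: "nat \<Rightarrow> (('v \<Rightarrow> complex) \<Rightarrow>\<^sub>0 complex) \<Rightarrow> (('v \<Rightarrow> complex) \<Rightarrow>\<^sub>0 complex)" where
  "TT i = lin (\<lambda>s. scal (pp i s) (e s) + scal (qroot D i * cc i s * eps i s) (e (act (sr i) s)))"

definition XX :: "'v \<Rightarrow> (('v \<Rightarrow> complex) \<Rightarrow>\<^sub>0 complex) \<Rightarrow> (('v \<Rightarrow> complex) \<Rightarrow>\<^sub>0 complex)" where
  "XX \<mu> = lin (\<lambda>s. scal (s \<mu>) (e s))"

lemma islin_TT: "islin (TT i)" and islin_XX: "islin (XX \<mu>)"
  by (simp_all add: TT_def XX_def islin_lin)

lemma TT_e: "TT i (e s) = scal (pp i s) (e s) + scal (qroot D i * cc i s * eps i s) (e (act (sr i) s))"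
  and XX_e: "XX \<mu> (e s) = scal (s \<mu>) (e s)"
  by (simp_all add: TT_def XX_def)

lemma TT_add: "TT i (m + m') = TT i m + TT i m'" and TT_scal: "TT i (scal c m) = scal c (TT i m)"
  and XX_add: "XX \<mu> (m + m') = XX \<mu> m + XX \<mu> m'" and XX_scal: "XX \<mu> (scal c m) = scal c (XX \<mu> m)"
  by (simp_all add: TT_def XX_def lin_add lin_scal)

lemma TT_quadratic:
  assumes "s \<in> characters D" "i \<in> idx D" "good (al i) s"
  shows "TT i (TT i (e s)) = e s + scal (zz i) (TT i (e s))"
proof -
  let ?p = "pp i s" and ?b = "qroot D i * cc i s * eps i s"
  let ?s' = "act (sr i) s"
  let ?b' = "qroot D i * cc i ?s' * eps i ?s'"
  have "?b * ?b' = kk i s"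
    using qr[OF assms(2)] assms(2) by (simp add: kk_def eps_sr eps_def act_sr_sr power2_eq_square)
  then have bb: "?b * ?b' = 1 + zz i * ?p - ?p * ?p"
    using kk_eq[OF assms] by (simp add: power2_eq_square)
  have "TT i (TT i (e s)) = scal (?p * ?p + ?b * ?b') (e s) + scal (?p * ?b + ?b * pp i ?s') (e ?s')"
    by (simp add: TT_e TT_add TT_scal act_sr_sr assms scal.scale_right_distrib
        scal.scale_left_distrib algebra_simps)
  also have "\<dots> = e s + scal (zz i) (TT i (e s))"
    unfolding bb pp_sr[OF assms] TT_e
    by (simp add: scal.scale_right_distrib scal.scale_left_distrib scal.scale_left_diff_distrib algebra_simps)
  finally show ?thesis .
qed

lemma TT_cross:
  assumes s: "s \<in> characters D" and i: "i \<in> idx D" and g: "good (al i) s" and \<mu>: "\<mu> \<in> L"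
    and p: "p \<in> group_alg D" "p * c_den (al i) = c'_num D (al i) * (xpow \<mu> - xpow (sr i \<mu>))"
  shows "TT i (XX \<mu> (e s)) - XX (sr i \<mu>) (TT i (e s)) = scal (qroot D i * ga_eval p s) (e s)"
proof -
  have "act (sr i) s (sr i \<mu>) = s \<mu>" using i by (simp add: act_sr_apply sr_sr)
  then have "TT i (XX \<mu> (e s)) - XX (sr i \<mu>) (TT i (e s)) = scal (pp i s * (s \<mu> - s (sr i \<mu>))) (e s)"
    by (simp add: TT_e XX_e TT_scal XX_add XX_scal scal.scale_right_distrib
        scal.scale_left_diff_distrib algebra_simps)
  then show ?thesis
    using ga_eval_cross[OF s i g \<mu> p] c'_val_cv[OF s i g] by (simp add: pp_def mult.assoc)
qed

definition TTw where "TTw is = foldr TT is"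

lemma TTw_simps: "TTw [] m = m" "TTw (i # is) m = TT i (TTw is m)" "TTw (is @ js) m = TTw is (TTw js m)"
  by (simp_all add: TTw_def)

lemma islin_TTw: "islin (TTw is)"
  unfolding TTw_def by (rule islin_foldr) (rule islin_TT)

section \<open>The braid relation at exceptional weights\<close>

text \<open>For odd order an alternating word conjugates \<open>sr j\<close> to \<open>sr i\<close>,
  which forces equal lengths. In types C2 and BC2 this parity suffices, so the order 4 is never
  computed.\<close>

lemma cox_even:
  assumes ij: "i \<in> idx D" "j \<in> idx D" and norms: "norm (al i) \<noteq> norm (al j)"
  shows "even (cox i j)"
proof (rule ccontr)
  assume "odd (cox i j)"
  then obtain n where n: "cox i j = Suc n" "even n" by (cases "cox i j") auto
  define x where "x = we (altw n j i)"
  have x: "x \<in> W0 D" using word_W0 altw_idx ij by (simp add: x_def)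
  have "we (altw (Suc n) i j) = sr i \<circ> x" by (simp add: word_elt_Cons x_def)
  moreover have "we (altw (Suc n) j i) = x \<circ> sr j"
    unfolding altw_snoc word_elt_append using n(2) by (simp add: letter_def word_elt_Cons x_def)
  ultimately have "sr i (x (al j)) = x (sr j (al j))"
    using word_cox[OF ij] n(1) by (metis comp_apply)
  then have y: "sr i (x (al j)) = - x (al j)" by (simp add: sr_al ij W0_uminus x)
  have xr: "x (al j) \<in> R0 D" "- x (al j) \<in> R0 D"
    using W0_R0_iff[OF x] al_R0[OF ij(2)] uminus_R0_iff by blast+
  have "x (al j) = al i \<or> - x (al j) = al i"
  proof (rule ccontr)
    assume neq: "\<not> (x (al j) = al i \<or> - x (al j) = al i)"
    show False
    proof (cases "pos (x (al j))")
      case True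
      then have "pos (- x (al j))" using sr_pos[OF ij(1) xr(1)] neq y by simp
      then show False using True neg_root[OF R0_root[OF xr(1)]] by blast
    next
      case False
      then have "pos (- x (al j))" using neg_root[OF R0_root[OF xr(1)]] by blast
      then have "pos (x (al j))"
        using sr_pos[OF ij(1) xr(2)] neq y linear_neg[OF linear_sr, of i "x (al j)"] by simp
      then show False using False by simp
    qed
  qed
  then have "norm (al i) = norm (x (al j))" by (metis norm_minus_cancel)
  also have "\<dots> = norm (al j)" by (simp add: norm_eq_sqrt_inner W0_inner x)
  finally show False using norms by simp
qed

text \<open>An alternating word of even length contains both letters equally often.\<close>

lemma scalar_braid:
  assumes "TT i v = scal a v" "TT j v = scal b v" "even m"
  shows "TTw (altw m i j) v = TTw (altw m j i) v"
proof -
  have "TTw (altw (2 * n) i j) v = scal ((a * b) ^ n) v \<and> TTw (altw (2 * n) j i) v = scal ((a * b) ^ n) v" for n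
    by (induction n) (auto simp: TTw_simps TT_scal assms ac_simps)
  then show ?thesis using assms(3) by (auto elim!: evenE)
qed

lemma TT_scalar_if:
  assumes "cc i s * cc i (act (sr i) s) = 0 \<or> act (sr i) s = s"
  shows "\<exists>a. TT i (e s) = scal a (e s)"
proof (cases "act (sr i) s = s")
  case True
  then show ?thesis unfolding TT_e by (metis scal.scale_left_distrib)
next
  case False
  then have "eps i s = 0" using assms by (simp add: eps_def)
  then show ?thesis unfolding TT_e by auto
qed

lemma TT_scalar_R1:
  assumes "s \<in> characters D" "i \<in> idx D" "al i \<in> R1 D"
    and "s (coroot (al i)) = qpar D i \<or> s (coroot (al i)) = inverse (qpar D i)"
  shows "\<exists>a. TT i (e s) = scal a (e s)"
proof (rule TT_scalar_if, rule num_zero_cases[OF assms(1,2)])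
  have "s (hh (al i)) = inverse (s (coroot (al i)))"
    using assms char_uminus coroot_in_L al_root by (simp add: hh_def)
  moreover have "qpar D i \<noteq> 0" using qr[OF assms(2)] by simp
  ultimately show "poly (numP (al i)) (s (hh (al i))) * poly (numP (al i)) (inverse (s (hh (al i)))) = 0"
    using assms by (auto simp: numP_def q_root_al)
qed

text \<open>The four values are those at which the numerator vanishes at the exponential of
  \<open>hh (al i)\<close> or at its inverse.\<close>

lemma TT_scalar_R2:
  assumes "s \<in> characters D" "i \<in> idx D" "al i \<in> R2 D"
    and "s ((1/2) *\<^sub>R coroot (al i)) \<in> {qroot D 0 * qroot D i, inverse (qroot D 0) * inverse (qroot D i),
      - (qroot D 0 * inverse (qroot D i)), - (inverse (qroot D 0) * qroot D i)}"
  shows "\<exists>a. TT i (e s) = scal a (e s)"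
proof (rule TT_scalar_if, rule num_zero_cases[OF assms(1,2)])
  let ?c = "(1/2) *\<^sub>R coroot (al i)"
  have nR1: "al i \<notin> R1 D" using assms(3) R12_disj by blast
  then have "- hh (al i) = ?c" by (simp add: hh_def)
  then have "?c \<in> L" using hh_L[OF al_R0[OF assms(2)]] L_uminus by metis
  then have h: "s (hh (al i)) = inverse (s ?c)"
    using char_uminus[OF assms(1)] nR1 by (simp add: hh_def)
  have i: "i = DIM('v)" using R2_al[OF assms(2,3)] .
  have nz: "qroot D 0 \<noteq> 0" "qroot D i \<noteq> 0" using qDIM i by auto
  define a b where "a = qroot D 0" and "b = qroot D i"
  have "a \<noteq> 0" "b \<noteq> 0" using nz by (simp_all add: a_def b_def)
  then have ab: "inverse a * inverse b * (a * b) = 1" "a * inverse b * (inverse a * b) = 1"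
    by (simp_all add: field_simps)
  have p: "poly (numP (al i)) y = (1 - inverse a * inverse b * y) * (1 + a * inverse b * y)" for y
    using nR1 by (simp add: numP_def i[symmetric] a_def b_def algebra_simps)
  have "s ?c \<in> {a * b, inverse a * inverse b, - (a * inverse b), - (inverse a * b)}"
    using assms(4) by (simp add: a_def b_def)
  then consider "s ?c = a * b" | "s ?c = inverse a * inverse b" | "s ?c = - (a * inverse b)" | "s ?c = - (inverse a * b)"
    by auto
  then show "poly (numP (al i)) (s (hh (al i))) * poly (numP (al i)) (inverse (s (hh (al i)))) = 0"
    unfolding h p inverse_inverse_eq
    by cases (use ab in \<open>simp_all add: inverse_minus_eq\<close>)
qed

lemma sub_roots_coef:
  assumes ij: "i \<in> idx D" "j \<in> idx D" and v: "v \<in> roots D" "v = of_int x *\<^sub>R al i + of_int y *\<^sub>R al j" and neq: "i \<noteq> j"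
  shows "v \<in> sub_roots D i j"
proof -
  have ne: "al i \<noteq> al j" using inj_al ij neq by (auto simp: inj_on_def)
  have "v \<in> int_span {al i, al j}"
    unfolding int_span_def
    using ne v(2) by (auto intro!: exI[of _ "{al i, al j}"] exI[of _ "\<lambda>a. if a = al i then x else y"])
  then show ?thesis using v by (simp add: sub_roots_def)
qed

text \<open>At every exceptional weight of this type each of the two coroots takes the value q or
  1/q for the parameter of its own root, so both generators act on \<open>e s\<close> by
  scalars.\<close>

lemma exceptional_C2_braid:
  assumes s: "s \<in> characters D" and ij: "i \<in> idx D" "j \<in> idx D" "i \<noteq> j" and ex: "exceptional_C2 D i j s"
  shows "TTw (altw (cox i j) i j) (e s) = TTw (altw (cox i j) j i) (e s)"
proof -
  have ty: "norm (al i) \<noteq> norm (al j)"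
    and sub: "sub_roots D i j = pm {al i, al j, al i + al j, 2 *\<^sub>R al i + al j}"
    using ex by (auto simp: exceptional_C2_def type_C2_def Let_def)
  let ?P = "\<lambda>v. (coef i v, coef j v)"
  note cf = coef_add coef_diff coef_scale coef_al coef_uminus ij pm_def ij(3)[symmetric]
  \<comment> \<open>Coordinates distinguish the doubles of \<open>al i\<close> and
    \<open>al j\<close> from all roots of the subsystem, which places both simple roots in
    \<open>R1\<close>.\<close>
  have "2 *\<^sub>R al i \<notin> roots D"
  proof
    assume "2 *\<^sub>R al i \<in> roots D"
    then have "2 *\<^sub>R al i \<in> sub_roots D i j" by (rule sub_roots_coef[OF ij(1,2) _ _ ij(3), of _ 2 0]) simp
    then have "?P (2 *\<^sub>R al i) \<in> ?P ` sub_roots D i j" by (rule imageI)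
    then show False unfolding sub by (simp add: cf)
  qed
  moreover have "2 *\<^sub>R al j \<notin> roots D"
  proof
    assume "2 *\<^sub>R al j \<in> roots D"
    then have "2 *\<^sub>R al j \<in> sub_roots D i j" by (rule sub_roots_coef[OF ij(1,2) _ _ ij(3), of _ 0 2]) simp
    then have "?P (2 *\<^sub>R al j) \<in> ?P ` sub_roots D i j" by (rule imageI)
    then show False unfolding sub by (simp add: cf)
  qed
  ultimately have R1: "al i \<in> R1 D" "al j \<in> R1 D"
    using al_R0 ij by (auto simp: R0_def R2_def)
  have "(s (coroot (al i)) = qpar D i \<or> s (coroot (al i)) = inverse (qpar D i)) \<and>
      (s (coroot (al j)) = qpar D j \<or> s (coroot (al j)) = inverse (qpar D j))"
    using ex by (auto simp: exceptional_C2_def Let_def power_inverse)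
  then obtain a b where "TT i (e s) = scal a (e s)" "TT j (e s) = scal b (e s)"
    using TT_scalar_R1 s ij R1 by metis
  then show ?thesis using scalar_braid cox_even[OF ij(1,2) ty] by blast
qed

text \<open>Again both generators are scalars at \<open>e s\<close>. Here \<open>al j\<close> lies
  in \<open>R2\<close>, and in all four subcases half its coroot takes one of the values in
  \<open>TT_scalar_R2\<close>.\<close>

lemma exceptional_BC2_braid:
  assumes s: "s \<in> characters D" and ij: "i \<in> idx D" "j \<in> idx D" "i \<noteq> j" and ex: "exceptional_BC2 D i j s"
  shows "TTw (altw (cox i j) i j) (e s) = TTw (altw (cox i j) j i) (e s)"
proof -
  have ty: "norm (al i) \<noteq> norm (al j)"
    and sub: "sub_roots D i j = pm {al i, al j, 2 *\<^sub>R al j, al i + al j, 2 *\<^sub>R (al i + al j), al i + 2 *\<^sub>R al j}"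
    using ex by (auto simp: exceptional_BC2_def type_BC2_def Let_def)
  let ?P = "\<lambda>v. (coef i v, coef j v)"
  note cf = coef_add coef_diff coef_scale coef_al coef_uminus ij pm_def ij(3)[symmetric]
  have "2 *\<^sub>R al i \<notin> roots D"
  proof
    assume "2 *\<^sub>R al i \<in> roots D"
    then have "2 *\<^sub>R al i \<in> sub_roots D i j" by (rule sub_roots_coef[OF ij(1,2) _ _ ij(3), of _ 2 0]) simp
    then have "?P (2 *\<^sub>R al i) \<in> ?P ` sub_roots D i j" by (rule imageI)
    then show False unfolding sub by (simp add: cf)
  qed
  then have R1: "al i \<in> R1 D"
    using al_R0 ij by (auto simp: R0_def R2_def)
  have "2 *\<^sub>R al j \<in> sub_roots D i j" unfolding sub by (simp add: pm_def)
  then have R2: "al j \<in> R2 D" using al_root ij by (simp add: sub_roots_def R2_def)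
  have nz: "qroot D 0 \<noteq> 0" "qroot D j \<noteq> 0" "qpar D 0 \<noteq> 0" "qpar D j \<noteq> 0"
    using q_nz qroot_nz idx_le ij by auto
  have "s (coroot (al i)) = qpar D i \<or> s (coroot (al i)) = inverse (qpar D i)"
    using ex by (auto simp: exceptional_BC2_def Let_def)
  moreover have "s ((1/2) *\<^sub>R coroot (al j)) \<in> {qroot D 0 * qroot D j, inverse (qroot D 0) * inverse (qroot D j),
      - (qroot D 0 * inverse (qroot D j)), - (inverse (qroot D 0) * qroot D j)}"
    using ex unfolding exceptional_BC2_def Let_def by auto
  ultimately obtain a b where "TT i (e s) = scal a (e s)" "TT j (e s) = scal b (e s)"
    using TT_scalar_R1[OF s ij(1) R1] TT_scalar_R2[OF s ij(2) R2] by metis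
  then show ?thesis using scalar_braid cox_even[OF ij(1,2) ty] by blast
qed


text \<open>Write A for the product of the two generators. Cayley-Hamilton gives A^3 = (tr(A)^2 -
  det(A)) A - tr(A) det(A), so the second alternative in \<open>H\<close> makes the cube a scalar
  depending on trace and determinant only, and these do not change when the factors are
  interchanged.\<close>

lemma TTw_two_dim:
  assumes l: "TT l u = scal a u" "TT l v = scal b v"
    and k: "TT k u = scal \<alpha> u + scal \<beta> v" "TT k v = scal \<gamma> u + scal \<delta> v"
    and H: "a = b \<or> (a * \<alpha> + b * \<delta>)\<^sup>2 = a * b * (\<alpha> * \<delta> - \<beta> * \<gamma>)"
  shows "TTw (altw (6 * n) l k) (scal x u + scal y v) = TTw (altw (6 * n) k l) (scal x u + scal y v)"
proof -
  define V where "V = (\<lambda>x y. scal x u + scal y v)"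
  have Vl: "TT l (V x y) = V (a * x) (b * y)" for x y
    by (simp add: V_def TT_add TT_scal l ac_simps)
  have Vk: "TT k (V x y) = V (\<alpha> * x + \<gamma> * y) (\<beta> * x + \<delta> * y)" for x y
    by (simp add: V_def TT_add TT_scal k scal.scale_right_distrib scal.scale_left_distrib ac_simps)
  have V: "\<exists>x' y'. TTw is (V x y) = V x' y'" if "set is \<subseteq> {l, k}" for "is" x y
    using that
  proof (induction "is")
    case (Cons m "is")
    then obtain x' y' where "TTw is (V x y) = V x' y'" by auto
    then have "TTw (m # is) (V x y) = TT m (V x' y')" by (simp add: TTw_simps)
    moreover have "m = l \<or> m = k" using Cons.prems by auto
    ultimately show ?case using Vl Vk by metis
  qed (auto simp: TTw_simps)
  have six: "TTw (altw 6 l k) (V x y) = TTw (altw 6 k l) (V x y)" for x y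
  proof -
    let ?lk = "\<lambda>x y. TT l (TT k (V x y))" and ?kl = "\<lambda>x y. TT k (TT l (V x y))"
    let ?K = "(a * \<alpha> + b * \<delta>)\<^sup>2 - a * b * (\<alpha> * \<delta> - \<beta> * \<gamma>)"
    \<comment> \<open>The two words of length 6 differ by multiples of \<open>?K * (a - b)\<close>,
      and \<open>H\<close> says that one of these two factors vanishes.\<close>
    have *: "V x1 y1 = V x2 y2" if "x1 - x2 = ?K * (a - b) * \<gamma> * y" "y1 - y2 = ?K * (b - a) * \<beta> * x" for x1 x2 y1 y2
      using that H by auto
    have 6: "altw 6 l k = [l, k, l, k, l, k]" "altw 6 k l = [k, l, k, l, k, l]"
      by (simp_all add: eval_nat_numeral)
    show ?thesis
      unfolding 6 TTw_simps Vl Vk by (rule *) algebra+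
  qed
  have "TTw (altw (6 * n) l k) (V x y) = TTw (altw (6 * n) k l) (V x y)" for n x y
  proof (induction n)
    case (Suc n)
    have app: "altw (6 * Suc n) l k = altw 6 l k @ altw (6 * n) l k"
      "altw (6 * Suc n) k l = altw 6 k l @ altw (6 * n) k l"
      using altw_add[of 6 "6 * n" l k] altw_add[of 6 "6 * n" k l] by (simp_all add: letter_def)
    obtain x' y' where "TTw (altw (6 * n) k l) (V x y) = V x' y'"
      using V[of "altw (6 * n) k l" x y] set_altw[of "6 * n" k l] by auto
    then show ?case by (simp only: app TTw_simps Suc six)
  qed (simp add: TTw_simps)
  then show ?thesis by (simp add: V_def)
qed

text \<open>On the span of \<open>e\<^sub>s\<close> and \<open>e\<^sub>k\<^sub>s\<close> either \<open>T\<^sub>l\<close> is a scalar or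
  \<open>A = T\<^sub>l T\<^sub>k\<close> satisfies \<open>tr(A)\<^sup>2 = det(A)\<close>, hence
  \<open>A\<^sup>3\<close> is a scalar.\<close>

lemma two_dim_braid:
  assumes s: "s \<in> characters D" and lk: "l \<in> idx D" "k \<in> idx D" and g: "good (al k) s"
    and six: "6 dvd m"
    and a: "TT l (e s) = scal a (e s)"
    and b: "eps k s \<noteq> 0 \<Longrightarrow> TT l (e (act (sr k) s)) = scal b (e (act (sr k) s))"
    and H: "eps k s \<noteq> 0 \<Longrightarrow> a = b \<or> a * b = -1 \<and> (a * pp k s + b * (zz k - pp k s))\<^sup>2 = 1"
  shows "TTw (altw m l k) (e s) = TTw (altw m k l) (e s)"
proof (cases "eps k s = 0")
  case True
  then have "TT k (e s) = scal (pp k s) (e s)" by (simp add: TT_e)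
  moreover have "even m" using six by (auto elim: dvdE)
  ultimately show ?thesis using scalar_braid a by blast
next
  case False
  let ?s = "act (sr k) s"
  let ?b = "qroot D k * cc k s * eps k s" and ?c = "qroot D k * cc k ?s * eps k s"
  have "?b * ?c = kk k s"
    using False qr[OF lk(2)] by (simp add: kk_def eps_def power2_eq_square split: if_splits)
  then have bc: "?b * ?c = 1 + zz k * pp k s - (pp k s)\<^sup>2" using kk_eq[OF s lk(2) g] by simp
  obtain n where m: "m = 6 * n" using six by (auto elim: dvdE)
  have "TTw (altw (6 * n) l k) (scal 1 (e s) + scal 0 (e ?s)) = TTw (altw (6 * n) k l) (scal 1 (e s) + scal 0 (e ?s))"
  proof (rule TTw_two_dim)
    show "TT l (e s) = scal a (e s)" "TT l (e ?s) = scal b (e ?s)" using a b False by auto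
    show "TT k (e s) = scal (pp k s) (e s) + scal ?b (e ?s)" by (rule TT_e)
    show "TT k (e ?s) = scal ?c (e s) + scal (zz k - pp k s) (e ?s)"
      using TT_e[of k ?s] pp_sr[OF s lk(2) g] lk by (simp add: act_sr_sr eps_sr add.commute)
    \<comment> \<open>The determinant of the generator \<open>k\<close>, whose eigenvalues multiply
      to -1.\<close>
    have "pp k s * (zz k - pp k s) - ?b * ?c = -1"
      unfolding bc by (simp add: algebra_simps power2_eq_square)
    then show "a = b \<or> (a * pp k s + b * (zz k - pp k s))\<^sup>2 = a * b * (pp k s * (zz k - pp k s) - ?b * ?c)"
      using H[OF False] by auto
  qed
  then show ?thesis by (simp add: m)
qed

lemma pp_R1:
  assumes "s \<in> characters D" "i \<in> idx D" "al i \<in> R1 D" "s (coroot (al i)) = z" "z \<noteq> 1"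
  shows "pp i s = qroot D i * (1 - inverse (qpar D i)) * z / (z - 1)"
proof -
  have c: "coroot (al i) \<in> L" using coroot_in_L al_root assms by blast
  have z: "z \<noteq> 0" using char_nz[OF assms(1) c] assms(4) by simp
  have q: "qpar D i \<noteq> 0" using qr[OF assms(2)] by simp
  have "s (hh (al i)) = inverse z" using assms char_uminus[OF assms(1) c] by (simp add: hh_def)
  then have "cc i s = (1 - inverse (qpar D i) * inverse z) / (1 - inverse z)"
    using c_val_num_den[OF assms(1,2)] assms by (simp add: numP_def denP_def q_root_al)
  also have "\<dots> = (z - inverse (qpar D i)) / (z - 1)"
    using z assms(5) by (simp add: divide_simps)
  finally have cc: "cc i s = (z - inverse (qpar D i)) / (z - 1)" .
  have "(z - w) / (z - 1) - w = (1 - w) * z / (z - 1)" for w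
    using assms(5) by (simp add: field_simps)
  then show ?thesis by (simp add: pp_def cc mult.assoc)
qed

text \<open>At these values the diagonal entry is a root of the quadratic relation, so by
  \<open>kk_eq\<close> the off-diagonal product vanishes and with it \<open>eps\<close>.\<close>

lemma TT_scalar_value:
  assumes s: "s \<in> characters D" and i: "i \<in> idx D" and R1: "al i \<in> R1 D" and q: "qpar D i \<noteq> 1"
  shows "s (coroot (al i)) = qpar D i \<Longrightarrow> TT i (e s) = scal (qroot D i) (e s)"
    and "s (coroot (al i)) = inverse (qpar D i) \<Longrightarrow> TT i (e s) = scal (- inverse (qroot D i)) (e s)"
proof -
  have r: "qroot D i \<noteq> 0" "qpar D i = (qroot D i)\<^sup>2" "qpar D i \<noteq> 0" using qr[OF i] by auto
  have eps: "eps i s = 0" if "pp i s = qroot D i \<or> pp i s = - inverse (qroot D i)" "s (coroot (al i)) \<noteq> 1"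
  proof -
    have "kk i s = 0"
      using that(1) kk_eq[OF s i good_if[OF s al_R0[OF i] that(2)]] r(1)
      by (auto simp: algebra_simps power2_eq_square)
    then show ?thesis using r by (simp add: kk_def eps_def)
  qed
  { assume z: "s (coroot (al i)) = qpar D i"
    have "(1 - inverse (qpar D i)) * qpar D i = qpar D i - 1" using r(3) by (simp add: left_diff_distrib)
    then have "pp i s = qroot D i" using pp_R1[OF s i R1 z q] q by (simp add: mult.assoc)
    then show "TT i (e s) = scal (qroot D i) (e s)" using eps z q by (simp add: TT_e) }
  { assume z: "s (coroot (al i)) = inverse (qpar D i)"
    have z1: "inverse (qpar D i) \<noteq> 1" using q by simp
    have "pp i s = qroot D i * (1 - inverse (qpar D i)) * inverse (qpar D i) / (inverse (qpar D i) - 1)"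
      by (rule pp_R1[OF s i R1 z z1])
    also have "\<dots> = - (qroot D i * inverse (qpar D i)) * ((inverse (qpar D i) - 1) / (inverse (qpar D i) - 1))"
      by (simp add: algebra_simps divide_simps)
    also have "\<dots> = - inverse (qroot D i)" using z1 r by (simp add: power2_eq_square)
    finally have "pp i s = - inverse (qroot D i)" .
    then show "TT i (e s) = scal (- inverse (qroot D i)) (e s)" using eps z z1 by (simp add: TT_e) }
qed

text \<open>The weight is fixed by the reflection, so \<open>c_val_sr\<close> reads c = 2 - c and
  determines the value without computing lowest terms.\<close>

lemma TT_scalar_q1:
  assumes s: "s \<in> characters D" and i: "i \<in> idx D" and g: "good (al i) s" and q: "qpar D i = 1"
    and z: "s (coroot (al i)) = 1"
  shows "TT i (e s) = scal (qroot D i) (e s)"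
proof -
  have fx: "act (sr i) s = s" using act_sr_fixed i s z by blast
  then have "cc i s = 2 - cc i s" using c_val_sr[OF s i g] q by simp
  then have "2 * cc i s = 2" by (simp add: algebra_simps)
  then have "cc i s = 1" by simp
  then show ?thesis by (simp add: TT_e fx pp_def q eps_def)
qed

text \<open>Here \<open>r\<close> is the square root of the parameter q_k, \<open>R\<close> that of
  q_l, and \<open>P\<close> is the diagonal entry of the generator \<open>k\<close> where its coroot
  has value q_k^2. The bracket is the trace of the product when the generator \<open>l\<close> has
  eigenvalues \<open>- inverse R\<close> and \<open>R\<close>. The admissible \<open>R\<close> come
  from q_l = q_k and q_l = q_k^3, which fix square roots only up to sign.\<close>

lemma trace_one:
  fixes r R P :: complex
  assumes "r \<noteq> 0" "P * (r\<^sup>2 + 1) = r * r\<^sup>2" "R = r \<or> R = - r \<or> R = r ^ 3 \<or> R = - (r ^ 3)"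
  shows "(- inverse R * P + R * (r - inverse r - P))\<^sup>2 = 1"
proof -
  define w where "w = inverse r"
  have rw: "r * w = 1" using assms(1) by (simp add: w_def)
  have 1: "- w * P + r * (r - w - P) = -1" using assms(2) rw by algebra
  have 3: "- (w ^ 3) * P + r ^ 3 * (r - w - P) = -1" using assms(2) rw by algebra
  from assms(3) consider "R = r" | "R = - r" | "R = r ^ 3" | "R = - (r ^ 3)" by blast
  then show ?thesis
  proof cases
    case 1 then show ?thesis using \<open>- w * P + r * (r - w - P) = -1\<close> by (simp add: w_def)
  next
    case 2
    then have "- inverse R * P + R * (r - inverse r - P) = - (- w * P + r * (r - w - P))"
      by (simp add: w_def inverse_minus_eq algebra_simps)
    then show ?thesis unfolding 1 by simp
  next
    case r3: 3 then show ?thesis using 3 by (simp add: w_def power_inverse)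
  next
    case 4
    then have "- inverse R * P + R * (r - inverse r - P) = - (- (w ^ 3) * P + r ^ 3 * (r - w - P))"
      by (simp add: w_def power_inverse inverse_minus_eq algebra_simps)
    then show ?thesis unfolding 3 by simp
  qed
qed

text \<open>The exceptional weights of type G2 at which the generator \<open>k\<close> need not be a
  scalar: the generator \<open>l\<close> takes both of its eigenvalues on \<open>e s\<close> and
  \<open>e (act (sr k) s)\<close>, and \<open>trace_one\<close> supplies the trace condition. If
  q_k^2 = 1 or q_l = 1, one of the generators degenerates to a scalar instead.\<close>

lemma two_dim_special:
  assumes s: "s \<in> characters D" and lk: "l \<in> idx D" "k \<in> idx D"
    and R1: "al l \<in> R1 D" "al k \<in> R1 D" and g: "good (al k) s" "good (al l) s"
    and g': "eps k s \<noteq> 0 \<Longrightarrow> good (al l) (act (sr k) s)" and six: "6 dvd m"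
    and R: "qroot D l = qroot D k \<or> qroot D l = - qroot D k \<or>
      qroot D l = qroot D k ^ 3 \<or> qroot D l = - (qroot D k ^ 3)"
    and z: "s (coroot (al k)) = (qpar D k)\<^sup>2 \<and> s (coroot (al l)) = inverse (qpar D l) \<and>
        act (sr k) s (coroot (al l)) = qpar D l \<or>
      s (coroot (al k)) = (inverse (qpar D k))\<^sup>2 \<and> s (coroot (al l)) = qpar D l \<and>
        act (sr k) s (coroot (al l)) = inverse (qpar D l)"
  shows "TTw (altw m l k) (e s) = TTw (altw m k l) (e s)"
proof (cases "s (coroot (al k)) = 1")
  case True
  then obtain a where "TT k (e s) = scal a (e s)"
    using TT_scalar_if act_sr_fixed[OF lk(2) s] by blast
  moreover obtain b where "TT l (e s) = scal b (e s)"
    using z TT_scalar_R1[OF s lk(1) R1(1)] by blast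
  moreover have "even m" using six by (auto elim: dvdE)
  ultimately show ?thesis using scalar_braid by blast
next
  case z1: False
  have s': "act (sr k) s \<in> characters D" using act_char W0_sr lk s by blast
  show ?thesis
  proof (cases "qpar D l = 1")
    case True
    show ?thesis
    proof (rule two_dim_braid[OF s lk g(1) six])
      show "TT l (e s) = scal (qroot D l) (e s)"
        using TT_scalar_q1[OF s lk(1) g(2) True] z True by auto
      show "TT l (e (act (sr k) s)) = scal (qroot D l) (e (act (sr k) s))" if "eps k s \<noteq> 0"
        using TT_scalar_q1[OF s' lk(1) g'[OF that] True] z True by auto
    qed simp
  next
    case q1: False
    define q r where "q = qpar D k" and "r = qroot D k"
    have r: "r \<noteq> 0" "q = r\<^sup>2" "q \<noteq> 0" using qr[OF lk(2)] by (auto simp: q_def r_def)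
    have rl: "qroot D l \<noteq> 0" using qr[OF lk(1)] by simp
    define P where "P = r * q / (q + 1)"
    have qq: "q \<noteq> 1" "q + 1 \<noteq> 0" using z1 z by (auto simp: q_def add_eq_0_iff2)
    have P: "P * (r\<^sup>2 + 1) = r * r\<^sup>2" using qq r by (simp add: P_def)
    have val: "pp k s = P" if "s (coroot (al k)) = q\<^sup>2"
    proof -
      have "pp k s = r * (1 - inverse q) * q\<^sup>2 / (q\<^sup>2 - 1)"
        using pp_R1[OF s lk(2) R1(2) that] z1 that by (simp add: r_def q_def)
      also have "(1 - inverse q) * q\<^sup>2 = q * (q - 1)"
        using r(3) by (simp add: left_diff_distrib right_diff_distrib power2_eq_square)
      then have "r * (1 - inverse q) * q\<^sup>2 = (q - 1) * (r * q)" by (simp add: mult.assoc mult.left_commute)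
      also have "q\<^sup>2 - 1 = (q - 1) * (q + 1)" by (simp add: algebra_simps power2_eq_square)
      finally show ?thesis using qq by (simp add: P_def)
    qed
    \<comment> \<open>At the inverse value the two diagonal entries of the generator
      \<open>k\<close> are interchanged.\<close>
    have val': "pp k s = zz k - P" if "s (coroot (al k)) = (inverse q)\<^sup>2"
    proof -
      define v where "v = inverse q"
      have v: "q * v = 1" using r(3) by (simp add: v_def)
      have v1: "v\<^sup>2 \<noteq> 1" using z1 that by (simp add: v_def)
      have "pp k s = r * (1 - v) * v\<^sup>2 / (v\<^sup>2 - 1)"
        using pp_R1[OF s lk(2) R1(2) that] z1 that by (simp add: r_def q_def v_def)
      then have "pp k s * (v\<^sup>2 - 1) = r * (1 - v) * v\<^sup>2" using v1 by simp
      moreover have "P * (q + 1) = r * q" using qq by (simp add: P_def)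
      then have "(r - r * v - P) * (q + 1) = r - r * v - r * q * v" using v by algebra
      then have "(r - r * v - P) * (q + 1) * (v\<^sup>2 - 1) = (r * (1 - v) * v\<^sup>2) * (q + 1)"
        using v by algebra
      ultimately have "pp k s * ((v\<^sup>2 - 1) * (q + 1)) = (r - r * v - P) * ((v\<^sup>2 - 1) * (q + 1))"
        by algebra
      moreover have "(v\<^sup>2 - 1) * (q + 1) \<noteq> 0" using v1 qq by simp
      ultimately have "pp k s = r - r * v - P" by (metis mult_right_cancel)
      moreover have "r * v = inverse r" using r by (simp add: v_def power2_eq_square)
      ultimately show ?thesis by (simp add: r_def)
    qed
    have tr: "(- inverse (qroot D l) * P + qroot D l * (zz k - P))\<^sup>2 = 1"
      using trace_one[OF r(1) P, of "qroot D l"] R by (simp add: r_def)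
    from z show ?thesis
    proof (elim disjE conjE)
      assume z: "s (coroot (al k)) = (qpar D k)\<^sup>2" "s (coroot (al l)) = inverse (qpar D l)"
        "act (sr k) s (coroot (al l)) = qpar D l"
      show ?thesis
      proof (rule two_dim_braid[OF s lk g(1) six])
        show "TT l (e s) = scal (- inverse (qroot D l)) (e s)"
          using TT_scalar_value(2)[OF s lk(1) R1(1) q1] z by simp
        show "TT l (e (act (sr k) s)) = scal (qroot D l) (e (act (sr k) s))"
          using TT_scalar_value(1)[OF s' lk(1) R1(1) q1] z by simp
        show "- inverse (qroot D l) = qroot D l \<or> - inverse (qroot D l) * qroot D l = - 1 \<and>
          (- inverse (qroot D l) * pp k s + qroot D l * (zz k - pp k s))\<^sup>2 = 1"
          using tr val z rl by (simp add: q_def)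
      qed
    next
      assume z: "s (coroot (al k)) = (inverse (qpar D k))\<^sup>2" "s (coroot (al l)) = qpar D l"
        "act (sr k) s (coroot (al l)) = inverse (qpar D l)"
      show ?thesis
      proof (rule two_dim_braid[OF s lk g(1) six])
        show "TT l (e s) = scal (qroot D l) (e s)"
          using TT_scalar_value(1)[OF s lk(1) R1(1) q1] z by simp
        show "TT l (e (act (sr k) s)) = scal (- inverse (qroot D l)) (e (act (sr k) s))"
          using TT_scalar_value(2)[OF s' lk(1) R1(1) q1] z by simp
        have "qroot D l * pp k s + - inverse (qroot D l) * (zz k - pp k s)
            = - inverse (qroot D l) * P + qroot D l * (zz k - P)"
          using val' z by (simp add: q_def)
        then show "qroot D l = - inverse (qroot D l) \<or> qroot D l * - inverse (qroot D l) = - 1 \<and>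
          (qroot D l * pp k s + - inverse (qroot D l) * (zz k - pp k s))\<^sup>2 = 1"
          using tr rl by simp
      qed
    qed
  qed
qed

lemma sr_alt: "sr i v = v - (v \<bullet> coroot (al i)) *\<^sub>R al i"
  by (simp add: sr_def coroot_def)

section \<open>Exceptional weights of type G2\<close>

context
  fixes i j
  assumes ij: "i \<in> idx D" "j \<in> idx D" "i \<noteq> j" and ty: "type_G2 D i j"
begin

lemma G2_sub: "sub_roots D i j = pm {al i, al j, al i + al j, 2 *\<^sub>R al i + al j,
    3 *\<^sub>R al i + al j, 3 *\<^sub>R al i + 2 *\<^sub>R al j}"
  and G2_norm: "norm (al i) \<noteq> norm (al j)"
  using ty by (auto simp: type_G2_def Let_def)

lemma G2_coefs:
  assumes "of_int x *\<^sub>R al i + of_int y *\<^sub>R al j \<in> roots D"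
  shows "(x, y) \<in> {(1,0), (0,1), (1,1), (2,1), (3,1), (3,2), (-1,0), (0,-1), (-1,-1), (-2,-1), (-3,-1), (-3,-2)}"
proof -
  let ?v = "of_int x *\<^sub>R al i + of_int y *\<^sub>R al j"
  let ?P = "\<lambda>v. (coef i v, coef j v)"
  have "?v \<in> sub_roots D i j" by (rule sub_roots_coef[OF ij(1,2) assms refl ij(3)])
  then have "?P ?v \<in> ?P ` sub_roots D i j" by (rule imageI)
  moreover have "?P ?v = (of_int x, of_int y)"
    using ij by (simp add: coef_add coef_scale coef_al)
  moreover have "?P ` sub_roots D i j = {(1,0), (0,1), (1,1), (2,1), (3,1), (3,2), (-1,0), (0,-1), (-1,-1), (-2,-1), (-3,-1), (-3,-2)}"
    unfolding G2_sub pm_def using ij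
    by (simp add: coef_add coef_diff coef_uminus coef_scale coef_al image_Un insert_commute)
  ultimately have "(real_of_int x, real_of_int y) \<in> {(1,0), (0,1), (1,1), (2,1), (3,1), (3,2), (-1,0), (0,-1), (-1,-1), (-2,-1), (-3,-1), (-3,-2)}"
    by (simp only:)
  moreover have "real_of_int u = - 1 \<longleftrightarrow> u = - 1" for u
    by (metis of_int_1 of_int_eq_iff of_int_minus)
  moreover have "real_of_int u = - numeral k \<longleftrightarrow> u = - numeral k" for u k
    by (metis of_int_numeral of_int_eq_iff of_int_minus)
  ultimately show ?thesis by simp
qed

lemma G2_R1: "al i \<in> R1 D" "al j \<in> R1 D"
proof -
  have "2 *\<^sub>R al i \<notin> roots D" "2 *\<^sub>R al j \<notin> roots D"
    using G2_coefs[of 2 0] G2_coefs[of 0 2] by auto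
  then show "al i \<in> R1 D" "al j \<in> R1 D" using al_R0 ij by (auto simp: R0_def R2_def)
qed

text \<open>Reflecting \<open>al j\<close> and \<open>3 al i + al j\<close> in \<open>al i\<close>
  keeps the coefficient 1 of \<open>al j\<close>, so both new coefficients of \<open>al i\<close>
  lie between 0 and 3, which leaves a single Cartan integer. Reflecting \<open>al i\<close> and
  \<open>3 al i + al j\<close> in \<open>al j\<close> determines the other.\<close>

lemma G2_cartan: "al j \<bullet> coroot (al i) = -3" "al i \<bullet> coroot (al j) = -1"
proof -
  have r: "3 *\<^sub>R al i + al j \<in> roots D"
  proof -
    have "3 *\<^sub>R al i + al j \<in> sub_roots D i j" unfolding G2_sub pm_def by blast
    then show ?thesis by (simp add: sub_roots_def)
  qed
  have self: "al i \<bullet> coroot (al i) = 2" "al j \<bullet> coroot (al j) = 2"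
    using inner_coroot[OF al_nz[OF ij(1)]] inner_coroot[OF al_nz[OF ij(2)]]
    by (simp_all only: inner_commute[of "al _" "coroot _"])
  obtain n where n: "al j \<bullet> coroot (al i) = of_int n"
    using integral_root[OF al_root[OF ij(1)] al_root[OF ij(2)]] by (auto elim: Ints_cases)
  have "of_int (- n) *\<^sub>R al i + of_int 1 *\<^sub>R al j \<in> roots D"
    using sr_root[OF ij(1) al_root[OF ij(2)]] by (simp add: sr_alt n)
  moreover have "sr i (3 *\<^sub>R al i + al j) = of_int (- 3 - n) *\<^sub>R al i + of_int 1 *\<^sub>R al j"
    by (rule coef_eqI)
      (simp add: sr_alt n inner_add_left self coef_add coef_diff coef_scale algebra_simps)
  then have "of_int (- 3 - n) *\<^sub>R al i + of_int 1 *\<^sub>R al j \<in> roots D"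
    using sr_root[OF ij(1) r] by simp
  ultimately have "n = -3" using G2_coefs[of "- n" 1] G2_coefs[of "- 3 - n" 1] by auto
  then show "al j \<bullet> coroot (al i) = -3" by (simp add: n)
  obtain l where l: "al i \<bullet> coroot (al j) = of_int l"
    using integral_root[OF al_root[OF ij(2)] al_root[OF ij(1)]] by (auto elim: Ints_cases)
  have "of_int 1 *\<^sub>R al i + of_int (- l) *\<^sub>R al j \<in> roots D"
    using sr_root[OF ij(2) al_root[OF ij(1)]] by (simp add: sr_alt l)
  moreover have "sr j (3 *\<^sub>R al i + al j) = of_int 3 *\<^sub>R al i + of_int (- 3 * l - 1) *\<^sub>R al j"
    by (rule coef_eqI)
      (simp add: sr_alt l inner_add_left self coef_add coef_diff coef_scale algebra_simps)
  then have "of_int 3 *\<^sub>R al i + of_int (- 3 * l - 1) *\<^sub>R al j \<in> roots D"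
    using sr_root[OF ij(2) r] by simp
  ultimately have "l = -1" using G2_coefs[of 1 "- l"] G2_coefs[of 3 "- 3 * l - 1"] by auto
  then show "al i \<bullet> coroot (al j) = -1" by (simp add: l)
qed

lemma G2_coroots: "sr i (coroot (al j)) = coroot (al j) + coroot (al i)"
  "sr j (coroot (al i)) = coroot (al i) + 3 *\<^sub>R coroot (al j)"
  using G2_cartan by (simp_all add: sr_def inner_commute)

text \<open>The product of the reflections moves \<open>al i\<close> through an orbit of length 6;
  divisibility is all that the computation in dimension two requires.\<close>

lemma G2_cox: "6 dvd cox i j"
proof -
  define g where "g = sr i \<circ> sr j"
  have self: "al i \<bullet> coroot (al i) = 2" "al j \<bullet> coroot (al j) = 2"
    using inner_coroot[OF al_nz[OF ij(1)]] inner_coroot[OF al_nz[OF ij(2)]]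
    by (simp_all only: inner_commute[of "al _" "coroot _"])
  have lin: "linear g" unfolding g_def by (rule linear_compose[OF linear_sr linear_sr])
  have gi: "g (al i) = 2 *\<^sub>R al i + al j" and gj: "g (al j) = - (3 *\<^sub>R al i) - al j"
    by (simp_all add: g_def sr_alt self G2_cartan inner_add_left inner_diff_left algebra_simps scaleR_2)
  have g: "g (2 *\<^sub>R al i + al j) = al i + al j" "g (al i + al j) = - al i"
    "g (- al i) = - (2 *\<^sub>R al i + al j)" "g (- (2 *\<^sub>R al i + al j)) = - (al i + al j)"
    "g (- (al i + al j)) = al i"
    by (auto intro!: coef_eqI simp: linear_add[OF lin] linear_neg[OF lin] linear_diff[OF lin] linear_scale[OF lin]
        gi gj coef_add coef_diff coef_scale coef_uminus)
  have pow: "(g ^^ 1) (al i) = 2 *\<^sub>R al i + al j" "(g ^^ 2) (al i) = al i + al j" "(g ^^ 3) (al i) = - al i"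
     "(g ^^ 4) (al i) = - (2 *\<^sub>R al i + al j)" "(g ^^ 5) (al i) = - (al i + al j)" "(g ^^ 6) (al i) = al i"
  proof -
    have step: "(g ^^ 2) x = g ((g ^^ 1) x)" "(g ^^ 3) x = g ((g ^^ 2) x)" "(g ^^ 4) x = g ((g ^^ 3) x)"
      "(g ^^ 5) x = g ((g ^^ 4) x)" "(g ^^ 6) x = g ((g ^^ 5) x)" "(g ^^ 1) x = g x" for x
      by (simp_all add: eval_nat_numeral)
    show "(g ^^ 1) (al i) = 2 *\<^sub>R al i + al j" "(g ^^ 2) (al i) = al i + al j" "(g ^^ 3) (al i) = - al i"
     "(g ^^ 4) (al i) = - (2 *\<^sub>R al i + al j)" "(g ^^ 5) (al i) = - (al i + al j)" "(g ^^ 6) (al i) = al i"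
      by (simp_all only: step gi g)
  qed
  have per: "(g ^^ (6 * k)) (al i) = al i" for k
    by (induction k) (simp_all only: mult_Suc_right funpow_add comp_apply pow mult_0_right funpow_0 id_apply)
  define r where "r = cox i j mod 6"
  have "(g ^^ (r + 6 * (cox i j div 6))) (al i) = al i"
    using cox_power[OF ij(1,2)] by (simp add: r_def g_def)
  then have r: "(g ^^ r) (al i) = al i" by (simp only: funpow_add comp_apply per)
  have "r < 6" by (simp add: r_def)
  then consider "r = 0" | "r = 1" | "r = 2" | "r = 3" | "r = 4" | "r = 5" by linarith
  then have "r = 0"
  proof cases
    case 2 then show ?thesis using arg_cong[OF r, of "coef j"] pow(1) ij by (simp add: coef_add coef_scale coef_al)
  next
    case 3 then show ?thesis using arg_cong[OF r, of "coef j"] pow(2) ij by (simp add: coef_add coef_scale coef_al)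
  next
    case 4 then show ?thesis using arg_cong[OF r, of "coef i"] pow(3) ij by (simp add: coef_uminus coef_al)
  next
    case 5 then show ?thesis using arg_cong[OF r, of "coef j"] pow(4) ij
      by (simp add: coef_add coef_diff coef_uminus coef_scale coef_al)
  next
    case 6 then show ?thesis using arg_cong[OF r, of "coef j"] pow(5) ij
      by (simp add: coef_add coef_diff coef_uminus coef_scale coef_al)
  qed
  then show ?thesis by (auto simp: r_def)
qed

text \<open>If each coroot has the value q or 1/q of its own root, both generators are scalars.
  Otherwise one coroot has the value q^2 or 1/q^2; its generator plays the part of \<open>k\<close>
  in \<open>two_dim_special\<close>, and its reflection inverts the value of the other
  coroot.\<close>

lemma exceptional_G2_braid:
  assumes s: "s \<in> characters D" and ex: "exceptional_G2 D i j s"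
    and g: "good (al i) s" "good (al j) s"
    and g': "eps j s \<noteq> 0 \<Longrightarrow> good (al i) (act (sr j) s)" "eps i s \<noteq> 0 \<Longrightarrow> good (al j) (act (sr i) s)"
  shows "TTw (altw (cox i j) i j) (e s) = TTw (altw (cox i j) j i) (e s)"
proof -
  define qi qj where "qi = qpar D i" and "qj = qpar D j"
  define a b where "a = s (coroot (al i))" and "b = s (coroot (al j))"
  have nz: "qi \<noteq> 0" "qj \<noteq> 0" using qr ij by (auto simp: qi_def qj_def)
  have cL: "coroot (al i) \<in> L" "coroot (al j) \<in> L" using coroot_in_L al_root ij by auto
  have b2: "act (sr i) s (coroot (al j)) = b * a"
    using cL by (simp add: act_sr_apply ij G2_coroots char_add s a_def b_def)
  have a2: "act (sr j) s (coroot (al i)) = a * b ^ 3"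
    using char_of_int[OF s cL(2), of 3] L_of_int[OF cL(2), of 3] cL
    by (simp add: act_sr_apply ij G2_coroots char_add s a_def b_def)
  have "(a = qi \<or> a = inverse qi) \<and> (b = qj \<or> b = inverse qj) \<or>
     qi = qj \<and> (a = qi\<^sup>2 \<and> b = inverse qi \<or> a = (inverse qi)\<^sup>2 \<and> b = qi) \<or>
     qi = qj ^ 3 \<and> (a = inverse qj ^ 3 \<and> b = qj\<^sup>2 \<or> a = qj ^ 3 \<and> b = (inverse qj)\<^sup>2)"
    using ex by (auto simp: exceptional_G2_def Let_def a_def b_def qi_def qj_def power_inverse)
  then consider (scalar) "(a = qi \<or> a = inverse qi) \<and> (b = qj \<or> b = inverse qj)"
    | (equal) "qi = qj" "a = qi\<^sup>2 \<and> b = inverse qi \<or> a = (inverse qi)\<^sup>2 \<and> b = qi"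
    | (cube) "qi = qj ^ 3" "a = inverse qj ^ 3 \<and> b = qj\<^sup>2 \<or> a = qj ^ 3 \<and> b = (inverse qj)\<^sup>2"
    by blast
  then show ?thesis
  proof cases
    case scalar
    then obtain x y where "TT i (e s) = scal x (e s)" "TT j (e s) = scal y (e s)"
      using TT_scalar_R1[OF s ij(1) G2_R1(1)] TT_scalar_R1[OF s ij(2) G2_R1(2)]
      unfolding a_def b_def qi_def qj_def by blast
    then show ?thesis using scalar_braid cox_even[OF ij(1,2) G2_norm] by blast
  next
    case equal
    note q = equal(1) and z = equal(2)
    have "TTw (altw (cox i j) j i) (e s) = TTw (altw (cox i j) i j) (e s)"
    proof (rule two_dim_special[OF s ij(2,1) G2_R1(2,1) g g'(2) G2_cox])
      \<comment> \<open>Only the squares are known to agree, so the two square roots may differ by a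
        sign.\<close>
      have "(qroot D j)\<^sup>2 = (qroot D i)\<^sup>2" using q qr ij by (simp add: qi_def qj_def)
      then show "qroot D j = qroot D i \<or> qroot D j = - qroot D i \<or>
        qroot D j = qroot D i ^ 3 \<or> qroot D j = - (qroot D i ^ 3)"
        unfolding power2_eq_iff by blast
      have "inverse qi * qi\<^sup>2 = qi" "qi * (inverse qi)\<^sup>2 = inverse qi"
        using nz by (simp_all add: power2_eq_square)
      then show "s (coroot (al i)) = (qpar D i)\<^sup>2 \<and> s (coroot (al j)) = inverse (qpar D j) \<and>
          act (sr i) s (coroot (al j)) = qpar D j \<or>
        s (coroot (al i)) = (inverse (qpar D i))\<^sup>2 \<and> s (coroot (al j)) = qpar D j \<and>
          act (sr i) s (coroot (al j)) = inverse (qpar D j)"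
        using z q unfolding b2 a_def[symmetric] b_def[symmetric] qi_def[symmetric] qj_def[symmetric] by auto
    qed
    then show ?thesis by simp
  next
    case cube
    note q = cube(1) and z = cube(2)
    show ?thesis
    proof (rule two_dim_special[OF s ij(1,2) G2_R1(1,2) g(2,1) g'(1) G2_cox])
      have "(qroot D i)\<^sup>2 = (qroot D j ^ 3)\<^sup>2"
        using q qr ij by (simp add: qi_def qj_def flip: power_mult)
      then show "qroot D i = qroot D j \<or> qroot D i = - qroot D j \<or>
        qroot D i = qroot D j ^ 3 \<or> qroot D i = - (qroot D j ^ 3)"
        unfolding power2_eq_iff by blast
      have "inverse qj ^ 3 * (qj\<^sup>2) ^ 3 = qj ^ 3" "qj ^ 3 * ((inverse qj)\<^sup>2) ^ 3 = inverse qj ^ 3"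
        using right_inverse[OF nz(2)] by algebra+
      then show "s (coroot (al j)) = (qpar D j)\<^sup>2 \<and> s (coroot (al i)) = inverse (qpar D i) \<and>
          act (sr j) s (coroot (al i)) = qpar D i \<or>
        s (coroot (al j)) = (inverse (qpar D j))\<^sup>2 \<and> s (coroot (al i)) = qpar D i \<and>
          act (sr j) s (coroot (al i)) = inverse (qpar D i)"
        using z q unfolding a2 a_def[symmetric] b_def[symmetric] qi_def[symmetric] qj_def[symmetric]
        by (auto simp: power_inverse)
    qed
  qed
qed

end

end

section \<open>Principal series of rank two subsystems\<close>

text \<open>Subtracting \<open>\<sigma> k \<mu>\<close> from \<open>f \<mu>\<close> kills
  \<open>y k\<close> modulo \<open>K\<close> and rescales the other terms, \<open>x\<close> by a
  nonzero factor for suitable \<open>\<mu>\<close>. Only the weight of \<open>x\<close> has to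
  differ from the others, which may coincide among themselves.\<close>

lemma (in vector_space) weight_sep:
  assumes K: "subspace K"
    and add: "\<And>\<mu> u v. f \<mu> (u + v) = f \<mu> u + f \<mu> v" and sc: "\<And>\<mu> c u. f \<mu> (scale c u) = scale c (f \<mu> u)"
    and fK: "\<And>\<mu> u. \<mu> \<in> A \<Longrightarrow> u \<in> K \<Longrightarrow> f \<mu> u \<in> K"
    and S: "finite S"
  shows "(\<And>k \<mu>. k \<in> S \<Longrightarrow> \<mu> \<in> A \<Longrightarrow> f \<mu> (y k) - scale (\<sigma> k \<mu>) (y k) \<in> K) \<Longrightarrow>
    (\<And>\<mu>. \<mu> \<in> A \<Longrightarrow> f \<mu> x - scale (\<tau> \<mu>) x \<in> K) \<Longrightarrow>
    (\<And>k. k \<in> S \<Longrightarrow> \<exists>\<mu>\<in>A. \<sigma> k \<mu> \<noteq> \<tau> \<mu>) \<Longrightarrow> x + sum y S \<in> K \<Longrightarrow> x \<in> K"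
  using S
proof (induction S arbitrary: x y rule: finite_induct)
  case (insert k S)
  note y = insert.prems(1) and x = insert.prems(2)
  obtain \<mu> where \<mu>: "\<mu> \<in> A" "\<sigma> k \<mu> \<noteq> \<tau> \<mu>" using insert.prems(3)[of k] by auto
  let ?c = "\<sigma> k \<mu>"
  have f0: "f \<mu> 0 = 0" for \<mu> using sc[of \<mu> 0 0] by simp
  have fsum: "f \<mu> (sum y S) = (\<Sum>l\<in>S. f \<mu> (y l))"
    by (induction S rule: infinite_finite_induct) (auto simp: f0 add)
  have comm: "f \<nu> (scale d v) - scale e (scale d v) = scale d (f \<nu> v - scale e v)" for \<nu> d e v
    by (simp add: sc scale_right_diff_distrib mult.commute)
  have "scale (\<tau> \<mu> - ?c) x \<in> K"
  proof (rule insert.IH)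
    show "f \<nu> (scale (\<sigma> l \<mu> - ?c) (y l)) - scale (\<sigma> l \<nu>) (scale (\<sigma> l \<mu> - ?c) (y l)) \<in> K"
      if "l \<in> S" "\<nu> \<in> A" for l \<nu>
      unfolding comm by (rule subspace_scale[OF K y]) (use that in auto)
    show "f \<nu> (scale (\<tau> \<mu> - ?c) x) - scale (\<tau> \<nu>) (scale (\<tau> \<mu> - ?c) x) \<in> K" if "\<nu> \<in> A" for \<nu>
      unfolding comm by (rule subspace_scale[OF K x[OF that]])
    show "\<exists>\<nu>\<in>A. \<sigma> l \<nu> \<noteq> \<tau> \<nu>" if "l \<in> S" for l using insert.prems(3) that by auto
    let ?t = "x + (y k + sum y S)"
    have t: "?t \<in> K" using insert.prems(4) insert.hyps by simp
    have h1: "f \<mu> ?t - scale ?c ?t \<in> K"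
      by (rule subspace_diff[OF K fK[OF \<mu>(1) t] subspace_scale[OF K t]])
    have h2: "f \<mu> (y k) - scale ?c (y k) \<in> K" by (rule y) (use \<mu> in auto)
    have h3: "(\<Sum>l\<in>S. f \<mu> (y l) - scale (\<sigma> l \<mu>) (y l)) \<in> K"
      by (rule subspace_sum[OF K], rule y) (use \<mu> in auto)
    have "f \<mu> ?t - scale ?c ?t - (f \<mu> (y k) - scale ?c (y k)) - (f \<mu> x - scale (\<tau> \<mu>) x)
        - (\<Sum>l\<in>S. f \<mu> (y l) - scale (\<sigma> l \<mu>) (y l)) \<in> K"
      by (rule subspace_diff[OF K subspace_diff[OF K subspace_diff[OF K h1 h2] x[OF \<mu>(1)]] h3])
    also have "f \<mu> ?t - scale ?c ?t - (f \<mu> (y k) - scale ?c (y k)) - (f \<mu> x - scale (\<tau> \<mu>) x)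
        - (\<Sum>l\<in>S. f \<mu> (y l) - scale (\<sigma> l \<mu>) (y l))
      = scale (\<tau> \<mu> - ?c) x + (\<Sum>l\<in>S. scale (\<sigma> l \<mu> - ?c) (y l))"
      by (simp add: add fsum scale_right_distrib scale_left_diff_distrib sum_subtractf scale_sum_right)
    finally show "scale (\<tau> \<mu> - ?c) x + (\<Sum>l\<in>S. scale (\<sigma> l \<mu> - ?c) (y l)) \<in> K" .
  qed
  then have "scale (inverse (\<tau> \<mu> - ?c)) (scale (\<tau> \<mu> - ?c) x) \<in> K" by (rule subspace_scale[OF K])
  then show ?case using \<mu>(2) by simp
qed simp

context hecke
begin

text \<open>Equivalently, \<open>sr k \<circ> u\<close> is longer than \<open>u\<close>.\<close>

definition up :: "nat \<Rightarrow> ('v \<Rightarrow> 'v) \<Rightarrow> bool" where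
  "up k u \<longleftrightarrow> pos (inv u (al k))"

definition kap_up :: "nat \<Rightarrow> ('v \<Rightarrow> complex) \<Rightarrow> ('v \<Rightarrow> 'v) \<Rightarrow> complex" where
  "kap_up k s u = (if up k u then 1 else kk k (act u s))"

text \<open>Coefficients of the image of the base vector under a word, in the principal series module
  with basis indexed by the chambers, normalised so that upward moves have coefficient 1; then
  all coefficients are polynomial in the values of the c-functions.\<close>

fun ps_coef :: "('v \<Rightarrow> complex) \<Rightarrow> nat list \<Rightarrow> ('v \<Rightarrow> 'v) \<Rightarrow> complex" where
  "ps_coef s [] u = (if u = id then 1 else 0)"
| "ps_coef s (k # is) u = pp k (act u s) * ps_coef s is u + kap_up k s (sr k \<circ> u) * ps_coef s is (sr k \<circ> u)"

lemma up_sr: "u \<in> W0 D \<Longrightarrow> k \<in> idx D \<Longrightarrow> up k (sr k \<circ> u) \<longleftrightarrow> \<not> up k u"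
  by (simp add: up_def pos_inv_sr)

text \<open>A family \<open>b\<close> that satisfies the principal series formulas modulo an
  invariant subspace \<open>K\<close> has its words computed by \<open>ps_coef\<close>. With
  \<open>K\<close> the ideal \<open>weight_ideal s\<close> the family is independent and identities
  between coefficients can be proved; with \<open>K = {0}\<close> in the region many
  \<open>b u\<close> are zero, and the same identities are applied.\<close>

lemma transfer:
  assumes vs: "vector_space sc" and K: "module.subspace sc K"
    and add: "\<And>k u v. f k (u + v) = f k u + f k v" and scl: "\<And>k c u. f k (sc c u) = sc c (f k u)"
    and fK: "\<And>k u. k \<in> I \<Longrightarrow> u \<in> K \<Longrightarrow> f k u \<in> K"
    and I: "I \<subseteq> idx D"
    and b: "\<And>k u. k \<in> I \<Longrightarrow> u \<in> parabolic D I \<Longrightarrow>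
      f k (b u) - (sc (pp k (act u s)) (b u) + sc (kap_up k s u) (b (sr k \<circ> u))) \<in> K"
    and b_id: "b id = b0"
  shows "set is \<subseteq> I \<Longrightarrow> foldr f is b0 - (\<Sum>u\<in>parabolic D I. sc (ps_coef s is u) (b u)) \<in> K"
proof (induction "is")
  interpret vector_space sc by (rule vs)
  let ?W = "parabolic D I"
  have fin: "finite ?W" using finite_W0 I parabolic_W0 by (meson finite_subset subsetI)
  {
    case Nil
    have "(\<Sum>u\<in>?W. sc (ps_coef s [] u) (b u)) = (\<Sum>u\<in>?W. if u = id then b u else 0)"
      by (intro sum.cong) auto
    also have "\<dots> = b0" using fin id_parabolic b_id by simp
    finally show ?case using subspace_0[OF K] by simp
  next
    case (Cons k "is")
    then have k: "k \<in> I" "k \<in> idx D" using I by auto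
    let ?F = "ps_coef s is"
    have f0: "f k 0 = 0" using scl[of k 0 0] by simp
    have fdiff: "f k (u - v) = f k u - f k v" for u v
      using add[of k "u - v" v] by (simp add: algebra_simps)
    have fsum: "f k (sum g A) = (\<Sum>a\<in>A. f k (g a))" for g and A :: "('v \<Rightarrow> 'v) set"
      by (induction A rule: infinite_finite_induct) (auto simp: f0 add)
    have bij: "bij_betw (\<lambda>u. sr k \<circ> u) ?W ?W"
      by (rule bij_betw_byWitness[of _ "\<lambda>u. sr k \<circ> u"])
        (use k comp_parabolic sr_parabolic in \<open>auto simp: sr_comp_sr[OF k(2)]\<close>)
    have r: "(\<Sum>u\<in>?W. sc (?F u * kap_up k s u) (b (sr k \<circ> u))) =
        (\<Sum>u\<in>?W. sc (?F (sr k \<circ> u) * kap_up k s (sr k \<circ> u)) (b u))"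
      using sum.reindex_bij_betw[OF bij, of "\<lambda>u. sc (?F u * kap_up k s u) (b (sr k \<circ> u))"]
      by (simp add: sr_comp_sr[OF k(2)])
    have "f k (foldr f is b0 - (\<Sum>u\<in>?W. sc (?F u) (b u))) +
        (\<Sum>u\<in>?W. sc (?F u) (f k (b u) - (sc (pp k (act u s)) (b u) + sc (kap_up k s u) (b (sr k \<circ> u))))) \<in> K"
      using Cons k by (intro subspace_add[OF K] subspace_sum[OF K] subspace_scale[OF K] fK b) auto
    also have "f k (foldr f is b0 - (\<Sum>u\<in>?W. sc (?F u) (b u))) +
        (\<Sum>u\<in>?W. sc (?F u) (f k (b u) - (sc (pp k (act u s)) (b u) + sc (kap_up k s u) (b (sr k \<circ> u)))))
      = f k (foldr f is b0) - ((\<Sum>u\<in>?W. sc (?F u * pp k (act u s)) (b u)) +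
        (\<Sum>u\<in>?W. sc (?F u * kap_up k s u) (b (sr k \<circ> u))))"
      by (simp add: fdiff fsum scl scale_right_diff_distrib scale_right_distrib sum_subtractf sum.distrib)
    also have "\<dots> = foldr f (k # is) b0 - (\<Sum>u\<in>?W. sc (ps_coef s (k # is) u) (b u))"
      unfolding r by (simp add: scale_left_distrib sum.distrib mult.commute)
    finally show ?case .
  }
qed

definition regular :: "nat set \<Rightarrow> ('v \<Rightarrow> complex) \<Rightarrow> bool" where
  "regular I s \<longleftrightarrow> (\<forall>u\<in>parabolic D I. \<forall>k\<in>I. act u s (coroot (al k)) \<noteq> 1)"

definition free :: "nat set \<Rightarrow> ('v \<Rightarrow> complex) \<Rightarrow> bool" where
  "free I s \<longleftrightarrow> (\<forall>u\<in>parabolic D I. \<forall>u'\<in>parabolic D I. act u s = act u' s \<longrightarrow> u = u')"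

lemma free_act:
  assumes "I \<subseteq> idx D" "u \<in> parabolic D I" "free I s"
  shows "free I (act u s)"
  unfolding free_def
proof (intro ballI impI)
  fix v v' assume v: "v \<in> parabolic D I" "v' \<in> parabolic D I" "act v (act u s) = act v' (act u s)"
  have W: "u \<in> W0 D" "v \<in> W0 D" "v' \<in> W0 D" using parabolic_W0 assms v by auto
  then have "v \<circ> u = v' \<circ> u"
    using assms(2,3) v comp_parabolic unfolding free_def by (metis act_comp)
  then have "v (u (inv u x)) = v' (u (inv u x))" for x by (metis comp_apply)
  then show "v = v'" by (auto simp: W0_inv_apply W(1))
qed

lemma regular_good:
  assumes "I \<subseteq> idx D" "s \<in> characters D" "regular I s" "u \<in> parabolic D I" "k \<in> I"
  shows "good (al k) (act u s)"
  using assms parabolic_W0 by (intro good_if act_char al_R0) (auto simp: regular_def)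

lemma reduced_altw:
  assumes ij: "i \<in> idx D" "j \<in> idx D" "i \<noteq> j" and n: "n \<le> cox i j"
  shows "reduced_word D (altw n i j)"
  using assms
proof (induction n arbitrary: i j)
  case (Suc n)
  have "reduced_word D (altw n j i)" using Suc cox_sym by (intro Suc.IH) auto
  moreover have "pos (inv (we (altw n j i)) (al i))"
    unfolding inv_word[OF altw_idx[OF Suc.prems(2,1)]] rev_altw
    using dihedral_pos[of i j n] dihedral_pos[of j i n] Suc.prems cox_sym[of i j]
    by (auto simp: letter_def)
  ultimately show ?case using Suc.prems by (simp add: reduced_Cons)
qed (simp add: reduced_Nil)

end

section \<open>Weight vectors and intertwiners modulo a left ideal\<close>

locale hecke_alg = hecke D
  for D :: "'v::euclidean_space hecke_data" +
  fixes sH :: "complex \<Rightarrow> 'h::ring_1 \<Rightarrow> 'h" and T :: "nat \<Rightarrow> 'h" and Tw :: "('v \<Rightarrow> 'v) \<Rightarrow> 'h"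
    and X :: "'v \<Rightarrow> 'h"
  assumes aha: "affine_hecke_algebra D sH T Tw X"
begin

sublocale H: vector_space sH
  using aha unfolding affine_hecke_algebra_def complex_algebra_def by blast

lemma sH_mult_all: "\<forall>c a b. sH c a * b = sH c (a * b) \<and> a * sH c b = sH c (a * b)"
  using aha unfolding affine_hecke_algebra_def complex_algebra_def by (elim conjE)

lemma sH_mult: "sH c a * b = sH c (a * b)" "a * sH c b = sH c (a * b)"
  by (rule sH_mult_all[rule_format, THEN conjunct1], rule sH_mult_all[rule_format, THEN conjunct2])

lemma T_quad_all: "\<forall>i\<in>idx D. T i * T i = 1 + sH (zz i) (T i)"
  and T_braid_all: "\<forall>i\<in>idx D. \<forall>j\<in>idx D. i \<noteq> j \<longrightarrow>
        alt_prod (cox i j) (T i) (T j) = alt_prod (cox i j) (T j) (T i)"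
  and X_0: "X 0 = 1"
  and X_mult_all: "\<forall>\<mu>\<in>L. \<forall>\<nu>\<in>L. X \<mu> * X \<nu> = X (\<mu> + \<nu>)"
  and Tw_word_all: "\<forall>is. reduced_word D is \<longrightarrow> Tw (we is) = prod_list (map T is)"
  and T_cross_all: "\<forall>i\<in>idx D. \<forall>\<mu>\<in>L. \<exists>p\<in>group_alg D.
        p * c_den (al i) = c'_num D (al i) * (xpow \<mu> - xpow (sr i \<mu>)) \<and>
        T i * X \<mu> - X (sr i \<mu>) * T i = sH (qroot D i) (ga_embed sH X p)"
  and basis_inj: "inj_on (\<lambda>(w, \<mu>). Tw w * X \<mu>) (W0 D \<times> L)"
  and basis_indep: "H.independent ((\<lambda>(w, \<mu>). Tw w * X \<mu>) ` (W0 D \<times> L))"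
  and basis_span: "H.span ((\<lambda>(w, \<mu>). Tw w * X \<mu>) ` (W0 D \<times> L)) = UNIV"
  using aha unfolding affine_hecke_algebra_def by - (elim conjE, assumption)+

lemma T_quad: "i \<in> idx D \<Longrightarrow> T i * T i = 1 + sH (zz i) (T i)"
  and X_mult: "\<mu> \<in> L \<Longrightarrow> \<nu> \<in> L \<Longrightarrow> X \<mu> * X \<nu> = X (\<mu> + \<nu>)"
  and Tw_word: "reduced_word D is \<Longrightarrow> Tw (we is) = prod_list (map T is)"
  by (erule T_quad_all[rule_format], erule X_mult_all[rule_format], assumption,
      erule Tw_word_all[rule_format])

lemma T_cross: "i \<in> idx D \<Longrightarrow> \<mu> \<in> L \<Longrightarrow> \<exists>p\<in>group_alg D.
        p * c_den (al i) = c'_num D (al i) * (xpow \<mu> - xpow (sr i \<mu>)) \<and>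
        T i * X \<mu> - X (sr i \<mu>) * T i = sH (qroot D i) (ga_embed sH X p)"
  by (rule bspec[OF bspec[OF T_cross_all]])

definition pbw_basis :: "'h set" where "pbw_basis = (\<lambda>(w, \<mu>). Tw w * X \<mu>) ` (W0 D \<times> L)"

lemma pbw_basis_inj: "inj_on (\<lambda>(w, \<mu>). Tw w * X \<mu>) (W0 D \<times> L)"
  and pbw_basis_indep: "H.independent pbw_basis" and pbw_basis_span: "H.span pbw_basis = UNIV"
  unfolding pbw_basis_def by (rule basis_inj basis_indep basis_span)+

definition Tl :: "nat list \<Rightarrow> 'h" where "Tl is = prod_list (map T is)"

lemma Tl_simps: "Tl [] = 1" "Tl (i # is) = T i * Tl is" "Tl (is @ js) = Tl is * Tl js"
  by (simp_all add: Tl_def)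

lemma Tl_eq: "reduced_word D is \<Longrightarrow> reduced_word D js \<Longrightarrow> we is = we js \<Longrightarrow> Tl is = Tl js"
  using Tw_word by (metis Tl_def)

lemma T_braid:
  assumes "i \<in> idx D" "j \<in> idx D"
  shows "Tl (altw (cox i j) i j) = Tl (altw (cox i j) j i)"
proof (cases "i = j")
  case False
  then have "alt_prod (cox i j) (T i) (T j) = alt_prod (cox i j) (T j) (T i)"
    by (rule T_braid_all[rule_format, OF assms])
  then show ?thesis by (simp add: Tl_def alt_prod_altw)
qed simp

text \<open>The left ideal modulo which the unit is a weight vector of weight s; the quotient is the
  principal series module.\<close>

definition weight_ideal :: "('v \<Rightarrow> complex) \<Rightarrow> 'h set" where
  "weight_ideal s = H.span {h * (X \<mu> - sH (s \<mu>) 1) | h \<mu>. \<mu> \<in> L}"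

lemma weight_ideal_subspace: "H.subspace (weight_ideal s)"
  by (simp add: weight_ideal_def)

lemma weight_ideal_mult: "x \<in> weight_ideal s \<Longrightarrow> h * x \<in> weight_ideal s"
  unfolding weight_ideal_def
proof (induction rule: H.span_induct_alt)
  case (step c x y)
  obtain h' \<mu> where x: "x = h' * (X \<mu> - sH (s \<mu>) 1)" "\<mu> \<in> L" using step(1) by auto
  have "h * x = (h * h') * (X \<mu> - sH (s \<mu>) 1)" by (simp add: x mult.assoc)
  then have "h * x \<in> H.span {h * (X \<mu> - sH (s \<mu>) 1) | h \<mu>. \<mu> \<in> L}"
    using x(2) by (intro H.span_base) blast
  then have "sH c (h * x) + h * y \<in> H.span {h * (X \<mu> - sH (s \<mu>) 1) | h \<mu>. \<mu> \<in> L}"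
    using step by (intro H.span_add H.span_scale)
  then show ?case by (simp add: distrib_left sH_mult)
qed (simp add: H.span_zero)

text \<open>In the quotient by \<open>weight_ideal s\<close>, the class of \<open>x\<close> is zero
  or a weight vector of weight \<open>s'\<close>.\<close>

definition weight_mod :: "('v \<Rightarrow> complex) \<Rightarrow> 'h \<Rightarrow> ('v \<Rightarrow> complex) \<Rightarrow> bool" where
  "weight_mod s x s' \<longleftrightarrow> (\<forall>\<mu>\<in>L. X \<mu> * x - sH (s' \<mu>) x \<in> weight_ideal s)"

lemma weight_mod_1: "weight_mod s 1 s"
  unfolding weight_mod_def weight_ideal_def by (auto intro!: H.span_base exI[of _ 1])

lemma weight_mod_ga:
  assumes "weight_mod s x s'" "p \<in> group_alg D"
  shows "ga_embed sH X p * x - sH (ga_eval p s') x \<in> weight_ideal s"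
proof -
  have "ga_embed sH X p * x - sH (ga_eval p s') x =
      (\<Sum>\<mu>\<in>Poly_Mapping.keys p. sH (Poly_Mapping.lookup p \<mu>) (X \<mu> * x - sH (s' \<mu>) x))"
    unfolding ga_embed_def ga_eval_def sum_distrib_right sH_mult(1) H.scale_sum_left
      H.scale_right_diff_distrib sum_subtractf H.scale_scale ..
  also have "\<dots> \<in> weight_ideal s"
    using assms by (intro H.subspace_sum weight_ideal_subspace H.subspace_scale)
      (auto simp: weight_mod_def group_alg_def)
  finally show ?thesis .
qed

text \<open>The usual intertwining operator, left unnormalised so that it is available wherever c
  has no pole, including the zeros of c.\<close>

definition tau :: "nat \<Rightarrow> ('v \<Rightarrow> complex) \<Rightarrow> 'h \<Rightarrow> 'h" where
  "tau i s x = T i * x - sH (pp i s) x"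

lemma tau_weight_mod:
  assumes x: "weight_mod s x s'" and s': "s' \<in> characters D" and i: "i \<in> idx D" and g: "good (al i) s'"
  shows "weight_mod s (tau i s' x) (act (sr i) s')"
  unfolding weight_mod_def
proof
  fix \<mu> assume \<mu>: "\<mu> \<in> L"
  \<comment> \<open>The cross relation for \<open>\<mu>'\<close> is the one in which
    \<open>X \<mu>\<close> stands to the left of \<open>T i\<close>.\<close>
  define \<mu>' where "\<mu>' = sr i \<mu>"
  have \<mu>': "\<mu>' \<in> L" "sr i \<mu>' = \<mu>" using \<mu> i by (simp_all add: \<mu>'_def sr_L sr_sr)
  obtain p where p: "p \<in> group_alg D"
      "p * c_den (al i) = c'_num D (al i) * (xpow \<mu>' - xpow (sr i \<mu>'))"
      "T i * X \<mu>' - X \<mu> * T i = sH (qroot D i) (ga_embed sH X p)"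
    using T_cross[OF i \<mu>'(1)] \<mu>'(2) by metis
  have e: "qroot D i * ga_eval p s' = pp i s' * (s' \<mu>' - s' \<mu>)"
    using ga_eval_cross[OF s' i g \<mu>'(1) p(1,2)] c'_val_cv[OF s' i g] by (simp add: \<mu>' pp_def)
  have XT: "X \<mu> * T i = T i * X \<mu>' - sH (qroot D i) (ga_embed sH X p)"
    using p(3) by (simp add: algebra_simps)
  have a: "act (sr i) s' \<mu> = s' \<mu>'" by (simp add: act_sr_apply i \<mu>'_def)
  have "T i * (X \<mu>' * x - sH (s' \<mu>') x) - sH (qroot D i) (ga_embed sH X p * x - sH (ga_eval p s') x)
      - sH (pp i s') (X \<mu> * x - sH (s' \<mu>) x) \<in> weight_ideal s"
    using x \<mu> \<mu>'(1) unfolding weight_mod_def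
    by (intro H.subspace_diff[OF weight_ideal_subspace H.subspace_diff[OF weight_ideal_subspace weight_ideal_mult
          H.subspace_scale[OF weight_ideal_subspace weight_mod_ga[OF x p(1)]]] H.subspace_scale[OF weight_ideal_subspace]]) auto
  also have "T i * (X \<mu>' * x - sH (s' \<mu>') x) - sH (qroot D i) (ga_embed sH X p * x - sH (ga_eval p s') x)
      - sH (pp i s') (X \<mu> * x - sH (s' \<mu>) x)
    = X \<mu> * tau i s' x - sH (s' \<mu>') (T i * x) + sH (qroot D i * ga_eval p s') x + sH (pp i s' * s' \<mu>) x"
    by (simp add: tau_def right_diff_distrib left_diff_distrib sH_mult XT mult.assoc[symmetric]
        H.scale_right_diff_distrib)
  also have "\<dots> = X \<mu> * tau i s' x - sH (s' \<mu>') (tau i s' x)"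
    unfolding e by (simp add: tau_def H.scale_right_diff_distrib H.scale_left_diff_distrib algebra_simps)
  finally show "X \<mu> * tau i s' x - sH (act (sr i) s' \<mu>) (tau i s' x) \<in> weight_ideal s" by (simp add: a)
qed

text \<open>By the quadratic relation the generator leads back from the intertwined vector with
  coefficient \<open>kk\<close>, which is the downward coefficient in \<open>kap_up\<close>.\<close>

lemma T_tau:
  assumes s: "s \<in> characters D" and i: "i \<in> idx D" and g: "good (al i) s"
  shows "T i * tau i s y = sH (pp i (act (sr i) s)) (tau i s y) + sH (kk i (act (sr i) s)) y"
proof -
  have "T i * tau i s y = y + sH (zz i - pp i s) (T i * y)"
  proof -
    have "T i * (T i * y) = (1 + sH (zz i) (T i)) * y"
      unfolding mult.assoc[symmetric] T_quad[OF i] ..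
    also have "\<dots> = y + sH (zz i) (T i * y)" by (simp only: distrib_right sH_mult mult_1)
    finally show ?thesis
      by (simp add: tau_def right_diff_distrib sH_mult H.scale_left_diff_distrib)
  qed
  also have "\<dots> = sH (zz i - pp i s) (tau i s y) + sH (1 + zz i * pp i s - (pp i s)\<^sup>2) y"
    by (simp add: tau_def H.scale_right_diff_distrib H.scale_left_diff_distrib H.scale_left_distrib
        left_diff_distrib power2_eq_square algebra_simps)
  finally show ?thesis by (simp add: pp_sr[OF s i g] kk_sr[OF i] kk_eq[OF s i g])
qed

fun tauw :: "('v \<Rightarrow> complex) \<Rightarrow> nat list \<Rightarrow> 'h \<Rightarrow> 'h" where
  "tauw s [] x = x"
| "tauw s (i # is) x = tau i (act (we is) s) (tauw s is x)"

lemma tauw_append: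
  "set is \<subseteq> idx D \<Longrightarrow> set js \<subseteq> idx D \<Longrightarrow> tauw s (is @ js) x = tauw (act (we js) s) is (tauw s js x)"
  by (induction "is") (auto simp: word_elt_append act_comp word_W0)

context
  fixes I :: "nat set" and s0 :: "'v \<Rightarrow> complex"
  assumes I: "I \<subseteq> idx D" and s0: "s0 \<in> characters D" and reg: "regular I s0" and fre: "free I s0"
begin

lemma tauw_weight_mod:
  assumes "u \<in> parabolic D I" "s = act u s0" "weight_mod s0 x s" "set is \<subseteq> I"
  shows "weight_mod s0 (tauw s is x) (act (we is) s)"
  using assms(4)
proof (induction "is")
  case (Cons k "is")
  have W: "u \<in> W0 D" "we is \<in> W0 D" "sr k \<in> W0 D"
    using assms(1) Cons.prems I parabolic_W0 word_W0 W0_sr by auto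
  have "good (al k) (act (we is \<circ> u) s0)"
    using Cons.prems assms(1) by (intro regular_good[OF I s0 reg] comp_parabolic parabolicI) auto
  then have g: "good (al k) (act (we is) s)" by (simp add: assms(2) act_comp W)
  have "act (we is) s \<in> characters D" using act_char W s0 assms(2) by simp
  then have "weight_mod s0 (tau k (act (we is) s) (tauw s is x)) (act (sr k) (act (we is) s))"
    using Cons g I by (intro tau_weight_mod) auto
  then show ?case unfolding word_elt_Cons act_comp[OF W(3,2)] by simp
qed (use assms in simp)

text \<open>Both sides are weight vectors of the same weight. Expanding T-words in intertwiner
  words, the braid relation shows that they differ, modulo the ideal, by a combination of strictly
  shorter alternating words. These belong to other group elements, hence to other weights as
  \<open>s0\<close> is free, so \<open>weight_sep\<close> puts the difference into the
  ideal.\<close>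

lemma tauw_braid:
  assumes u: "u \<in> parabolic D I" "s = act u s0" "weight_mod s0 x s"
    and ij: "i \<in> I" "j \<in> I" "i \<noteq> j"
  shows "tauw s (altw (cox i j) i j) x - tauw s (altw (cox i j) j i) x \<in> weight_ideal s0"
proof -
  let ?m = "cox i j"
  have ix: "i \<in> idx D" "j \<in> idx D" using ij I by auto
  have altI: "set (altw n i j) \<subseteq> I" "set (altw n j i) \<subseteq> I" for n using set_altw ij by blast+
  have W: "we is \<in> W0 D" if "set is \<subseteq> I" for "is" using word_W0 I that by blast
  have uW: "u \<in> W0 D" using u(1) I parabolic_W0 by blast
  define Z where "Z = (\<lambda>n. {tauw s (altw k a b) x | k a b. k < n \<and> (a = i \<and> b = j \<or> a = j \<and> b = i)})"
  \<comment> \<open>Being congruent modulo \<open>Y n\<close> means agreement up to the ideal and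
    intertwined vectors of alternating length below \<open>n\<close>. A generator raises
    \<open>n\<close> by at most one.\<close>
  define Y where "Y = (\<lambda>n. H.span (weight_ideal s0 \<union> Z n))"
  have Zmono: "Z n \<subseteq> Z (Suc n)" for n by (force simp: Z_def)
  have Ymono: "Y n \<subseteq> Y (Suc n)" for n unfolding Y_def by (rule H.span_mono) (use Zmono in blast)
  have inY: "tauw s (altw k a b) x \<in> Y n" if "k < n" "a = i \<and> b = j \<or> a = j \<and> b = i" for k n a b
    unfolding Y_def by (rule H.span_base) (use that in \<open>auto simp: Z_def\<close>)
  have tauT: "T a * y = tau a s' y + sH (pp a s') y" for a s' y by (simp add: tau_def)
  have TY: "T a * y \<in> Y (Suc n)" if y: "y \<in> Y n" and a: "a \<in> {i, j}" for a y n
    using y unfolding Y_def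
  proof (induction rule: H.span_induct_alt)
    case base
    show ?case using H.span_zero by simp
  next
    case (step c z y)
    have "T a * z \<in> Y (Suc n)"
    proof (cases "z \<in> weight_ideal s0")
      case True
      then show ?thesis unfolding Y_def by (intro H.span_base UnI1 weight_ideal_mult)
    next
      case False
      then obtain k b c where z: "z = tauw s (altw k b c) x" "k < n" "b = i \<and> c = j \<or> b = j \<and> c = i"
        using step(1) by (auto simp: Z_def)
      show ?thesis
      \<comment> \<open>A generator that repeats the first letter leads back by
        \<open>T_tau\<close>; any other one lengthens the word. For \<open>k = 0\<close> there is no
        first letter, and both generators lengthen.\<close>
      proof (cases "a = b \<and> k \<noteq> 0")
        case False
        have "T a * z \<in> Y (Suc n)" if "a = c"
        proof -
          have "tau a (act (we (altw k b c)) s) z = tauw s (altw (Suc k) c b) x"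
            using that by (simp add: z(1))
          then show ?thesis
            unfolding tauT[of a z "act (we (altw k b c)) s"] Y_def
            using inY[of "Suc k" "Suc n" c b] inY[of k "Suc n" b c] z(2,3)
            unfolding Y_def z(1)[symmetric] by (intro H.span_add H.span_scale) (auto simp only:)
        qed
        moreover have "T a * z \<in> Y (Suc n)" if "a = b" "k = 0"
        proof -
          have "tau a s z = tauw s (altw (Suc 0) b c) x" using that by (simp add: z(1))
          then show ?thesis
            unfolding tauT[of a z s] Y_def
            using inY[of "Suc 0" "Suc n" b c] inY[of k "Suc n" b c] z(2,3)
            unfolding Y_def z(1)[symmetric] by (intro H.span_add H.span_scale) (auto simp only:)
        qed
        ultimately show ?thesis using False z(3) a by auto
      next
        case True
        then obtain k' where k': "k = Suc k'" by (cases k) auto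
        define s' where "s' = act (we (altw k' c b)) s"
        have aI: "a \<in> I" "a \<in> idx D" using a ij ix by auto
        have alt': "set (altw k' c b) \<subseteq> I" using altI z(3) by auto
        have "s' = act (we (altw k' c b) \<circ> u) s0" using u(2) W[OF alt'] uW by (simp add: s'_def act_comp)
        moreover have "we (altw k' c b) \<circ> u \<in> parabolic D I" using comp_parabolic parabolicI alt' u(1) by blast
        ultimately have s': "s' \<in> characters D" "good (al a) s'"
          using regular_good[OF I s0 reg _ aI(1)] act_char s0 parabolic_W0[OF I] by auto
        have zt: "z = tau a s' (tauw s (altw k' c b) x)" using True by (simp add: z(1) k' s'_def)
        have "T a * z = sH (pp a (act (sr a) s')) z + sH (kk a (act (sr a) s')) (tauw s (altw k' c b) x)"
          unfolding zt by (rule T_tau[OF s'(1) aI(2) s'(2)])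
        moreover have "z \<in> Y (Suc n)" using inY[of k "Suc n" b c] z(2,3) unfolding z(1) by auto
        moreover have "tauw s (altw k' c b) x \<in> Y (Suc n)" using inY[of k' "Suc n" c b] z(2,3) k' by auto
        ultimately show ?thesis unfolding Y_def by (simp add: H.span_add H.span_scale)
      qed
    qed
    then have "sH c (T a * z) + T a * y \<in> Y (Suc n)"
      using step(2) unfolding Y_def by (intro H.span_add H.span_scale)
    then show ?case by (simp add: distrib_left sH_mult Y_def)
  qed
  have exp: "Tl (altw n a b) * x - tauw s (altw n a b) x \<in> Y n" if "a = i \<and> b = j \<or> a = j \<and> b = i" for n a b
    using that
  proof (induction n arbitrary: a b)
    case 0
    then show ?case by (simp add: Tl_simps Y_def H.span_zero)
  next
    case (Suc n)
    let ?y = "tauw s (altw n b a) x" and ?s = "act (we (altw n b a)) s"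
    have "T a * (Tl (altw n b a) * x - ?y) \<in> Y (Suc n)"
      using Suc by (intro TY) auto
    moreover have "sH (pp a ?s) ?y \<in> Y (Suc n)"
      using inY[of n "Suc n" b a] Suc.prems unfolding Y_def by (intro H.span_scale) auto
    ultimately have "T a * (Tl (altw n b a) * x - ?y) + sH (pp a ?s) ?y \<in> Y (Suc n)"
      unfolding Y_def by (rule H.span_add)
    then show ?case
      by (simp add: Tl_simps tau_def right_diff_distrib mult.assoc diff_diff_eq2 diff_add_eq)
  qed
  let ?d = "tauw s (altw ?m i j) x - tauw s (altw ?m j i) x"
  have "(Tl (altw ?m j i) * x - tauw s (altw ?m j i) x) - (Tl (altw ?m i j) * x - tauw s (altw ?m i j) x) \<in> Y ?m"
    unfolding Y_def by (rule H.span_diff) (use exp[of _ _ ?m] in \<open>auto simp: Y_def\<close>)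
  then have "?d \<in> Y ?m" using T_braid[OF ix] by simp
  then obtain \<kappa> z where \<kappa>: "\<kappa> \<in> weight_ideal s0" "z \<in> H.span (Z ?m)" "?d = \<kappa> + z"
    unfolding Y_def H.span_Un using H.span_eq_iff[THEN iffD2, OF weight_ideal_subspace] by auto
  then obtain S r where S: "finite S" "S \<subseteq> Z ?m" "z = (\<Sum>a\<in>S. sH (r a) a)"
    by (auto simp: H.span_explicit)
  have Zw: "\<exists>v\<in>parabolic D I. weight_mod s0 a (act v s) \<and> v \<noteq> we (altw ?m i j)" if az: "a \<in> Z ?m" for a
  proof -
    obtain k b c where a: "a = tauw s (altw k b c) x" "k < ?m" "b = i \<and> c = j \<or> b = j \<and> c = i"
      using az by (auto simp: Z_def)
    have bc: "set (altw k b c) \<subseteq> I" using altI a(3) by auto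
    \<comment> \<open>Length distinguishes the group elements: the full alternating word is reduced,
      and the others have fewer letters.\<close>
    have "len (we (altw ?m i j)) = ?m" using reduced_altw[OF ix ij(3), of ?m] by (simp add: reduced_iff)
    moreover have "len (we (altw k b c)) \<le> k" using len_le[of "altw k b c"] bc I by auto
    ultimately have "we (altw k b c) \<noteq> we (altw ?m i j)" using a(2) by auto
    then show ?thesis using tauw_weight_mod[OF u bc] parabolicI[OF bc] a(1) by blast
  qed
  then obtain v where v: "\<And>a. a \<in> Z ?m \<Longrightarrow> v a \<in> parabolic D I \<and> weight_mod s0 a (act (v a) s) \<and> v a \<noteq> we (altw ?m i j)"
    by metis
  let ?w = "we (altw ?m i j)"
  have wP: "?w \<in> parabolic D I" by (rule parabolicI[OF altI(1)])
  have fs: "free I s" using free_act[OF I u(1) fre] u(2) by simp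
  have sc: "s \<in> characters D" using act_char uW s0 u(2) by simp
  show ?thesis
  proof (rule H.weight_sep[where f = "\<lambda>\<mu> h. X \<mu> * h" and A = L and S = S
        and y = "\<lambda>a. - sH (r a) a" and \<sigma> = "\<lambda>a. act (v a) s" and \<tau> = "act ?w s"])
    show "X \<mu> * (- sH (r a) a) - sH (act (v a) s \<mu>) (- sH (r a) a) \<in> weight_ideal s0" if "a \<in> S" "\<mu> \<in> L" for a \<mu>
    proof -
      have "sH (- r a) (X \<mu> * a - sH (act (v a) s \<mu>) a) \<in> weight_ideal s0"
        using v[of a] that S(2) by (intro H.subspace_scale weight_ideal_subspace) (auto simp: weight_mod_def)
      then show ?thesis by (simp add: H.scale_right_diff_distrib sH_mult mult.commute)
    qed
    show "X \<mu> * ?d - sH (act ?w s \<mu>) ?d \<in> weight_ideal s0" if "\<mu> \<in> L" for \<mu>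
    proof -
      have "(X \<mu> * tauw s (altw ?m i j) x - sH (act ?w s \<mu>) (tauw s (altw ?m i j) x)) -
        (X \<mu> * tauw s (altw ?m j i) x - sH (act ?w s \<mu>) (tauw s (altw ?m j i) x)) \<in> weight_ideal s0"
        by (rule H.subspace_diff[OF weight_ideal_subspace])
          (use tauw_weight_mod[OF u altI(1), of ?m] tauw_weight_mod[OF u altI(2), of ?m] word_cox[OF ix] that
            in \<open>auto simp only: weight_mod_def\<close>)
      then show ?thesis by (simp add: right_diff_distrib H.scale_right_diff_distrib algebra_simps)
    qed
    show "\<exists>\<mu>\<in>L. act (v a) s \<mu> \<noteq> act ?w s \<mu>" if "a \<in> S" for a
    proof (rule ccontr)
      assume "\<not> ?thesis"
      then have "act (v a) s = act ?w s"
        using v[of a] that S(2) wP sc parabolic_W0[OF I] by (intro char_eqI act_char) auto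
      then show False using v[of a] that S(2) fs wP by (auto simp: free_def)
    qed
    show "?d + (\<Sum>a\<in>S. - sH (r a) a) \<in> weight_ideal s0" using \<kappa> S by (simp add: sum_negf)
  qed (use S weight_ideal_subspace weight_ideal_mult in \<open>auto simp: distrib_left sH_mult\<close>)
qed

end

end

section \<open>Independence in the quotient, and the braid identity between coefficients\<close>

context hecke_alg
begin

definition lower :: "nat \<Rightarrow> 'h set" where
  "lower n = H.span {Tl js | js. reduced_word D js \<and> length js < n}"

lemma lower_mono: "m \<le> n \<Longrightarrow> lower m \<subseteq> lower n"
  unfolding lower_def by (rule H.span_mono) force

lemma Tl_lower: "reduced_word D js \<Longrightarrow> length js < n \<Longrightarrow> Tl js \<in> lower n"
  unfolding lower_def by (rule H.span_base) blast

lemma T_descent: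
  assumes js: "reduced_word D js" and i: "i \<in> idx D" and d: "\<not> pos (inv (we js) (al i))"
  obtains ks where "reduced_word D ks" "we ks = sr i \<circ> we js" "length js = Suc (length ks)"
    "Tl js = T i * Tl ks"
proof -
  have W: "we js \<in> W0 D" using js word_W0 by (simp add: reduced_iff)
  obtain ks where ks: "reduced_word D ks" "we ks = sr i \<circ> we js"
    using reduced_ex[OF W0_comp[OF W0_sr[OF i] W]] by metis
  have "pos (inv (we ks) (al i))" unfolding ks(2) using pos_inv_sr[OF W i] d by simp
  then have r: "reduced_word D (i # ks)" using ks i by (simp add: reduced_Cons)
  have e: "we (i # ks) = we js" by (simp only: word_elt_Cons ks(2) sr_comp_sr[OF i])
  have "Tl js = T i * Tl ks" using Tl_eq[OF js r] e by (simp add: Tl_simps)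
  moreover have "length js = Suc (length ks)" using js r e unfolding reduced_iff by (metis length_Cons)
  ultimately show ?thesis using that ks by blast
qed

lemma T_lower: assumes "z \<in> lower n" "i \<in> idx D" shows "T i * z \<in> lower (Suc n)"
  using assms(1) unfolding lower_def
proof (induction rule: H.span_induct_alt)
  case base
  show ?case using H.span_zero by simp
next
  case (step c x y)
  then obtain js where js: "x = Tl js" "reduced_word D js" "length js < n" by blast
  have "T i * x \<in> lower (Suc n)"
  proof (cases "pos (inv (we js) (al i))")
    case True
    then have "reduced_word D (i # js)" using js assms(2) by (simp add: reduced_Cons)
    then show ?thesis using Tl_lower[of "i # js" "Suc n"] js by (simp add: Tl_simps)
  next
    case False
    then obtain ks where ks: "reduced_word D ks" "length js = Suc (length ks)" "Tl js = T i * Tl ks"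
      using T_descent[OF js(2) assms(2)] by metis
    have "T i * x = (1 + sH (zz i) (T i)) * Tl ks"
      unfolding js(1) ks(3) mult.assoc[symmetric] T_quad[OF assms(2)] ..
    also have "\<dots> = Tl ks + sH (zz i) (Tl js)"
      by (simp only: distrib_right sH_mult mult_1 ks(3))
    also have "\<dots> \<in> lower (Suc n)"
      using Tl_lower[OF ks(1), of "Suc n"] Tl_lower[OF js(2), of "Suc n"] js(3) ks(2)
      unfolding lower_def by (intro H.span_add H.span_scale) auto
    finally show ?thesis .
  qed
  then have "sH c (T i * x) + T i * y \<in> lower (Suc n)"
    using step(2) unfolding lower_def by (intro H.span_add H.span_scale)
  then show ?case by (simp add: distrib_left sH_mult lower_def)
qed

text \<open>An intertwiner differs from its generator by a scalar only, so the intertwined vectors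
  are unitriangular with respect to words ordered by length.\<close>

lemma tauw_leading: "reduced_word D is \<Longrightarrow> tauw s is 1 - Tl is \<in> lower (length is)"
proof (induction "is")
  case Nil
  show ?case by (simp add: Tl_simps lower_def H.span_zero)
next
  case (Cons i "is")
  then have r: "reduced_word D is" "i \<in> idx D" by (simp_all add: reduced_Cons)
  let ?y = "tauw s is 1" and ?n = "length is"
  have z: "?y - Tl is \<in> lower ?n" using Cons.IH r by simp
  have "T i * (?y - Tl is) - (sH (pp i (act (we is) s)) (?y - Tl is) + sH (pp i (act (we is) s)) (Tl is))
      \<in> lower (Suc ?n)"
  proof -
    have "?y - Tl is \<in> lower (Suc ?n)" using z lower_mono[of ?n "Suc ?n"] by auto
    moreover have "Tl is \<in> lower (Suc ?n)" using Tl_lower[OF r(1)] by simp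
    ultimately show ?thesis
      using T_lower[OF z r(2)] unfolding lower_def
      by (metis (no_types, lifting) H.span_add H.span_diff H.span_scale)
  qed
  also have "T i * (?y - Tl is) - (sH (pp i (act (we is) s)) (?y - Tl is) + sH (pp i (act (we is) s)) (Tl is))
    = tauw s (i # is) 1 - Tl (i # is)"
    by (simp add: tau_def Tl_simps right_diff_distrib H.scale_right_diff_distrib algebra_simps)
  finally show ?case by simp
qed

text \<open>The coefficient of \<open>Tw u\<close> after specialising the lattice part on the right
  to the character \<open>s\<close>. Such functionals vanish on \<open>weight_ideal s\<close> and so
  detect nonzero classes in the quotient.\<close>

lemma ex_functional:
  assumes s: "s \<in> characters D" and u: "u \<in> W0 D"
  obtains \<phi> :: "'h \<Rightarrow> complex" where "\<And>x y. \<phi> (x + y) = \<phi> x + \<phi> y" "\<And>c x. \<phi> (sH c x) = c * \<phi> x"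
    "\<And>w \<mu>. w \<in> W0 D \<Longrightarrow> \<mu> \<in> L \<Longrightarrow> \<phi> (Tw w * X \<mu>) = (if w = u then s \<mu> else 0)"
proof -
  interpret C: vector_space "(*) :: complex \<Rightarrow> complex \<Rightarrow> complex"
    by unfold_locales (auto simp: algebra_simps)
  interpret P: vector_space_pair sH "(*) :: complex \<Rightarrow> complex \<Rightarrow> complex" ..
  define g where "g = (\<lambda>b. case inv_into (W0 D \<times> L) (\<lambda>(w, \<mu>). Tw w * X \<mu>) b of
    (w, \<mu>) \<Rightarrow> if w = u then s \<mu> else 0)"
  obtain \<phi> where \<phi>: "Vector_Spaces.linear sH (*) \<phi>" "\<And>b. b \<in> pbw_basis \<Longrightarrow> \<phi> b = g b"
    using P.linear_independent_extend[OF pbw_basis_indep, of g] by auto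
  interpret \<phi>: Vector_Spaces.linear sH "(*)" \<phi> by (rule \<phi>(1))
  show ?thesis
  proof
    show "\<phi> (x + y) = \<phi> x + \<phi> y" for x y by (rule \<phi>.add)
    show "\<phi> (sH c x) = c * \<phi> x" for c x by (rule \<phi>.scale)
    show "\<phi> (Tw w * X \<mu>) = (if w = u then s \<mu> else 0)" if "w \<in> W0 D" "\<mu> \<in> L" for w \<mu>
    proof -
      have "Tw w * X \<mu> \<in> pbw_basis" using that by (force simp: pbw_basis_def)
      moreover have "inv_into (W0 D \<times> L) (\<lambda>(w, \<mu>). Tw w * X \<mu>) (Tw w * X \<mu>) = (w, \<mu>)"
        using inv_into_f_f[OF pbw_basis_inj, of "(w, \<mu>)"] that by simp
      ultimately show ?thesis by (simp add: \<phi>(2) g_def)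
    qed
  qed
qed

text \<open>The functional belonging to \<open>we is\<close> has value 1 on the leading term and 0
  on all shorter terms and on the ideal.\<close>

lemma tauw_nonzero:
  assumes s: "s \<in> characters D" and r: "reduced_word D is"
  shows "tauw s is 1 \<notin> weight_ideal s"
proof
  assume K: "tauw s is 1 \<in> weight_ideal s"
  define u where "u = we is"
  have u: "u \<in> W0 D" using r word_W0 by (simp add: u_def reduced_iff)
  obtain \<phi> :: "'h \<Rightarrow> complex" where \<phi>: "\<And>x y. \<phi> (x + y) = \<phi> x + \<phi> y" "\<And>c x. \<phi> (sH c x) = c * \<phi> x"
    "\<And>w \<mu>. w \<in> W0 D \<Longrightarrow> \<mu> \<in> L \<Longrightarrow> \<phi> (Tw w * X \<mu>) = (if w = u then s \<mu> else 0)"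
    using ex_functional[OF s u] by metis
  have \<phi>0: "\<phi> 0 = 0" using \<phi>(2)[of 0 0] by simp
  have \<phi>d: "\<phi> (x - y) = \<phi> x - \<phi> y" for x y using \<phi>(1)[of "x - y" y] by simp
  have gen: "\<phi> (h * (X \<mu> - sH (s \<mu>) 1)) = 0" if \<mu>: "\<mu> \<in> L" for h \<mu>
  proof -
    have "h \<in> H.span pbw_basis" using pbw_basis_span by simp
    then show ?thesis
    proof (induction rule: H.span_induct_alt)
      case (step c x y)
      then obtain w \<nu> where x: "x = Tw w * X \<nu>" "w \<in> W0 D" "\<nu> \<in> L" by (auto simp: pbw_basis_def)
      have "x * (X \<mu> - sH (s \<mu>) 1) = Tw w * X (\<nu> + \<mu>) - sH (s \<mu>) (Tw w * X \<nu>)"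
        by (simp add: x(1) right_diff_distrib sH_mult mult.assoc X_mult[OF x(3) \<mu>])
      then have "\<phi> (x * (X \<mu> - sH (s \<mu>) 1)) = 0"
        using x(2,3) \<mu> by (simp add: \<phi>d \<phi>(2,3) L_add char_add[OF s])
      then show ?case using step(2) by (simp add: distrib_right sH_mult \<phi>(1,2))
    qed (simp add: \<phi>0)
  qed
  have "\<phi> x = 0" if "x \<in> weight_ideal s" for x
    using that unfolding weight_ideal_def
    by (induction rule: H.span_induct_alt) (auto simp: \<phi>0 \<phi>(1,2) gen)
  then have "\<phi> (tauw s is 1) = 0" using K by blast
  moreover have low: "\<phi> x = 0" if "x \<in> lower (length is)" for x
    using that unfolding lower_def
  proof (induction rule: H.span_induct_alt)
    case (step c x y)
    then obtain js where js: "x = Tl js" "reduced_word D js" "length js < length is" by blast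
    have "we js \<noteq> u" using js(2,3) r unfolding u_def reduced_iff by (metis less_irrefl)
    moreover have "x = Tw (we js) * X 0" using Tw_word[OF js(2)] js(1) by (simp add: X_0 Tl_def)
    ultimately have "\<phi> x = 0" using \<phi>(3)[of "we js" 0] js(2) word_W0 L_0 by (simp add: reduced_iff)
    then show ?case using step(2) by (simp add: \<phi>(1,2))
  qed (simp add: \<phi>0)
  moreover have "\<phi> (Tl is) = 1"
    using \<phi>(3)[OF u L_0] Tw_word[OF r] by (simp add: X_0 Tl_def u_def char_0[OF s])
  ultimately show False using low[OF tauw_leading[OF r, of s]] by (simp add: \<phi>d)
qed

text \<open>For a free regular weight the vectors \<open>b w\<close> constructed here are nonzero
  modulo the ideal and have different weights. Both sides of the braid relation expand in them with
  coefficients \<open>ps_coef\<close>, and the components of weight \<open>act u s\<close> are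
  compared.\<close>

lemma ps_coef_generic:
  assumes ij: "i \<in> idx D" "j \<in> idx D" "i \<noteq> j" and s: "s \<in> characters D"
    and reg: "regular {i, j} s" and fre: "free {i, j} s" and u: "u \<in> parabolic D {i, j}"
  shows "ps_coef s (altw (cox i j) i j) u = ps_coef s (altw (cox i j) j i) u"
proof -
  let ?I = "{i, j}" let ?W = "parabolic D ?I" let ?m = "cox i j"
  have I: "?I \<subseteq> idx D" using ij by auto
  have WP: "w \<in> W0 D" if "w \<in> ?W" for w using that parabolic_W0[OF I] by blast
  have fin: "finite ?W" using finite_W0 WP by (meson finite_subset subsetI)
  \<comment> \<open>Equality of the group elements is part of the relation because the intertwiner
    prepended next depends on the weight that the word has reached.\<close>
  define rel where "rel = (\<lambda>is js. we is = we js \<and> tauw s is 1 - tauw s js 1 \<in> weight_ideal s)"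
  have rel: "rel is js" if "set is \<subseteq> ?I" "set js \<subseteq> ?I" "reduced_word D is" "reduced_word D js" "we is = we js"
    for "is" js
  proof (rule matsumoto[OF I, where rel = rel])
    show "rel is is" for "is" by (simp add: rel_def H.subspace_0[OF weight_ideal_subspace])
    show "rel js is" if "rel is js" for "is" js
    proof -
      have "- (tauw s is 1 - tauw s js 1) \<in> weight_ideal s"
        by (rule H.subspace_neg[OF weight_ideal_subspace]) (use that in \<open>simp add: rel_def\<close>)
      then show ?thesis using that by (simp add: rel_def)
    qed
    show "rel is ks" if "rel is js" "rel js ks" for "is" js ks
    proof -
      have "(tauw s is 1 - tauw s js 1) + (tauw s js 1 - tauw s ks 1) \<in> weight_ideal s"
        by (rule H.subspace_add[OF weight_ideal_subspace]) (use that in \<open>simp_all add: rel_def\<close>)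
      then show ?thesis using that by (simp add: rel_def)
    qed
    show "rel (k # is) (k # js)" if "k \<in> ?I" "rel is js" for k "is" js
    proof -
      let ?x = "tauw s is 1 - tauw s js 1" and ?p = "pp k (act (we js) s)"
      have "T k * ?x - sH ?p ?x \<in> weight_ideal s"
        by (rule H.subspace_diff[OF weight_ideal_subspace weight_ideal_mult H.subspace_scale[OF weight_ideal_subspace]])
          (use that in \<open>simp_all add: rel_def\<close>)
      also have "T k * ?x - sH ?p ?x = tauw s (k # is) 1 - tauw s (k # js) 1"
        using that by (simp add: rel_def tau_def right_diff_distrib H.scale_right_diff_distrib algebra_simps)
      finally show ?thesis using that by (simp add: rel_def word_elt_Cons)
    qed
    show "rel (altw (cox a b) a b @ ks) (altw (cox a b) b a @ ks)"
      if "a \<in> ?I" "b \<in> ?I" "a \<noteq> b" "set ks \<subseteq> ?I" for a b ks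
    proof -
      have ab: "a \<in> idx D" "b \<in> idx D" "set ks \<subseteq> idx D" using that I by auto
      have w: "weight_mod s (tauw s ks 1) (act (we ks) s)"
        using tauw_weight_mod[OF I s reg fre id_parabolic _ weight_mod_1 that(4)] by simp
      have "tauw (act (we ks) s) (altw (cox a b) a b) (tauw s ks 1) -
          tauw (act (we ks) s) (altw (cox a b) b a) (tauw s ks 1) \<in> weight_ideal s"
        by (rule tauw_braid[OF I s reg fre parabolicI[OF that(4)] refl w that(1-3)])
      then show ?thesis
        using word_cox[OF ab(1,2)] ab altw_idx[OF ab(1,2)] altw_idx[OF ab(2,1)]
        by (simp add: rel_def tauw_append word_elt_append)
    qed
  qed (use that in auto)
  \<comment> \<open>One reduced word per element is fixed; by \<open>rel\<close> the choice does not
    matter modulo the ideal.\<close>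
  define wd where "wd = (\<lambda>w. SOME is. set is \<subseteq> ?I \<and> reduced_word D is \<and> we is = w)"
  have wd: "set (wd w) \<subseteq> ?I \<and> reduced_word D (wd w) \<and> we (wd w) = w" if "w \<in> ?W" for w
    unfolding wd_def by (rule someI_ex) (use reduced_in_parabolic[OF I that] in metis)
  define b where "b = (\<lambda>w. tauw s (wd w) 1)"
  have b_wt: "weight_mod s (b w) (act w s)" if "w \<in> ?W" for w
    using tauw_weight_mod[OF I s reg fre id_parabolic _ weight_mod_1, of "wd w"] wd[OF that] by (simp add: b_def)
  have b_nz: "b w \<notin> weight_ideal s" if "w \<in> ?W" for w
    using tauw_nonzero[OF s] wd[OF that] by (simp add: b_def)
  have stepup: "b (sr k \<circ> w) - tau k (act w s) (b w) \<in> weight_ideal s"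
    if k: "k \<in> ?I" and w: "w \<in> ?W" and up: "up k w" for k w
  proof -
    have sw: "sr k \<circ> w \<in> ?W" using comp_parabolic sr_parabolic k w by blast
    have r: "reduced_word D (k # wd w)" using wd[OF w] k I up by (auto simp: reduced_Cons up_def)
    have "rel (wd (sr k \<circ> w)) (k # wd w)"
      using wd[OF sw] wd[OF w] r k by (intro rel) (auto simp: word_elt_Cons)
    then show ?thesis using wd[OF w] by (simp add: rel_def b_def)
  qed
  have Tb: "T k * b w - (sH (pp k (act w s)) (b w) + sH (kap_up k s w) (b (sr k \<circ> w))) \<in> weight_ideal s"
    if k: "k \<in> ?I" and w: "w \<in> ?W" for k w
  proof (cases "up k w")
    case True
    have "- (b (sr k \<circ> w) - tau k (act w s) (b w)) \<in> weight_ideal s"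
      by (rule H.subspace_neg[OF weight_ideal_subspace stepup[OF k w True]])
    then show ?thesis using True by (simp add: kap_up_def tau_def algebra_simps)
  next
    case False
    have kI: "k \<in> idx D" using k I by auto
    define w' where "w' = sr k \<circ> w"
    have w': "w' \<in> ?W" using comp_parabolic sr_parabolic k w by (simp add: w'_def)
    have ww: "w = sr k \<circ> w'" by (simp only: w'_def sr_comp_sr[OF kI])
    have upw: "up k w'" using up_sr[OF WP[OF w] kI] False by (simp add: w'_def)
    have aw: "act (sr k) (act w' s) = act w s"
      using act_comp[OF W0_sr[OF kI] WP[OF w'], of s] by (simp add: ww)
    have d: "b w - tau k (act w' s) (b w') \<in> weight_ideal s" using stepup[OF k w' upw] ww by simp
    have g: "good (al k) (act w' s)" using regular_good[OF I s reg w' k] .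
    have e: "T k * tau k (act w' s) (b w') =
        sH (pp k (act w s)) (tau k (act w' s) (b w')) + sH (kk k (act w s)) (b w')"
      using T_tau[OF act_char[OF WP[OF w'] s] kI g, of "b w'"] by (simp only: aw)
    let ?d = "b w - tau k (act w' s) (b w')"
    have "T k * ?d - sH (pp k (act w s)) ?d \<in> weight_ideal s"
      by (rule H.subspace_diff[OF weight_ideal_subspace weight_ideal_mult[OF d] H.subspace_scale[OF weight_ideal_subspace d]])
    also have "T k * ?d - sH (pp k (act w s)) ?d = T k * b w - (sH (pp k (act w s)) (b w) + sH (kk k (act w s)) (b w'))"
      by (simp add: right_diff_distrib H.scale_right_diff_distrib e)
    finally show ?thesis using False by (simp add: kap_up_def w'_def)
  qed
  have Tlf: "foldr (\<lambda>k h. T k * h) is x = Tl is * x" for "is" x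
    by (induction "is") (simp_all add: Tl_simps mult.assoc)
  \<comment> \<open>The identity has only the empty reduced word, so that \<open>b id\<close> is
    exactly 1, as \<open>transfer\<close> requires.\<close>
  have wdid: "wd id = []"
  proof -
    have "we (wd id) = id" "length (wd id) = len (we (wd id))"
      using wd[OF id_parabolic] unfolding reduced_iff by auto
    then show ?thesis using len_id by (simp only: length_0_conv)
  qed
  have b_id: "b id = 1" by (simp add: b_def wdid)
  have tr: "Tl is - (\<Sum>w\<in>?W. sH (ps_coef s is w) (b w)) \<in> weight_ideal s" if "set is \<subseteq> ?I" for "is"
  proof -
    have "foldr (\<lambda>k h. T k * h) is 1 - (\<Sum>w\<in>?W. sH (ps_coef s is w) (b w)) \<in> weight_ideal s"
      by (rule transfer[OF H.vector_space_axioms weight_ideal_subspace _ _ _ I Tb b_id that])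
        (auto simp: distrib_left sH_mult weight_ideal_mult)
    then show ?thesis by (simp add: Tlf)
  qed
  let ?c = "\<lambda>w. ps_coef s (altw ?m i j) w - ps_coef s (altw ?m j i) w"
  have aI: "set (altw ?m i j) \<subseteq> ?I" "set (altw ?m j i) \<subseteq> ?I"
    using set_altw[of ?m i j] set_altw[of ?m j i] by auto
  have "(Tl (altw ?m j i) - (\<Sum>w\<in>?W. sH (ps_coef s (altw ?m j i) w) (b w))) -
      (Tl (altw ?m i j) - (\<Sum>w\<in>?W. sH (ps_coef s (altw ?m i j) w) (b w))) \<in> weight_ideal s"
    by (rule H.subspace_diff[OF weight_ideal_subspace tr[OF aI(2)] tr[OF aI(1)]])
  then have sum: "(\<Sum>w\<in>?W. sH (?c w) (b w)) \<in> weight_ideal s"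
    using T_braid[OF ij(1,2)] by (simp add: H.scale_left_diff_distrib sum_subtractf)
  have "sH (?c u) (b u) \<in> weight_ideal s"
  proof (rule H.weight_sep[where f = "\<lambda>\<mu> h. X \<mu> * h" and A = L and S = "?W - {u}"
        and y = "\<lambda>w. sH (?c w) (b w)" and \<sigma> = "\<lambda>w. act w s" and \<tau> = "act u s"])
    have wt: "X \<mu> * sH (?c w) (b w) - sH (act w s \<mu>) (sH (?c w) (b w)) \<in> weight_ideal s" if "w \<in> ?W" "\<mu> \<in> L" for w \<mu>
    proof -
      have "sH (?c w) (X \<mu> * b w - sH (act w s \<mu>) (b w)) \<in> weight_ideal s"
        by (rule H.subspace_scale[OF weight_ideal_subspace]) (use b_wt[OF that(1)] that(2) in \<open>simp add: weight_mod_def\<close>)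
      also have "sH (?c w) (X \<mu> * b w - sH (act w s \<mu>) (b w))
          = X \<mu> * sH (?c w) (b w) - sH (act w s \<mu>) (sH (?c w) (b w))"
        by (simp only: H.scale_right_diff_distrib sH_mult H.scale_scale mult.commute)
      finally show ?thesis .
    qed
    show "X \<mu> * sH (?c w) (b w) - sH (act w s \<mu>) (sH (?c w) (b w)) \<in> weight_ideal s" if "w \<in> ?W - {u}" "\<mu> \<in> L" for w \<mu>
      using wt that by blast
    show "X \<mu> * sH (?c u) (b u) - sH (act u s \<mu>) (sH (?c u) (b u)) \<in> weight_ideal s" if "\<mu> \<in> L" for \<mu>
      using wt[OF u that] .
    show "\<exists>\<mu>\<in>L. act w s \<mu> \<noteq> act u s \<mu>" if w: "w \<in> ?W - {u}" for w
    proof (rule ccontr)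
      assume "\<not> ?thesis"
      then have "act w s = act u s"
        using w u WP by (intro char_eqI act_char s) auto
      then show False using fre w u by (auto simp: free_def)
    qed
    show "sH (?c u) (b u) + (\<Sum>w\<in>?W - {u}. sH (?c w) (b w)) \<in> weight_ideal s"
      using sum fin u by (simp add: sum.remove[of ?W u])
  qed (use fin weight_ideal_subspace weight_ideal_mult in \<open>auto simp: distrib_left sH_mult\<close>)
  then have "?c u = 0"
  proof (rule contrapos_pp)
    assume c: "?c u \<noteq> 0"
    show "sH (?c u) (b u) \<notin> weight_ideal s"
    proof
      assume "sH (?c u) (b u) \<in> weight_ideal s"
      then have "sH (inverse (?c u)) (sH (?c u) (b u)) \<in> weight_ideal s"
        by (rule H.subspace_scale[OF weight_ideal_subspace])
      then show False using b_nz[OF u] c by simp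
    qed
  qed
  then show ?thesis by simp
qed


section \<open>Perturbation to weights with trivial stabiliser\<close>

lemma height_vector:
  obtains \<xi> :: 'v where "\<And>v. v \<bullet> \<xi> = (\<Sum>k\<in>idx D. coef k v)"
proof
  have "linear (\<lambda>v. \<Sum>k\<in>idx D. coef k v)"
    by (rule linearI) (simp_all add: coef_add coef_scale sum.distrib sum_distrib_left)
  then show "v \<bullet> adjoint (\<lambda>v. \<Sum>k\<in>idx D. coef k v) 1 = (\<Sum>k\<in>idx D. coef k v)" for v
    by (simp add: adjoint_works)
qed

text \<open>The vector with inner product 1 with every simple root; it lies in the interior of the
  dominant chamber.\<close>

definition xi :: 'v where "xi = (SOME \<xi>. \<forall>v. v \<bullet> \<xi> = (\<Sum>k\<in>idx D. coef k v))"

lemma inner_xi: "v \<bullet> xi = (\<Sum>k\<in>idx D. coef k v)"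
proof -
  have "\<forall>v. v \<bullet> xi = (\<Sum>k\<in>idx D. coef k v)"
    unfolding xi_def by (rule someI_ex) (metis height_vector)
  then show ?thesis by blast
qed

text \<open>An element fixing \<open>xi\<close> preserves heights of roots, whereas the inverse of a
  nontrivial element sends some simple root, of height 1, to a negative root.\<close>

lemma xi_moved:
  assumes g: "g \<in> W0 D" "g \<noteq> id"
  shows "g xi \<noteq> xi"
proof
  assume fixed: "g xi = xi"
  obtain i where i: "i \<in> idx D" "\<not> pos (inv g (al i))" using exists_descent[OF g] .
  let ?v = "inv g (al i)"
  have r: "?v \<in> roots D" using i g W0_root W0_inv al_root by blast
  have "0 \<le> (\<Sum>k\<in>idx D. coef k (- ?v))"
    using neg_root[OF r] i(2) pos_coef by (intro sum_nonneg) blast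
  also have "\<dots> = - (?v \<bullet> xi)" by (simp only: inner_xi[symmetric] inner_minus_left)
  also have "?v \<bullet> xi = al i \<bullet> xi"
    using W0_inner[OF g(1), of ?v xi] by (simp add: fixed W0_inv_apply(2)[OF g(1)])
  also have "al i \<bullet> xi = 1"
    using i(1) finite_idx by (simp add: inner_xi coef_al)
  finally show False by simp
qed

text \<open>Since \<open>xi\<close> has trivial stabiliser, so have all but finitely many of the characters on the
  curve \<open>pert s\<close> through \<open>s\<close>.\<close>

definition pert :: "('v \<Rightarrow> complex) \<Rightarrow> real \<Rightarrow> 'v \<Rightarrow> complex" where
  "pert s x \<mu> = (if \<mu> \<in> L then s \<mu> * exp (of_real (x * (\<mu> \<bullet> xi))) else undefined)"

lemma pert_char:
  assumes "s \<in> characters D"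
  shows "pert s x \<in> characters D"
proof -
  have "pert s x (\<mu> + \<nu>) = pert s x \<mu> * pert s x \<nu>" if "\<mu> \<in> L" "\<nu> \<in> L" for \<mu> \<nu>
    using that L_add char_add[OF assms] by (simp add: pert_def inner_add_left distrib_left exp_add)
  then show ?thesis
    using char_nz[OF assms] by (auto simp: characters_def pert_def)
qed

lemma pert_tendsto: "\<mu> \<in> L \<Longrightarrow> ((\<lambda>x. pert s x \<mu>) \<longlongrightarrow> s \<mu>) (at 0)"
  unfolding pert_def by (auto intro!: tendsto_eq_intros)

lemma cv_pert_tendsto:
  assumes "\<beta> \<in> R0 D" "good \<beta> s"
  shows "((\<lambda>x. cv \<beta> (pert s x)) \<longlongrightarrow> cv \<beta> s) (at 0)"
proof -
  have p: "((\<lambda>x. poly q (pert s x (hh \<beta>))) \<longlongrightarrow> poly q (s (hh \<beta>))) (at 0)" for q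
    by (rule isCont_tendsto_compose[OF poly_isCont pert_tendsto[OF hh_L[OF assms(1)]]])
  show ?thesis unfolding cv_def
    by (rule tendsto_divide[OF p p]) (use assms(2) in \<open>simp add: good_def\<close>)
qed

lemma cc_pert_tendsto:
  assumes s: "s \<in> characters D" and u: "u \<in> W0 D" and i: "i \<in> idx D" and g: "good (al i) (act u s)"
  shows "((\<lambda>x. cc i (act u (pert s x))) \<longlongrightarrow> cc i (act u s)) (at 0)"
proof -
  have "inv u (al i) \<in> R0 D" using W0_R0_iff[OF W0_inv[OF u]] al_R0[OF i] by simp
  moreover have "good (inv u (al i)) s" using g good_W0[OF u] by simp
  ultimately show ?thesis
    using cv_pert_tendsto s by (simp add: c_val_cv act_char[OF u] pert_char i cv_W0[OF u])
qed

text \<open>The coefficients are polynomial in c-values along the orbit, and regularity of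
  \<open>s\<close> excludes poles there.\<close>

lemma ps_coef_pert_tendsto:
  assumes I: "I \<subseteq> idx D" and s: "s \<in> characters D" and reg: "regular I s"
  shows "set is \<subseteq> I \<Longrightarrow> u \<in> parabolic D I \<Longrightarrow> ((\<lambda>x. ps_coef (pert s x) is u) \<longlongrightarrow> ps_coef s is u) (at 0)"
proof (induction "is" arbitrary: u)
  case (Cons k "is")
  then have k: "k \<in> I" "k \<in> idx D" using I by auto
  have cc: "((\<lambda>x. cc k (act v (pert s x))) \<longlongrightarrow> cc k (act v s)) (at 0)" if "v \<in> parabolic D I" for v
    by (rule cc_pert_tendsto[OF s parabolic_W0[OF I that] k(2) regular_good[OF I s reg that k(1)]])
  have sv: "sr k \<circ> v \<in> parabolic D I" if "v \<in> parabolic D I" for v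
    using comp_parabolic sr_parabolic k that by blast
  have p: "((\<lambda>x. pp k (act v (pert s x))) \<longlongrightarrow> pp k (act v s)) (at 0)" if "v \<in> parabolic D I" for v
    unfolding pp_def by (intro tendsto_intros cc that)
  have q: "((\<lambda>x. kap_up k (pert s x) v) \<longlongrightarrow> kap_up k s v) (at 0)" if "v \<in> parabolic D I" for v
  proof (cases "up k v")
    case False
    have "((\<lambda>x. kk k (act v (pert s x))) \<longlongrightarrow> kk k (act v s)) (at 0)"
      unfolding kk_def act_comp[OF W0_sr[OF k(2)] parabolic_W0[OF I that], symmetric]
      by (intro tendsto_intros cc that sv)
    then show ?thesis using False by (simp add: kap_up_def)
  qed (simp add: kap_up_def)
  show ?case unfolding ps_coef.simps
    by (intro tendsto_intros p q Cons.IH sv Cons.prems(2)) (use Cons.prems in auto)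
qed simp

lemma regular_pert:
  assumes I: "I \<subseteq> idx D" and s: "s \<in> characters D" and reg: "regular I s"
  shows "eventually (\<lambda>x. regular I (pert s x)) (at 0)"
proof -
  have fin: "finite (parabolic D I)" "finite I"
    using finite_W0 I parabolic_W0 finite_idx by (meson finite_subset subsetI)+
  have "eventually (\<lambda>x. act u (pert s x) (coroot (al k)) \<noteq> 1) (at 0)"
    if u: "u \<in> parabolic D I" and k: "k \<in> I" for u k
  proof (rule tendsto_imp_eventually_ne)
    have "inv u (coroot (al k)) \<in> L"
      using W0_L[OF W0_inv[OF parabolic_W0[OF I u]]] coroot_in_L al_root k I by blast
    then show "((\<lambda>x. act u (pert s x) (coroot (al k))) \<longlongrightarrow> act u s (coroot (al k))) (at 0)"
      unfolding act_apply by (rule pert_tendsto)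
    show "act u s (coroot (al k)) \<noteq> 1" using reg u k by (simp add: regular_def)
  qed
  then show ?thesis unfolding regular_def
    using fin by (intro eventually_ball_finite ballI) auto
qed

text \<open>Two different elements give the same weight for at most one point of the curve: on a
  coroot that tells apart their images of \<open>xi\<close>, the quotient of the two values has
  strictly monotone modulus.\<close>

lemma free_pert:
  assumes I: "I \<subseteq> idx D" and s: "s \<in> characters D"
  shows "eventually (\<lambda>x. free I (pert s x)) (at 0)"
proof -
  have fin: "finite (parabolic D I)"
    using finite_W0 I parabolic_W0 by (meson finite_subset subsetI)
  have ev: "eventually (\<lambda>x. act u (pert s x) \<noteq> act u' (pert s x)) (at 0)"
    if u: "u \<in> W0 D" and u': "u' \<in> W0 D" and ne: "u \<noteq> u'" for u u'
  proof -
    have "inv u \<circ> u' \<noteq> id"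
    proof
      assume eq: "inv u \<circ> u' = id"
      have "u' v = u v" for v
        using fun_cong[OF eq, of v] W0_inv_apply(2)[OF u, of "u' v"] by simp
      then show False using ne by auto
    qed
    then have "inv u (u' xi) \<noteq> xi"
      using xi_moved[of "inv u \<circ> u'"] W0_comp W0_inv u u' by auto
    then have "u' xi - u xi \<noteq> 0" using W0_inv_apply(1)[OF u, of xi] by auto
    have "\<exists>k\<in>idx D. al k \<bullet> (u' xi - u xi) \<noteq> 0"
    proof (rule ccontr)
      let ?d = "u' xi - u xi"
      assume "\<not> ?thesis"
      then have "(\<Sum>k\<in>idx D. coef k ?d *\<^sub>R al k) \<bullet> ?d = 0"
        by (simp add: inner_sum_left)
      then show False using \<open>?d \<noteq> 0\<close> by (simp only: coef_expand inner_eq_zero_iff)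
    qed
    then obtain k where k: "k \<in> idx D" "al k \<bullet> (u' xi - u xi) \<noteq> 0" by blast
    define \<mu> where "\<mu> = coroot (al k)"
    have \<mu>: "\<mu> \<in> L" unfolding \<mu>_def using coroot_in_L al_root k by blast
    define d where "d = \<mu> \<bullet> (u' xi - u xi)"
    have d: "d \<noteq> 0" using k al_nz[OF k(1)] by (simp add: d_def \<mu>_def coroot_def)
    have iu: "inv u \<mu> \<in> L" "inv u' \<mu> \<in> L" using W0_L W0_inv u u' \<mu> by blast+
    have inn: "inv v \<mu> \<bullet> xi = \<mu> \<bullet> v xi" if "v \<in> W0 D" for v
      using W0_inner[OF that, of "inv v \<mu>" xi] W0_inv_apply(2)[OF that, of \<mu>] by simp
    have key: "s (inv u \<mu>) = s (inv u' \<mu>) * exp (of_real (x * d))"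
      if "act u (pert s x) = act u' (pert s x)" for x
    proof -
      have "s (inv u \<mu>) * exp (of_real (x * (\<mu> \<bullet> u xi))) = s (inv u' \<mu>) * exp (of_real (x * (\<mu> \<bullet> u' xi)))"
        using fun_cong[OF that, of \<mu>] iu u u' by (simp add: act_apply pert_def inn)
      then have "s (inv u \<mu>) * exp (of_real (x * (\<mu> \<bullet> u xi))) =
          (s (inv u' \<mu>) * exp (of_real (x * d))) * exp (of_real (x * (\<mu> \<bullet> u xi)))"
        by (simp add: d_def inner_diff_right right_diff_distrib exp_diff)
      then show ?thesis by simp
    qed
    have uniq: "x = y" if "act u (pert s x) = act u' (pert s x)" "act u (pert s y) = act u' (pert s y)" for x y
    proof -
      have "s (inv u' \<mu>) * exp (of_real (x * d)) = s (inv u' \<mu>) * exp (of_real (y * d))"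
        by (rule trans[OF key[OF that(1), symmetric] key[OF that(2)]])
      then have "exp (of_real (x * d) :: complex) = exp (of_real (y * d))"
        using char_nz[OF s iu(2)] by simp
      then have "norm (exp (of_real (x * d) :: complex)) = norm (exp (of_real (y * d) :: complex))" by simp
      then show ?thesis using d by (simp add: norm_exp_eq_Re)
    qed
    show ?thesis
    proof (cases "\<exists>x. act u (pert s x) = act u' (pert s x)")
      case True
      then obtain x where "act u (pert s x) = act u' (pert s x)" by blast
      then have "y \<noteq> x \<Longrightarrow> act u (pert s y) \<noteq> act u' (pert s y)" for y using uniq by metis
      then show ?thesis
        using eventually_mono[OF eventually_neq_at_within[of x 0 UNIV]] by simp
    qed simp
  qed
  have "eventually (\<lambda>x. \<forall>u\<in>parabolic D I. \<forall>u'\<in>parabolic D I. u \<noteq> u' \<longrightarrow>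
      act u (pert s x) \<noteq> act u' (pert s x)) (at 0)"
    using fin ev parabolic_W0[OF I]
    by (intro eventually_ball_finite ballI) (auto simp: eventually_conj_iff)
  then show ?thesis unfolding free_def by (rule eventually_mono) blast
qed

end

context hecke_alg
begin

lemma ps_coef_regular:
  assumes ij: "i \<in> idx D" "j \<in> idx D" "i \<noteq> j" and s: "s \<in> characters D"
    and reg: "regular {i, j} s" and u: "u \<in> parabolic D {i, j}"
  shows "ps_coef s (altw (cox i j) i j) u = ps_coef s (altw (cox i j) j i) u"
proof (rule tendsto_unique)
  have I: "{i, j} \<subseteq> idx D" using ij by simp
  have sub: "set (altw (cox i j) i j) \<subseteq> {i, j}" "set (altw (cox i j) j i) \<subseteq> {i, j}"
    using set_altw[of "cox i j" i j] set_altw[of "cox i j" j i] by auto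
  show "((\<lambda>x. ps_coef (pert s x) (altw (cox i j) i j) u) \<longlongrightarrow> ps_coef s (altw (cox i j) i j) u) (at 0)"
    by (rule ps_coef_pert_tendsto[OF I s reg sub(1) u])
  have "eventually (\<lambda>x. ps_coef (pert s x) (altw (cox i j) j i) u = ps_coef (pert s x) (altw (cox i j) i j) u) (at 0)"
    using regular_pert[OF I s reg] free_pert[OF I s]
    by eventually_elim (simp add: ps_coef_generic[OF ij pert_char[OF s] _ _ u])
  then show "((\<lambda>x. ps_coef (pert s x) (altw (cox i j) i j) u) \<longlongrightarrow> ps_coef s (altw (cox i j) j i) u) (at 0)"
    using ps_coef_pert_tendsto[OF I s reg sub(2) u] by (rule Lim_transform_eventually[rotated])
qed simp


text \<open>The counterpart of \<open>q_root\<close> for the fixed square roots.\<close>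

definition rq :: "'v \<Rightarrow> complex" where
  "rq \<beta> = qroot D (SOME k. k \<in> idx D \<and> (\<exists>w\<in>W0 D. \<beta> = w (al k)))"

text \<open>The operators \<open>T\<^sub>i - p\<^sub>i\<close> along a reduced word of \<open>u\<close> take
  \<open>e\<^sub>s\<close> to this multiple of \<open>e\<^sub>u\<^sub>s\<close>, if they stay within the local region.\<close>

definition intertwine :: "('v \<Rightarrow> complex) \<Rightarrow> ('v \<Rightarrow> 'v) \<Rightarrow> complex" where
  "intertwine s u = (\<Prod>\<beta>\<in>{\<beta>\<in>R0_pos D. \<not> pos (u \<beta>)}. rq \<beta> * cv \<beta> s)"

lemma rq_W0_al: assumes i: "i \<in> idx D" and w: "w \<in> W0 D" shows "rq (w (al i)) = qroot D i"
proof -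
  define k where "k = (SOME k. k \<in> idx D \<and> (\<exists>v\<in>W0 D. w (al i) = v (al k)))"
  have "\<exists>k. k \<in> idx D \<and> (\<exists>v\<in>W0 D. w (al i) = v (al k))" using i w by blast
  then have "k \<in> idx D \<and> (\<exists>v\<in>W0 D. w (al i) = v (al k))" unfolding k_def by (rule someI_ex)
  then obtain v where v: "k \<in> idx D" "v \<in> W0 D" "w (al i) = v (al k)" by blast
  have "al i = (inv w \<circ> v) (al k)" using W0_inv_apply(1)[OF w, of "al i"] v(3) by simp
  then have "qroot D k = qroot D i" using conj_par(2)[OF i v(1) W0_comp[OF W0_inv[OF w] v(2)]] by blast
  then show ?thesis by (simp add: rq_def k_def)
qed

lemma finite_R0_pos: "finite (R0_pos D)"
proof (rule finite_subset)
  show "R0_pos D \<subseteq> roots D" using R0_root by (auto simp: R0_pos_iff)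
  show "finite (roots D)"
    using datum by (simp add: hecke_datum_def irreducible_root_system_def root_system_def)
qed

lemma intertwine_id: "intertwine s id = 1"
proof -
  have "{\<beta>\<in>R0_pos D. \<not> pos (id \<beta>)} = {}" by (auto simp: R0_pos_iff)
  then show ?thesis by (simp only: intertwine_def prod.empty)
qed

text \<open>An upward step adds exactly one inversion, the root \<open>inv u (al k)\<close>, and its
  factor is the coefficient of that step.\<close>

lemma intertwine_up:
  assumes s: "s \<in> characters D" and u: "u \<in> W0 D" and k: "k \<in> idx D" and up: "up k u"
  shows "intertwine s (sr k \<circ> u) = intertwine s u * (qroot D k * cc k (act u s))"
proof -
  let ?b = "inv u (al k)" and ?N = "\<lambda>u. {\<beta>\<in>R0_pos D. \<not> pos (u \<beta>)}"
  have b: "?b \<in> R0_pos D" using up W0_R0_iff[OF W0_inv[OF u]] al_R0[OF k] by (simp add: R0_pos_iff up_def)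
  have ub: "u ?b = al k" by (rule W0_inv_apply(2)[OF u])
  have "\<not> pos (sr k (u \<beta>)) \<longleftrightarrow> \<beta> = ?b \<or> \<not> pos (u \<beta>)" if \<beta>: "\<beta> \<in> R0_pos D" for \<beta>
  proof -
    have \<beta>': "\<beta> \<in> R0 D" "pos \<beta>" using \<beta> by (auto simp: R0_pos_iff)
    have r: "u \<beta> \<in> R0 D" "- u \<beta> \<in> R0 D" using W0_R0_iff[OF u] \<beta>' uminus_R0_iff by auto
    show ?thesis
    proof (cases "pos (u \<beta>)")
      case True
      show ?thesis
      proof (cases "\<beta> = ?b")
        case True
        then show ?thesis using neg_root[OF al_root[OF k]] pos_al[OF k] by (simp add: ub sr_al[OF k])
      next
        case False
        then have "u \<beta> \<noteq> al k" using W0_inv_apply(1)[OF u, of \<beta>] by auto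
        then show ?thesis using sr_pos[OF k r(1)] True False by simp
      qed
    next
      case False
      have "- u \<beta> \<noteq> al k"
      proof
        assume "- u \<beta> = al k"
        then have "?b = - \<beta>" using W0_inv_apply(1)[OF u, of "- \<beta>"] by (simp add: W0_uminus[OF u])
        then show False using b \<beta>' neg_root[OF R0_root[OF \<beta>'(1)]] by (simp add: R0_pos_iff)
      qed
      then have "pos (- sr k (u \<beta>))"
        using sr_pos[OF k r(2)] neg_root[OF R0_root[OF r(1)]] False linear_neg[OF linear_sr, of k "u \<beta>"] by simp
      then show ?thesis using neg_root[OF sr_root[OF k R0_root[OF r(1)]]] False by simp
    qed
  qed
  then have "?N (sr k \<circ> u) = insert ?b (?N u)" using b by auto
  moreover have "?b \<notin> ?N u" using pos_al[OF k] by (simp add: ub)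
  moreover have "rq ?b * cv ?b s = qroot D k * cc k (act u s)"
    using s k u by (simp add: rq_W0_al W0_inv c_val_cv act_char cv_W0)
  ultimately show ?thesis using finite_R0_pos by (simp add: intertwine_def)
qed

lemma lookup_XX: "Poly_Mapping.lookup (XX \<mu> m) s = s \<mu> * Poly_Mapping.lookup m s"
proof -
  have "XX \<mu> m = (\<Sum>r\<in>Poly_Mapping.keys m. scal (Poly_Mapping.lookup m r) (scal (r \<mu>) (e r)))"
    by (simp add: XX_def lin_def)
  then have "Poly_Mapping.lookup (XX \<mu> m) s =
      (\<Sum>r\<in>Poly_Mapping.keys m. Poly_Mapping.lookup (scal (Poly_Mapping.lookup m r) (scal (r \<mu>) (e r))) s)"
    by (simp only: lookup_sum)
  also have "\<dots> = (\<Sum>r\<in>Poly_Mapping.keys m. if r = s then s \<mu> * Poly_Mapping.lookup m s else 0)"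
    by (rule sum.cong) (auto simp: lookup_scal lookup_single when_def)
  finally show ?thesis by (simp add: in_keys_iff)
qed

end

section \<open>The braid relation on a local region\<close>

locale region = hecke_alg D sH T Tw X
  for D :: "'v::euclidean_space hecke_data" and sH :: "complex \<Rightarrow> 'h::ring_1 \<Rightarrow> 'h"
    and T :: "nat \<Rightarrow> 'h" and Tw :: "('v \<Rightarrow> 'v) \<Rightarrow> 'h" and X :: "'v \<Rightarrow> 'h" +
  fixes t :: "'v \<Rightarrow> complex" and J :: "'v set"
  assumes t: "t \<in> characters D" and J: "J \<subseteq> N_set D t" and F_ne: "F_set D J t \<noteq> {}"
    and calib: "\<forall>w\<in>F_set D J t. \<forall>i\<in>idx D. \<forall>j\<in>idx D. i \<noteq> j \<longrightarrow> calibratable D i j (act w t)"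
    and no_poles: "\<forall>w\<in>F_set D J t. \<forall>i\<in>idx D. ga_eval (d_fun D (al i)) (act w t) \<noteq> 0"
begin

abbreviation "F \<equiv> F_set D J t"
abbreviation "\<Omega> \<equiv> region_weights D J t"
abbreviation "M \<equiv> region_module D J t"

text \<open>The right-hand side depends on the weight only, so elements of the region with the same
  weight agree on which steps stay inside.\<close>

lemma F_eps:
  assumes v: "v \<in> F" and k: "k \<in> idx D" and g: "good (al k) (act v t)"
  shows "sr k \<circ> v \<in> F \<longleftrightarrow> eps k (act v t) \<noteq> 0"
proof -
  note V = F_W0[OF J v]
  show ?thesis
    unfolding F_step[OF J v k] Un_iff absr_D_set[OF t V k] absr_N_set[OF t V k g] eps_def
    using g by simp
qed

text \<open>The vectors \<open>b u\<close>, with zero for chambers outside the region, satisfy the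
  principal series formulas. The factor \<open>intertwine s u\<close> accounts for the
  normalisation: upward steps have coefficient 1 in \<open>ps_coef\<close> but q^(1/2) c in
  \<open>TT\<close>.\<close>

lemma regular_braid:
  assumes ij: "i \<in> idx D" "j \<in> idx D" "i \<noteq> j" and w: "w \<in> F" and reg: "regular {i, j} (act w t)"
  shows "TTw (altw (cox i j) i j) (e (act w t)) = TTw (altw (cox i j) j i) (e (act w t))"
proof -
  let ?I = "{i, j}" let ?W = "parabolic D ?I"
  define s where "s = act w t"
  note wW = F_W0[OF J w]
  have s: "s \<in> characters D" using act_char[OF wW t] by (simp add: s_def)
  have reg: "regular ?I s" using reg by (simp add: s_def)
  have I: "?I \<subseteq> idx D" using ij by auto
  have ac: "act u s = act (u \<circ> w) t" if "u \<in> W0 D" for u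
    using act_comp[OF that wW] by (simp add: s_def)
  define b where "b = (\<lambda>u. if u \<circ> w \<in> F then scal (intertwine s u) (e (act u s)) else 0)"
  have b_step: "TT k (b u) - (scal (pp k (act u s)) (b u) + scal (kap_up k s u) (b (sr k \<circ> u))) \<in> {0}"
    if kI: "k \<in> ?I" and uI: "u \<in> ?W" for k u
  proof -
    have k: "k \<in> idx D" and u: "u \<in> W0 D" using kI uI I parabolic_W0[OF I] by auto
    have su: "sr k \<circ> u \<in> W0 D" using W0_comp W0_sr k u by blast
    have g: "good (al k) (act u s)" by (rule regular_good[OF I s reg uI kI])
    have g': "good (al k) (act (sr k \<circ> u) s)"
      by (rule regular_good[OF I s reg _ kI]) (use comp_parabolic sr_parabolic kI uI in blast)
    have aa: "act (sr k) (act u s) = act (sr k \<circ> u) s" using act_comp[OF W0_sr[OF k] u] by simp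
    show ?thesis
    proof (cases "u \<circ> w \<in> F")
      case True
      have st: "sr k \<circ> (u \<circ> w) \<in> F \<longleftrightarrow> eps k (act u s) \<noteq> 0"
        using F_eps[OF True k] g ac[OF u] by simp
      have "scal (intertwine s u * (qroot D k * cc k (act u s) * eps k (act u s))) (e (act (sr k \<circ> u) s)) =
          scal (kap_up k s u) (b (sr k \<circ> u))"
      proof (cases "sr k \<circ> u \<circ> w \<in> F")
        case True
        then have e1: "eps k (act u s) = 1" using st by (auto simp: eps_def comp_assoc split: if_splits)
        have "intertwine s u * (qroot D k * cc k (act u s)) = kap_up k s u * intertwine s (sr k \<circ> u)"
        proof (cases "up k u")
          case True
          then show ?thesis using intertwine_up[OF s u k True] by (simp add: kap_up_def)
        next
          case False
          then have "up k (sr k \<circ> u)" using up_sr[OF u k] by simp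
          from intertwine_up[OF s su k this]
          have "intertwine s u = intertwine s (sr k \<circ> u) * (qroot D k * cc k (act (sr k \<circ> u) s))"
            by (simp only: sr_comp_sr[OF k])
          then show ?thesis using False qr[OF k] by (simp add: kap_up_def kk_def aa power2_eq_square)
        qed
        then show ?thesis using True e1 by (simp add: b_def)
      next
        case False
        then have "eps k (act u s) = 0" using st by (simp add: comp_assoc)
        then show ?thesis using False by (simp add: b_def)
      qed
      moreover have "b u = scal (intertwine s u) (e (act u s))" using True by (simp add: b_def)
      ultimately show ?thesis
        by (simp add: TT_scal TT_e aa scal.scale_right_distrib mult.commute)
    next
      case False
      \<comment> \<open>Nothing may flow back into the region from outside. If the neighbour is
        inside and the step to it goes down, its coefficient \<open>kk\<close> is zero. The step
        cannot go up: its wall would separate the neighbour from \<open>w\<close>, both in the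
        region, and would also be a wall at which the region ends.\<close>
      have "scal (kap_up k s u) (b (sr k \<circ> u)) = 0"
      proof (cases "sr k \<circ> u \<circ> w \<in> F")
        case True
        have cancel: "sr k \<circ> (sr k \<circ> u \<circ> w) = u \<circ> w" using sr_comp_sr[OF k, of "u \<circ> w"] by (simp add: comp_assoc)
        then have "eps k (act (sr k \<circ> u \<circ> w) t) = 0"
          using F_eps[OF True k] g' ac[OF su] False by simp
        then have "eps k (act u s) = 0"
          using eps_sr[OF k, of "act u s"] ac[OF su] aa by simp
        then have kk0: "kk k (act u s) = 0" by (auto simp: eps_def kk_def split: if_splits)
        have "\<not> up k u"
        proof
          assume up: "up k u"
          let ?v = "sr k \<circ> u \<circ> w" let ?\<gamma> = "inv (u \<circ> w) (al k)"
          note uw = W0_comp[OF u wW]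
          have \<gamma>: "?\<gamma> \<in> R0 D" using W0_R0_iff[OF W0_inv[OF uw]] al_R0[OF k] by simp
          have "w ?\<gamma> = inv u (al k)" by (simp add: inv_comp_W0[OF u wW] W0_inv_apply(2)[OF wW])
          then have p: "pos (w ?\<gamma>)" using up by (simp add: up_def)
          have "?v ?\<gamma> = - al k" using W0_inv_apply(2)[OF uw, of "al k"] by (simp add: sr_al[OF k])
          then have n: "\<not> pos (?v ?\<gamma>)" using neg_root[OF al_root[OF k]] pos_al[OF k] by simp
          have *: "absr ?\<gamma> \<notin> N_set D t \<union> D_set D t" by (rule F_separated[OF J w True \<gamma> p n])
          have "sr k \<circ> ?v = u \<circ> w" by (rule cancel)
          then have "absr (inv ?v (al k)) \<in> N_set D t \<union> D_set D t"
            using F_step[OF J True k] False by auto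
          moreover have "inv ?v (al k) = - ?\<gamma>"
            using inv_sr_comp[OF uw k, of "al k"] W0_uminus[OF W0_inv[OF uw]] by (simp add: sr_al[OF k] comp_assoc)
          moreover have "absr (- ?\<gamma>) = absr ?\<gamma>"
            using neg_root[OF R0_root[OF \<gamma>]] by (auto simp: absr_def)
          ultimately show False using * by simp
        qed
        then show ?thesis using kk0 by (simp add: kap_up_def)
      qed (simp add: b_def)
      then show ?thesis using False islin_0[OF islin_TT] by (simp add: b_def)
    qed
  qed
  have b_id: "b id = e s" using w by (simp only: b_def id_comp if_True intertwine_id act_id scal.scale_one)
  have "foldr TT is (e s) - (\<Sum>u\<in>?W. scal (ps_coef s is u) (b u)) \<in> {0}" if "set is \<subseteq> ?I" for "is"
    by (rule transfer[OF vector_space_scal scal.subspace_single_0 TT_add TT_scal _ I b_step b_id that])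
      (auto simp: islin_0[OF islin_TT])
  then have tr: "TTw is (e s) = (\<Sum>u\<in>?W. scal (ps_coef s is u) (b u))" if "set is \<subseteq> ?I" for "is"
    using that by (simp add: TTw_def)
  have sub: "set (altw (cox i j) i j) \<subseteq> ?I" "set (altw (cox i j) j i) \<subseteq> ?I"
    using set_altw[of "cox i j" i j] set_altw[of "cox i j" j i] by auto
  show ?thesis
    unfolding tr[OF sub(1), unfolded s_def] tr[OF sub(2), unfolded s_def]
    by (rule sum.cong) (use ps_coef_regular[OF ij s reg] in \<open>simp_all add: s_def\<close>)
qed

lemma region_weightE:
  assumes "s \<in> \<Omega>"
  obtains w where "w \<in> F" "w \<in> W0 D" "s = act w t" "s \<in> characters D" "\<And>i. i \<in> idx D \<Longrightarrow> good (al i) s"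
proof -
  obtain w where w: "w \<in> F" "s = act w t" using assms by (auto simp: region_weights_def)
  note W = F_W0[OF J w(1)]
  have s: "s \<in> characters D" using act_char[OF W t] w by simp
  have "good (al i) s" if "i \<in> idx D" for i
    using no_poles w that good_iff[OF s that] by auto
  then show ?thesis using that w W s by blast
qed

lemma weight_step:
  assumes "s \<in> \<Omega>" "k \<in> idx D" "eps k s \<noteq> 0"
  shows "act (sr k) s \<in> \<Omega>"
proof -
  obtain w where w: "w \<in> F" "w \<in> W0 D" "s = act w t" "\<And>i. i \<in> idx D \<Longrightarrow> good (al i) s"
    using region_weightE[OF assms(1)] by metis
  then have "sr k \<circ> w \<in> F" using F_eps[OF w(1) assms(2)] assms by simp
  then show ?thesis using act_comp[OF W0_sr[OF assms(2)] w(2), of t] w(3)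
    by (auto simp: region_weights_def intro!: image_eqI[of _ _ "sr k \<circ> w"])
qed

lemma braid_e:
  assumes s: "s \<in> \<Omega>" and ij: "i \<in> idx D" "j \<in> idx D" "i \<noteq> j"
  shows "TTw (altw (cox i j) i j) (e s) = TTw (altw (cox i j) j i) (e s)"
proof -
  obtain w where w: "w \<in> F" "s = act w t" "s \<in> characters D" and g: "\<And>i. i \<in> idx D \<Longrightarrow> good (al i) s"
    using region_weightE[OF s] by metis
  have ex: "TTw (altw (cox a b) a b) (e s) = TTw (altw (cox a b) b a) (e s)"
    if ab: "a \<in> idx D" "b \<in> idx D" "a \<noteq> b" and ex: "exceptional_pair D a b s" for a b
  proof -
    \<comment> \<open>A nonzero off-diagonal entry keeps the weight in the region, where poles are
      excluded.\<close>
    have g': "good (al a) (act (sr b) s)" if "eps b s \<noteq> 0" "a \<in> idx D" "b \<in> idx D" for a b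
      using region_weightE[OF weight_step[OF s that(3,1)]] that(2) by metis
    have "type_G2 D a b" if "exceptional_G2 D a b s"
      using that by (simp add: exceptional_G2_def)
    then show ?thesis
      using ex exceptional_C2_braid[OF w(3) ab] exceptional_BC2_braid[OF w(3) ab]
        exceptional_G2_braid[OF ab _ w(3) _ g[OF ab(1)] g[OF ab(2)] g'[OF _ ab(1,2)] g'[OF _ ab(2,1)]]
      unfolding exceptional_pair_def by blast
  qed
  have "calibratable D i j s" using calib w(1,2) ij by blast
  then consider "regular_pair D i j s" | "exceptional_pair D i j s" | "exceptional_pair D j i s"
    unfolding calibratable_def by blast
  then show ?thesis
  proof cases
    case 1
    then have "regular {i, j} s" by (auto simp: regular_pair_def regular_def)
    then show ?thesis using regular_braid[OF ij w(1)] w(2) by simp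
  next
    case 2
    then show ?thesis using ex ij by blast
  next
    case 3
    then show ?thesis using ex[OF ij(2,1)] ij(3) by (simp add: cox_sym[OF ij(2,1)])
  qed
qed

end

context region
begin

section \<open>The representation\<close>

lemma region_moduleD: "m \<in> M \<Longrightarrow> s \<in> Poly_Mapping.keys m \<Longrightarrow> s \<in> \<Omega>"
  by (auto simp: region_module_def)

lemma M_subspace: "scal.subspace M"
proof (rule scal.subspaceI)
  show "0 \<in> M" by (simp add: region_module_def)
  show "m + m' \<in> M" if "m \<in> M" "m' \<in> M" for m m'
    using that keys_add[of m m'] by (auto simp: region_module_def)
  show "scal c m \<in> M" if "m \<in> M" for c m
    using that by (auto simp: region_module_def in_keys_iff lookup_scal)
qed

lemmas M_add = scal.subspace_add[OF M_subspace]
lemmas M_scal = scal.subspace_scale[OF M_subspace]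
lemmas M_sum = scal.subspace_sum[OF M_subspace]
lemmas M_0 = scal.subspace_0[OF M_subspace]

lemma e_M: "s \<in> \<Omega> \<Longrightarrow> e s \<in> M"
  by (simp add: region_module_def)

text \<open>Additivity and homogeneity are asked for on \<open>M\<close> only, since nothing is
  known about a given representation outside \<open>M\<close>.\<close>

lemma M_eqI:
  assumes f: "\<And>m m'. m \<in> M \<Longrightarrow> m' \<in> M \<Longrightarrow> f (m + m') = f m + f m'" "\<And>c m. m \<in> M \<Longrightarrow> f (scal c m) = scal c (f m)"
    and g: "\<And>m m'. m \<in> M \<Longrightarrow> m' \<in> M \<Longrightarrow> g (m + m') = g m + g m'" "\<And>c m. m \<in> M \<Longrightarrow> g (scal c m) = scal c (g m)"
    and eq: "\<And>s. s \<in> \<Omega> \<Longrightarrow> f (e s) = g (e s)" and m: "m \<in> M"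
  shows "f m = g m"
proof -
  have "A \<subseteq> \<Omega> \<Longrightarrow> f (\<Sum>s\<in>A. scal (c s) (e s)) = g (\<Sum>s\<in>A. scal (c s) (e s))" if "finite A" for A c
    using that
  proof (induction A rule: finite_induct)
    case empty
    show ?case using f(2)[OF M_0, of 0] g(2)[OF M_0, of 0] by simp
  next
    case (insert s A)
    have "(\<Sum>s\<in>A. scal (c s) (e s)) \<in> M"
      using insert.prems by (intro M_sum M_scal e_M) auto
    moreover have "scal (c s) (e s) \<in> M" "e s \<in> M" using insert.prems e_M M_scal by auto
    ultimately show ?case using insert f g eq by simp
  qed
  from this[of "Poly_Mapping.keys m" "Poly_Mapping.lookup m"] show ?thesis
    using region_moduleD[OF m] by (auto simp flip: scal_decomp)
qed

lemma islin_M_eqI: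
  assumes "islin f" "islin g" "\<And>s. s \<in> \<Omega> \<Longrightarrow> f (e s) = g (e s)" "m \<in> M"
  shows "f m = g m"
  by (rule islin_eqI[OF assms(1,2)]) (use assms(3) region_moduleD[OF assms(4)] in blast)

lemma islin_M:
  assumes f: "islin f" and e: "\<And>s. s \<in> \<Omega> \<Longrightarrow> f (e s) \<in> M" and m: "m \<in> M"
  shows "f m \<in> M"
proof -
  have "f m = (\<Sum>s\<in>Poly_Mapping.keys m. scal (Poly_Mapping.lookup m s) (f (e s)))"
    by (subst scal_decomp[of m]) (use f in \<open>simp add: islin_sum, simp add: islin_def\<close>)
  also have "\<dots> \<in> M" using region_moduleD[OF m] by (intro M_sum M_scal e) auto
  finally show ?thesis .
qed

lemma XX_M: "m \<in> M \<Longrightarrow> XX \<mu> m \<in> M"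
  by (rule islin_M[OF islin_XX]) (simp_all add: XX_e M_scal e_M)

lemma TT_M: assumes k: "k \<in> idx D" and m: "m \<in> M" shows "TT k m \<in> M"
proof (rule islin_M[OF islin_TT _ m])
  fix s assume s: "s \<in> \<Omega>"
  have "scal (qroot D k * cc k s * eps k s) (e (act (sr k) s)) \<in> M"
  proof (cases "eps k s = 0")
    case False
    then show ?thesis using weight_step[OF s k] M_scal e_M by blast
  qed (simp add: M_0)
  then show "TT k (e s) \<in> M" using s by (simp add: TT_e M_add M_scal e_M)
qed

lemma TTw_M: "set is \<subseteq> idx D \<Longrightarrow> m \<in> M \<Longrightarrow> TTw is m \<in> M"
  by (induction "is") (auto simp: TTw_simps TT_M)

lemma TT_quadratic_M:
  assumes k: "k \<in> idx D" and m: "m \<in> M"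
  shows "TT k (TT k m) = m + scal (zz k) (TT k m)"
proof (rule islin_M_eqI[OF _ _ _ m])
  show "islin (\<lambda>m. TT k (TT k m))" by (simp add: islin_def TT_add TT_scal)
  show "islin (\<lambda>m. m + scal (zz k) (TT k m))"
    by (simp add: islin_def TT_add TT_scal scal.scale_right_distrib mult.commute)
  fix s assume "s \<in> \<Omega>"
  then show "TT k (TT k (e s)) = e s + scal (zz k) (TT k (e s))"
    using TT_quadratic k by (metis region_weightE)
qed

lemma TT_cross_M:
  assumes k: "k \<in> idx D" and \<mu>: "\<mu> \<in> L" and m: "m \<in> M"
    and p: "p \<in> group_alg D" "p * c_den (al k) = c'_num D (al k) * (xpow \<mu> - xpow (sr k \<mu>))"
  shows "TT k (XX \<mu> m) - XX (sr k \<mu>) (TT k m) =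
    scal (qroot D k) (\<Sum>\<nu>\<in>Poly_Mapping.keys p. scal (Poly_Mapping.lookup p \<nu>) (XX \<nu> m))"
proof (rule islin_M_eqI[OF _ _ _ m])
  show "islin (\<lambda>m. TT k (XX \<mu> m) - XX (sr k \<mu>) (TT k m))"
    by (simp add: islin_def TT_add TT_scal XX_add XX_scal scal.scale_right_diff_distrib)
  show "islin (\<lambda>m. scal (qroot D k) (\<Sum>\<nu>\<in>Poly_Mapping.keys p. scal (Poly_Mapping.lookup p \<nu>) (XX \<nu> m)))"
    by (simp add: islin_def XX_add XX_scal scal.scale_right_distrib sum.distrib scal.scale_sum_right mult_ac)
  fix s assume "s \<in> \<Omega>"
  then have s: "s \<in> characters D" "good (al k) s" using k by (metis region_weightE)+
  have "(\<Sum>\<nu>\<in>Poly_Mapping.keys p. scal (Poly_Mapping.lookup p \<nu>) (XX \<nu> (e s))) = scal (ga_eval p s) (e s)"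
    by (simp add: XX_e ga_eval_def scal.scale_sum_left)
  then show "TT k (XX \<mu> (e s)) - XX (sr k \<mu>) (TT k (e s)) =
      scal (qroot D k) (\<Sum>\<nu>\<in>Poly_Mapping.keys p. scal (Poly_Mapping.lookup p \<nu>) (XX \<nu> (e s)))"
    using TT_cross[OF s(1) k s(2) \<mu> p] by simp
qed

lemma TTw_eq:
  assumes "reduced_word D is" "reduced_word D js" "we is = we js" "m \<in> M"
  shows "TTw is m = TTw js m"
proof -
  have "\<forall>m\<in>M. TTw is m = TTw js m"
  proof (rule matsumoto[OF subset_refl, where rel = "\<lambda>is js. \<forall>m\<in>M. TTw is m = TTw js m"])
    show "\<forall>m\<in>M. TTw (altw (cox i j) i j @ ks) m = TTw (altw (cox i j) j i @ ks) m"
      if "i \<in> idx D" "j \<in> idx D" "i \<noteq> j" "set ks \<subseteq> idx D" for i j ks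
    proof
      fix m assume "m \<in> M"
      then have ks: "TTw ks m \<in> M" using that TTw_M by blast
      have "TTw (altw (cox i j) i j) (TTw ks m) = TTw (altw (cox i j) j i) (TTw ks m)"
        by (rule islin_M_eqI[OF islin_TTw islin_TTw braid_e[OF _ that(1-3)] ks])
      then show "TTw (altw (cox i j) i j @ ks) m = TTw (altw (cox i j) j i @ ks) m"
        by (simp add: TTw_simps)
    qed
  qed (use assms in \<open>auto simp: TTw_simps reduced_iff\<close>)
  then show ?thesis using assms(4) by blast
qed

lemma XX_0_M: assumes "m \<in> M" shows "XX 0 m = m"
  using islin_M_eqI[OF islin_XX islin_id _ assms, of 0]
  by (simp add: XX_e) (metis char_0 region_weightE scal.scale_one)

lemma XX_mult_M: assumes "m \<in> M" "\<mu> \<in> L" "\<nu> \<in> L" shows "XX (\<mu> + \<nu>) m = XX \<mu> (XX \<nu> m)"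
proof (rule islin_M_eqI[OF islin_XX _ _ assms(1)])
  show "islin (\<lambda>m. XX \<mu> (XX \<nu> m))" by (simp add: islin_def XX_add XX_scal)
  fix s assume "s \<in> \<Omega>"
  then have "s (\<mu> + \<nu>) = s \<mu> * s \<nu>" using char_add assms by (metis region_weightE)
  then show "XX (\<mu> + \<nu>) (e s) = XX \<mu> (XX \<nu> (e s))" by (simp add: XX_e XX_scal mult.commute)
qed

definition wd :: "('v \<Rightarrow> 'v) \<Rightarrow> nat list" where
  "wd w = (SOME is. reduced_word D is \<and> we is = w)"

lemma wd: "w \<in> W0 D \<Longrightarrow> reduced_word D (wd w) \<and> we (wd w) = w"
  unfolding wd_def by (rule someI_ex) (metis reduced_ex)

text \<open>Prescribed on the basis \<open>Tw w * X \<mu>\<close> and extended linearly in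
  \<open>h\<close>; multiplicativity is then established one generator at a time, from the
  left.\<close>

definition R :: "'h \<Rightarrow> (('v \<Rightarrow> complex) \<Rightarrow>\<^sub>0 complex) \<Rightarrow> (('v \<Rightarrow> complex) \<Rightarrow>\<^sub>0 complex)" where
  "R h m = vector_space_pair.construct sH scal pbw_basis
     (\<lambda>b. case inv_into (W0 D \<times> L) (\<lambda>(w, \<mu>). Tw w * X \<mu>) b of (w, \<mu>) \<Rightarrow> TTw (wd w) (XX \<mu> m)) h"

lemma R_linear: "Vector_Spaces.linear sH scal (\<lambda>h. R h m)"
proof -
  interpret VP: vector_space_pair sH "scal :: complex \<Rightarrow> (('v \<Rightarrow> complex) \<Rightarrow>\<^sub>0 complex) \<Rightarrow> _" ..
  show ?thesis unfolding R_def using VP.linear_construct[OF pbw_basis_indep] by simp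
qed

lemma R_add: "R (h + k) m = R h m + R k m" and R_scale: "R (sH c h) m = scal c (R h m)"
proof -
  interpret R: Vector_Spaces.linear sH scal "\<lambda>h. R h m" by (rule R_linear)
  show "R (h + k) m = R h m + R k m" "R (sH c h) m = scal c (R h m)" by (rule R.add R.scale)+
qed

lemma R_sum: "R (sum f A) m = (\<Sum>a\<in>A. R (f a) m)"
proof -
  interpret R: Vector_Spaces.linear sH scal "\<lambda>h. R h m" by (rule R_linear)
  show ?thesis by (rule R.sum)
qed

lemma R_diff: "R (h - k) m = R h m - R k m"
proof -
  interpret R: Vector_Spaces.linear sH scal "\<lambda>h. R h m" by (rule R_linear)
  show ?thesis by (rule R.diff)
qed

lemma R_Tl:
  assumes r: "reduced_word D is" and \<mu>: "\<mu> \<in> L" and m: "m \<in> M"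
  shows "R (Tl is * X \<mu>) m = TTw is (XX \<mu> m)"
proof -
  interpret VP: vector_space_pair sH "scal :: complex \<Rightarrow> (('v \<Rightarrow> complex) \<Rightarrow>\<^sub>0 complex) \<Rightarrow> _" ..
  have W: "we is \<in> W0 D" using word_W0 r by (simp add: reduced_iff)
  let ?b = "Tw (we is) * X \<mu>"
  have "inv_into (W0 D \<times> L) (\<lambda>(w, \<mu>). Tw w * X \<mu>) ?b = (we is, \<mu>)"
    using inv_into_f_f[OF pbw_basis_inj, of "(we is, \<mu>)"] W \<mu> by simp
  moreover have "?b \<in> pbw_basis" using W \<mu> by (auto simp: pbw_basis_def)
  ultimately have "R ?b m = TTw (wd (we is)) (XX \<mu> m)"
    by (simp add: R_def VP.construct_basis[OF pbw_basis_indep])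
  also have "\<dots> = TTw is (XX \<mu> m)" using wd[OF W] r m by (intro TTw_eq XX_M) auto
  finally show ?thesis by (simp add: Tl_def Tw_word[OF r])
qed

lemma H_induct [case_names add scale base]:
  assumes add: "\<And>h k. P h \<Longrightarrow> P k \<Longrightarrow> P (h + k)" and scale: "\<And>c h. P h \<Longrightarrow> P (sH c h)"
    and base: "\<And>is \<mu>. reduced_word D is \<Longrightarrow> \<mu> \<in> L \<Longrightarrow> P (Tl is * X \<mu>)"
  shows "P h"
proof -
  have h: "h \<in> H.span pbw_basis" by (simp add: pbw_basis_span)
  have p0: "P 0" using scale[OF base[OF reduced_Nil L_0], of 0] by simp
  have step: "P (sH c x + y)" if x: "x \<in> pbw_basis" and y: "P y" for c x y
  proof -
    obtain w \<mu> where w: "w \<in> W0 D" "\<mu> \<in> L" "x = Tw w * X \<mu>" using x by (auto simp: pbw_basis_def)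
    then have "x = Tl (wd w) * X \<mu>" using Tw_word wd by (metis Tl_def)
    then show ?thesis using add scale base wd w y by simp
  qed
  show ?thesis by (rule H.span_induct_alt[OF h p0 step])
qed

lemma R_M: assumes m: "m \<in> M" shows "R h m \<in> M"
proof (induction h rule: H_induct)
  case (base "is" \<mu>)
  then show ?case using m by (auto simp: R_Tl reduced_iff intro!: TTw_M XX_M)
qed (auto simp: R_add R_scale M_add M_scal)

text \<open>Prepending a descent gives a word that is not reduced; the quadratic relation, valid
  both in the algebra and for the operators, rewrites it through reduced ones.\<close>

lemma R_T:
  assumes i: "i \<in> idx D" and m: "m \<in> M"
  shows "R (T i * h) m = TT i (R h m)"
proof (induction h rule: H_induct)
  case (base "is" \<mu>)
  have xm: "XX \<mu> m \<in> M" using m by (rule XX_M)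
  show ?case
  proof (cases "pos (inv (we is) (al i))")
    case True
    then have "reduced_word D (i # is)" using base i by (simp add: reduced_Cons)
    from R_Tl[OF this base(2) m] R_Tl[OF base m] show ?thesis by (simp add: Tl_simps TTw_simps mult.assoc)
  next
    case False
    obtain js where js: "reduced_word D js" "we js = sr i \<circ> we is" "Tl is = T i * Tl js"
      using T_descent[OF base(1) i False] .
    have W: "we is \<in> W0 D" using word_W0 base by (simp add: reduced_iff)
    have "we (i # js) = we is" by (simp only: word_elt_Cons js(2) sr_comp_sr[OF i])
    moreover have "reduced_word D (i # js)"
      using False pos_inv_sr[OF W i] i js by (simp add: reduced_Cons)
    ultimately have eq: "Tl is = T i * Tl js" "\<And>m. m \<in> M \<Longrightarrow> TTw is m = TT i (TTw js m)"
      using js(3) TTw_eq[OF base(1), of "i # js"] by (simp_all add: TTw_simps)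
    have "T i * (Tl is * X \<mu>) = (T i * T i) * (Tl js * X \<mu>)" by (simp add: eq mult.assoc)
    also have "\<dots> = Tl js * X \<mu> + sH (zz i) (Tl is * X \<mu>)"
      by (simp add: T_quad[OF i] distrib_right sH_mult eq mult.assoc)
    finally have "R (T i * (Tl is * X \<mu>)) m = TTw js (XX \<mu> m) + scal (zz i) (TTw is (XX \<mu> m))"
      using R_Tl[OF js(1) base(2) m] R_Tl[OF base m] by (simp add: R_add R_scale)
    also have "\<dots> = TT i (TTw is (XX \<mu> m))"
      unfolding eq(2)[OF xm]
      by (rule TT_quadratic_M[OF i TTw_M[OF _ xm], symmetric]) (use js(1) in \<open>simp add: reduced_iff\<close>)
    finally show ?thesis using R_Tl[OF base m] by simp
  qed
qed (auto simp: distrib_left sH_mult R_add R_scale TT_add TT_scal)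

text \<open>Moving \<open>X \<mu>\<close> through a letter produces a correction involving other
  lattice elements, so the induction is over all \<open>\<mu>\<close>. Both sides are kept in terms
  of \<open>R\<close>, because tails of the word need not be evaluated and the word need not be
  reduced.\<close>

lemma R_X_word:
  assumes \<nu>: "\<nu> \<in> L" and m: "m \<in> M"
  shows "set is \<subseteq> idx D \<Longrightarrow> \<mu> \<in> L \<Longrightarrow> R (X \<mu> * (Tl is * X \<nu>)) m = XX \<mu> (R (Tl is * X \<nu>) m)"
proof (induction "is" arbitrary: \<mu>)
  case Nil
  then show ?case
    using R_Tl[OF reduced_Nil L_add[OF Nil(2) \<nu>] m] R_Tl[OF reduced_Nil \<nu> m] XX_mult_M[OF m Nil(2) \<nu>] X_mult[OF Nil(2) \<nu>]
    by (simp add: Tl_simps TTw_simps)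
next
  case (Cons i "is")
  then have i: "i \<in> idx D" and is_idx: "set is \<subseteq> idx D" by auto
  let ?k = "Tl is * X \<nu>" and ?\<kappa> = "sr i \<mu>"
  have \<lambda>: "?\<kappa> \<in> L" using sr_L[OF i Cons.prems(2)] .
  have IH: "R (X \<mu> * ?k) m = XX \<mu> (R ?k m)" if "\<mu> \<in> L" for \<mu> by (rule Cons.IH[OF is_idx that])
  obtain p where p: "p \<in> group_alg D" "p * c_den (al i) = c'_num D (al i) * (xpow ?\<kappa> - xpow (sr i ?\<kappa>))"
    and pT: "T i * X ?\<kappa> - X (sr i ?\<kappa>) * T i = sH (qroot D i) (ga_embed sH X p)"
    using T_cross[OF i \<lambda>] by blast
  have pL: "Poly_Mapping.keys p \<subseteq> L" using p(1) by (simp add: group_alg_def)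
  have "X \<mu> * T i = T i * X ?\<kappa> - sH (qroot D i) (ga_embed sH X p)"
    unfolding pT[symmetric] by (simp add: sr_sr[OF i])
  then have "X \<mu> * (T i * ?k) = T i * (X ?\<kappa> * ?k) - sH (qroot D i) (ga_embed sH X p * ?k)"
    by (simp add: left_diff_distrib sH_mult flip: mult.assoc)
  then have "R (X \<mu> * (T i * ?k)) m = TT i (XX ?\<kappa> (R ?k m)) - scal (qroot D i) (R (ga_embed sH X p * ?k) m)"
    by (simp only: R_diff R_T[OF i m] R_scale IH[OF \<lambda>])
  also have "R (ga_embed sH X p * ?k) m =
      (\<Sum>\<nu>\<in>Poly_Mapping.keys p. scal (Poly_Mapping.lookup p \<nu>) (XX \<nu> (R ?k m)))"
    unfolding ga_embed_def sum_distrib_right R_sum sH_mult R_scale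
    by (rule sum.cong) (use pL IH in auto)
  also have "scal (qroot D i) \<dots> = TT i (XX ?\<kappa> (R ?k m)) - XX \<mu> (TT i (R ?k m))"
    using TT_cross_M[OF i \<lambda> R_M[OF m] p] by (simp only: sr_sr[OF i])
  finally show ?case using R_T[OF i m, of ?k] by (simp add: Tl_simps mult.assoc)
qed

lemma R_X:
  assumes \<mu>: "\<mu> \<in> L" and m: "m \<in> M"
  shows "R (X \<mu> * h) m = XX \<mu> (R h m)"
proof (induction h rule: H_induct)
  case (base "is" \<nu>)
  then show ?case using R_X_word[OF base(2) m _ \<mu>] by (simp add: reduced_iff)
qed (auto simp: distrib_left sH_mult R_add R_scale XX_add XX_scal)

lemma R_1: assumes m: "m \<in> M" shows "R 1 m = m"
  using R_Tl[OF reduced_Nil L_0 m] XX_0_M[OF m] by (simp add: Tl_simps TTw_simps X_0)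

lemma R_gen:
  assumes "m \<in> M"
  shows "i \<in> idx D \<Longrightarrow> R (T i) m = TT i m" "\<mu> \<in> L \<Longrightarrow> R (X \<mu>) m = XX \<mu> m"
  using R_T[OF _ assms, of i 1] R_X[OF _ assms, of \<mu> 1] R_1[OF assms] by simp_all

lemma R_mult: assumes m: "m \<in> M" shows "R (h * k) m = R h (R k m)"
proof (induction h rule: H_induct)
  case (base "is" \<mu>)
  have "set js \<subseteq> idx D \<Longrightarrow> R (Tl js * h) m = TTw js (R h m)" for js h
    by (induction js) (auto simp: Tl_simps TTw_simps mult.assoc R_T[OF _ m])
  then show ?case
    using base R_X[OF base(2) m] R_Tl[OF base R_M[OF m]] by (simp add: reduced_iff mult.assoc)
qed (auto simp: distrib_right sH_mult R_add R_scale)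

lemma R_lin: "m \<in> M \<Longrightarrow> m' \<in> M \<Longrightarrow> R h (m + m') = R h m + R h m'"
  and R_lin_scal: "m \<in> M \<Longrightarrow> R h (scal c m) = scal c (R h m)"
proof -
  show "R h (m + m') = R h m + R h m'" if "m \<in> M" "m' \<in> M"
  proof (induction h rule: H_induct)
    case (base "is" \<mu>)
    then show ?case using that islin_TTw[of "is"] by (simp add: R_Tl M_add XX_add islin_def)
  qed (auto simp: R_add R_scale scal.scale_right_distrib)
  show "R h (scal c m) = scal c (R h m)" if "m \<in> M"
  proof (induction h rule: H_induct)
    case (base "is" \<mu>)
    then show ?case using that islin_TTw[of "is"] by (simp add: R_Tl M_scal XX_scal islin_def)
  qed (auto simp: R_add R_scale scal.scale_right_distrib mult.commute)
qed

lemma basis_vec_e: "w \<in> F \<Longrightarrow> basis_vec D J t w = e (act w t)"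
  by (simp add: basis_vec_def)

lemma basis_vec_M: "w \<in> F \<Longrightarrow> basis_vec D J t w \<in> M"
  by (simp add: basis_vec_e e_M region_weights_def)

text \<open>Multiplication by \<open>eps\<close> has the same effect as the convention that vectors
  outside the region are zero; this is \<open>F_eps\<close> again.\<close>

lemma TT_basis_vec:
  assumes w: "w \<in> F" and i: "i \<in> idx D"
  shows "TT i (basis_vec D J t w) = scal (qroot D i * c'_val D i (act w t)) (basis_vec D J t w) +
    scal (qroot D i * cc i (act w t)) (basis_vec D J t (sr i \<circ> w))"
proof -
  let ?s = "act w t"
  note W = F_W0[OF J w]
  have s: "?s \<in> characters D" by (rule act_char[OF W t])
  have g: "good (al i) ?s" using no_poles w i good_iff[OF s i] by blast
  have "scal (eps i ?s) (e (act (sr i) ?s)) = basis_vec D J t (sr i \<circ> w)"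
    using F_eps[OF w i g] act_comp[OF W0_sr[OF i] W, of t]
    by (cases "sr i \<circ> w \<in> F") (auto simp: basis_vec_def eps_def split: if_splits)
  then have "scal (qroot D i * cc i ?s * eps i ?s) (e (act (sr i) ?s)) =
      scal (qroot D i * cc i ?s) (basis_vec D J t (sr i \<circ> w))"
    by (simp flip: scal.scale_scale)
  then show ?thesis
    using c'_val_cv[OF s i g] by (simp add: basis_vec_e[OF w] TT_e pp_def)
qed

definition rho :: "'h \<Rightarrow> (('v \<Rightarrow> complex) \<Rightarrow>\<^sub>0 complex) \<Rightarrow> (('v \<Rightarrow> complex) \<Rightarrow>\<^sub>0 complex)" where
  "rho h = restrict (R h) M"

lemma region_rep_rho: "region_rep D sH T X J t rho"
proof -
  have "representation sH scal M rho"
    unfolding representation_def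
    by (intro conjI allI ballI) (auto simp: rho_def vector_space_scal M_subspace R_M M_add M_scal R_lin R_lin_scal R_1 R_add R_mult R_scale)
  moreover have "x_formula D J t \<mu> (rho (X \<mu>))" if "\<mu> \<in> L" for \<mu>
    using that by (auto simp: x_formula_def rho_def basis_vec_M R_gen) (auto simp: basis_vec_e XX_e)
  moreover have "T_formula D J t i (rho (T i))" if "i \<in> idx D" for i
    using that by (auto simp: T_formula_def rho_def basis_vec_M R_gen TT_basis_vec)
  ultimately show ?thesis by (simp add: region_rep_def)
qed

lemma rep_eq:
  assumes rep: "region_rep D sH T X J t \<rho>" and m: "m \<in> M"
  shows "\<rho> h m = R h m"
proof -
  have R: "representation sH scal M \<rho>" and xf: "\<And>\<mu>. \<mu> \<in> L \<Longrightarrow> x_formula D J t \<mu> (\<rho> (X \<mu>))"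
    and Tf: "\<And>i. i \<in> idx D \<Longrightarrow> T_formula D J t i (\<rho> (T i))"
    using rep by (auto simp: region_rep_def)
  have lin: "\<rho> h (u + v) = \<rho> h u + \<rho> h v" "\<rho> h (scal c u) = scal c (\<rho> h u)" if "u \<in> M" "v \<in> M" for h u v c
    using R that by (auto simp: representation_def)
  have alg: "\<rho> (h + k) u = \<rho> h u + \<rho> k u" "\<rho> (h * k) u = \<rho> h (\<rho> k u)" "\<rho> (sH c h) u = scal c (\<rho> h u)" "\<rho> 1 u = u"
    if "u \<in> M" for h k c u
    using R that by (auto simp: representation_def)
  have ext: "\<rho> h u = f u" if "islin f" "\<And>w. w \<in> F \<Longrightarrow> \<rho> h (basis_vec D J t w) = f (basis_vec D J t w)" "u \<in> M" for h f u
  proof (rule M_eqI[OF _ _ _ _ _ that(3)])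
    fix s assume "s \<in> \<Omega>"
    then show "\<rho> h (e s) = f (e s)" using that(2) by (auto simp: region_weights_def basis_vec_e)
  qed (use that(1) lin in \<open>auto simp: islin_def\<close>)
  have X: "\<rho> (X \<mu>) u = XX \<mu> u" if "\<mu> \<in> L" "u \<in> M" for \<mu> u
    by (rule ext[OF islin_XX _ that(2)]) (use xf[OF that(1)] in \<open>auto simp: x_formula_def basis_vec_e XX_e\<close>)
  have T: "\<rho> (T i) u = TT i u" if "i \<in> idx D" "u \<in> M" for i u
    by (rule ext[OF islin_TT _ that(2)]) (use Tf[OF that(1)] that(1) in \<open>auto simp: T_formula_def TT_basis_vec\<close>)
  have Tl: "set is \<subseteq> idx D \<Longrightarrow> u \<in> M \<Longrightarrow> \<rho> (Tl is) u = TTw is u" for "is" u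
    by (induction "is") (auto simp: Tl_simps TTw_simps alg T TTw_M)
  show ?thesis
  proof (induction h rule: H_induct)
    case (base "is" \<mu>)
    then show ?case using m by (simp add: alg X Tl XX_M R_Tl reduced_iff)
  qed (simp_all add: alg m R_add R_scale)
qed

section \<open>Irreducibility and calibration\<close>

lemma M_spanned: "scal.span (e ` \<Omega>) = M"
proof
  show "scal.span (e ` \<Omega>) \<subseteq> M" by (rule scal.span_minimal) (use e_M M_subspace in auto)
  show "M \<subseteq> scal.span (e ` \<Omega>)"
  proof
    fix m assume "m \<in> M"
    then have "(\<Sum>s\<in>Poly_Mapping.keys m. scal (Poly_Mapping.lookup m s) (e s)) \<in> scal.span (e ` \<Omega>)"
      using region_moduleD by (intro scal.span_sum scal.span_scale scal.span_base) auto
    then show "m \<in> scal.span (e ` \<Omega>)" by (simp flip: scal_decomp)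
  qed
qed

text \<open>\<open>weight_sep\<close> isolates one basis vector from a nonzero element. Subtracting
  the diagonal entry of a generator then leaves a multiple of the neighbouring basis vector, whose
  coefficient is nonzero for steps inside the region.\<close>

lemma submodule_eq:
  assumes U: "scal.subspace U" "U \<subseteq> M" and inv: "\<And>h u. u \<in> U \<Longrightarrow> R h u \<in> U" and nz: "U \<noteq> {0}"
  shows "U = M"
proof -
  have UX: "XX \<mu> u \<in> U" if "\<mu> \<in> L" "u \<in> U" for \<mu> u
    using inv[OF that(2), of "X \<mu>"] R_gen(2)[OF _ that(1), of u] that(2) U(2) by auto
  have UT: "TT i u \<in> U" if "i \<in> idx D" "u \<in> U" for i u
    using inv[OF that(2), of "T i"] R_gen(1)[OF _ that(1), of u] that(2) U(2) by auto
  obtain m where m: "m \<in> U" "m \<noteq> 0" using nz scal.subspace_0[OF U(1)] by blast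
  then obtain s where s: "s \<in> Poly_Mapping.keys m" by (auto simp flip: keys_eq_empty)
  have keys: "r \<in> \<Omega>" if "r \<in> Poly_Mapping.keys m" for r using region_moduleD m(1) U(2) that by blast
  have ch: "r \<in> characters D" if "r \<in> Poly_Mapping.keys m" for r using region_weightE[OF keys[OF that]] by metis
  let ?c = "Poly_Mapping.lookup m"
  have "scal (?c s) (e s) \<in> U"
  proof (rule scal.weight_sep[OF U(1), where f = XX and A = L and S = "Poly_Mapping.keys m - {s}"
        and y = "\<lambda>r. scal (?c r) (e r)" and \<sigma> = "\<lambda>r. r" and \<tau> = s])
    have "scal (?c s) (e s) + (\<Sum>r\<in>Poly_Mapping.keys m - {s}. scal (?c r) (e r)) = m"
      using sum.remove[OF finite_keys s, of "\<lambda>r. scal (?c r) (e r)"] scal_decomp[of m] by (rule trans[OF sym sym])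
    then show "scal (?c s) (e s) + (\<Sum>r\<in>Poly_Mapping.keys m - {s}. scal (?c r) (e r)) \<in> U"
      using m(1) by (rule ssubst)
    show "\<exists>\<mu>\<in>L. r \<mu> \<noteq> s \<mu>" if r: "r \<in> Poly_Mapping.keys m - {s}" for r
    proof (rule ccontr)
      assume "\<not> ?thesis"
      then have "r = s" using char_eqI[OF ch ch[OF s], of r] r by blast
      then show False using r by simp
    qed
  qed (simp_all add: XX_add XX_scal XX_e UX mult.commute scal.subspace_0[OF U(1)])
  then have "scal (inverse (?c s)) (scal (?c s) (e s)) \<in> U" by (rule scal.subspace_scale[OF U(1)])
  then have es: "e s \<in> U" using s by (simp add: in_keys_iff)
  obtain w where w: "w \<in> F" "s = act w t" using region_weightE[OF keys[OF s]] by metis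
  have "e (act v t) \<in> U" if "v \<in> F" for v
  proof (rule F_connected[OF J w(1) _ _ that])
    show "e (act w t) \<in> U" using es w by simp
    fix v i assume v: "v \<in> F" "e (act v t) \<in> U" and i: "i \<in> idx D" and sv: "sr i \<circ> v \<in> F"
    let ?s = "act v t"
    note V = F_W0[OF J v(1)]
    have g: "good (al i) ?s" using no_poles v(1) i good_iff[OF act_char[OF V t] i] by blast
    have ep: "eps i ?s \<noteq> 0" using F_eps[OF v(1) i g] sv by simp
    define c where "c = qroot D i * cc i ?s * eps i ?s"
    have c: "c \<noteq> 0" using ep qr[OF i] by (auto simp: c_def eps_def split: if_splits)
    have "TT i (e ?s) - scal (pp i ?s) (e ?s) \<in> U"
      by (rule scal.subspace_diff[OF U(1) UT[OF i v(2)] scal.subspace_scale[OF U(1) v(2)]])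
    then have "scal c (e (act (sr i) ?s)) \<in> U" by (simp add: TT_e c_def)
    then have "scal (inverse c) (scal c (e (act (sr i) ?s))) \<in> U" by (rule scal.subspace_scale[OF U(1)])
    then show "e (act (sr i \<circ> v) t) \<in> U" using c by (simp add: act_comp[OF W0_sr[OF i] V])
  qed
  then have "e ` \<Omega> \<subseteq> U" by (auto simp: region_weights_def)
  then have "M \<subseteq> U" unfolding M_spanned[symmetric] by (rule scal.span_minimal[OF _ U(1)])
  then show ?thesis using U(2) by blast
qed

lemma irreducible:
  assumes rep: "region_rep D sH T X J t \<rho>"
  shows "irreducible_rep scal M \<rho>"
proof -
  obtain w where "w \<in> F" using F_ne by blast
  then have "e (act w t) \<in> M" using e_M by (simp add: region_weights_def)
  moreover have "e (act w t) \<noteq> 0" by (metis lookup_single_eq lookup_zero zero_neq_one)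
  ultimately have "M \<noteq> {0}" by blast
  moreover have "U = {0} \<or> U = M"
    if U: "scal.subspace U" "U \<subseteq> M" and inv: "\<forall>h. \<forall>u\<in>U. \<rho> h u \<in> U" for U
  proof -
    have "R h u \<in> U" if "u \<in> U" for h u
      using inv that U(2) rep_eq[OF rep, of u h] by (metis subsetD)
    then show ?thesis using submodule_eq[OF U] by blast
  qed
  ultimately show ?thesis unfolding irreducible_rep_def by blast
qed

text \<open>The lattice part acts diagonally, so a power of \<open>X \<mu> - c\<close> kills a
  vector only if \<open>s \<mu> = c\<close> at every weight of its support. Hence generalised weight
  vectors are weight vectors.\<close>

lemma R_X_power:
  assumes \<mu>: "\<mu> \<in> L" and m: "m \<in> M"
  shows "Poly_Mapping.lookup (R ((X \<mu> - sH c 1) ^ k) m) s = (s \<mu> - c) ^ k * Poly_Mapping.lookup m s"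
proof (induction k)
  case (Suc k)
  let ?n = "R ((X \<mu> - sH c 1) ^ k) m"
  have "R ((X \<mu> - sH c 1) ^ Suc k) m = XX \<mu> ?n - scal c ?n"
    using R_M[OF m] by (simp add: R_mult[OF m] R_diff R_scale R_1 R_gen(2)[OF _ \<mu>])
  then show ?case by (simp only: lookup_minus lookup_XX lookup_scal Suc) (simp add: algebra_simps)
qed (simp add: R_1 m)

lemma calibrated_region:
  assumes rep: "region_rep D sH T X J t \<rho>"
  shows "calibrated D sH X scal M \<rho>"
proof -
  have "finite (e ` \<Omega>)"
    using finite_subset[OF _ finite_W0, of F] F_W0[OF J] by (auto simp: region_weights_def)
  moreover have "e ` \<Omega> \<subseteq> M" using e_M by blast
  ultimately have "\<exists>B. finite B \<and> B \<subseteq> M \<and> scal.span B = M" using M_spanned by blast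
  moreover have "gen_weight_space D sH X M \<rho> \<tau> = weight_space D X scal M \<rho> \<tau>" for \<tau>
  proof -
    have "(\<exists>k>0. \<rho> ((X \<mu> - sH (\<tau> \<mu>) 1) ^ k) u = 0) \<longleftrightarrow> \<rho> (X \<mu>) u = scal (\<tau> \<mu>) u"
      if u: "u \<in> M" and \<mu>: "\<mu> \<in> L" for u \<mu>
    proof
      assume "\<exists>k>0. \<rho> ((X \<mu> - sH (\<tau> \<mu>) 1) ^ k) u = 0"
      then obtain k where k: "k > 0" "R ((X \<mu> - sH (\<tau> \<mu>) 1) ^ k) u = 0"
        using rep_eq[OF rep u] by auto
      have "s \<mu> * Poly_Mapping.lookup u s = \<tau> \<mu> * Poly_Mapping.lookup u s" for s
        using R_X_power[OF \<mu> u, of "\<tau> \<mu>" k s] k by auto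
      then have "XX \<mu> u = scal (\<tau> \<mu>) u" by (intro poly_mapping_eqI) (simp add: lookup_XX lookup_scal)
      then show "\<rho> (X \<mu>) u = scal (\<tau> \<mu>) u" using rep_eq[OF rep u] R_gen(2)[OF u \<mu>] by simp
    next
      assume "\<rho> (X \<mu>) u = scal (\<tau> \<mu>) u"
      then have "R ((X \<mu> - sH (\<tau> \<mu>) 1) ^ 1) u = 0"
        using rep_eq[OF rep u] by (simp add: R_diff R_scale R_1 u)
      then show "\<exists>k>0. \<rho> ((X \<mu> - sH (\<tau> \<mu>) 1) ^ k) u = 0"
        using rep_eq[OF rep u] by (intro exI[of _ 1]) simp
    qed
    then show ?thesis by (auto simp: gen_weight_space_def weight_space_def)
  qed
  ultimately show ?thesis unfolding calibrated_def by blast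
qed

lemma region_rep_unique: "\<exists>!\<rho>. region_rep D sH T X J t \<rho>"
proof (rule ex1I)
  show "region_rep D sH T X J t rho" by (rule region_rep_rho)
  fix \<rho> assume rep: "region_rep D sH T X J t \<rho>"
  have "\<rho> h \<in> M \<rightarrow>\<^sub>E M" for h using rep by (auto simp: region_rep_def representation_def)
  \<comment> \<open>Outside \<open>M\<close> both sides are \<open>undefined\<close> by
    extensionality, which makes uniqueness hold for functions on the whole type.\<close>
  then have "\<rho> h m = rho h m" for h m
    using rep_eq[OF rep, of m h] by (cases "m \<in> M") (auto simp: rho_def PiE_def extensional_def)
  then show "\<rho> = rho" by (intro ext)
qed

end

theorem theorem2p6:
  fixes D :: "'v::euclidean_space hecke_data"
    and sH :: "complex \<Rightarrow> 'h::ring_1 \<Rightarrow> 'h"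
    and T :: "nat \<Rightarrow> 'h" and Tw :: "('v \<Rightarrow> 'v) \<Rightarrow> 'h" and X :: "'v \<Rightarrow> 'h"
    and t :: "'v \<Rightarrow> complex" and J :: "'v set"
  assumes "hecke_datum D"
    and "affine_hecke_algebra D sH T Tw X"
    and "t \<in> characters D"
    and "J \<subseteq> N_set D t"
    and "F_set D J t \<noteq> {}"
    and "\<forall>w\<in>F_set D J t. \<forall>i\<in>idx D. \<forall>j\<in>idx D. i \<noteq> j \<longrightarrow> calibratable D i j (act w t)"
    and no_poles: "\<forall>w\<in>F_set D J t. \<forall>i\<in>idx D. ga_eval (d_fun D (sroot D i)) (act w t) \<noteq> 0"
  shows "(\<exists>!\<rho>. region_rep D sH T X J t \<rho>) \<and>
    (\<forall>\<rho>. region_rep D sH T X J t \<rho> \<longrightarrow>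
       irreducible_rep scal (region_module D J t) \<rho> \<and>
       calibrated D sH X scal (region_module D J t) \<rho>)"
proof -
  interpret region D sH T Tw X t J
    by unfold_locales (fact assms)+
  show ?thesis using region_rep_unique irreducible calibrated_region by blast
qed

end
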